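(* Let $\pi\subset V$ be an intersection of mirrors of $W$ of the form $\pi=\{x\in V\mid (\beta,x)=0\ \forall\beta\in\Gamma_0^v\}$ with parabolic stratum $D=\bigcup_{w\in W}w(\pi)$, and assume that the parabolic ideal of $D$ is $H_c$-invariant. Then the operator $\sum_{i=1}^N\nabla_i^2$ restricted to the $W$-invariant functions on $D$ has the generalized Calogero-Moser form $$\Big(\sum_{i=1}^N \nabla_i^2\Big)^{Res_\pi}=\Delta_y-\sum_{\alpha\in\mathcal R_+,\ \hat\alpha\neq 0}\frac{2c_\alpha}{(\hat\alpha,y)}\partial_{\hat\alpha},$$ where $y=(y_1,\dots,y_n)$ are orthonormal coordinates on $\pi$, $\Delta_y=\frac{\partial^2}{\partial y_1^2}+\dots+\frac{\partial^2}{\partial y_n^2}$, and $\hat\alpha$ is the orthogonal projection of $\alpha$ onto $\pi$. Moreover, for any polynomials $\sigma,\tau\in\mathbb C[x]^W$ the restrictions $\sigma(\nabla)^{Res_\pi}$ and $\tau(\nabla)^{Res_\pi}$ are commuting differential operators in the space $\pi$; in particular, the operator $\big(\sum_{i=1}^N \nabla_i^2\big)^{Res_\pi}$ is quantum integrable.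
   Context: Let $W$ be a finite real reflection group acting by orthogonal transformations in its complexified reflection representation $V=\mathbb C^N$, with $(\cdot,\cdot)$ the standard (complex bilinear) scalar product. Let $\mathcal R$ be the corresponding Coxeter root system (real vectors, $W$-invariant set, exactly one pair $\pm\alpha$ per reflection $s_\alpha\in W$), with positive subsystem $\mathcal R_+$, and let $\Gamma$ be the Coxeter graph, whose vertices are identified with the simple roots. $\Gamma_0\subset\Gamma$ is a subgraph (some vertices and all edges between them) and $\Gamma_0^v$ is the set of simple roots corresponding to its vertices. Let $c:\mathcal R\to\mathbb C$, $\alpha\mapsto c_\alpha$, be a $W$-invariant function. The Dunkl operators are $$\nabla_\xi=\partial_\xi-\sum_{\alpha\in\mathcal R_+}\frac{c_\alpha(\alpha,\xi)}{(\alpha,x)}(1-s_\alpha),\qquad \nabla_i=\nabla_{e_i},$$ where $s_\alpha$ is the orthogonal reflection in $(\alpha,x)=0$; they commute. For a polynomial $\sigma$, $\sigma(\nabla)=\sigma(\nabla_1,\dots,\nabla_N)$. The rational Cherednik algebra $H_c$ is considered in its polynomial representation: the algebra of operators on $\mathbb C[x]=\mathbb C[x_1,\dots,x_N]$ generated by multiplications by polynomials, $W$, and the Dunkl operators. The parabolic ideal of $D$ is the set of polynomials vanishing on $D$; it is $H_c$-invariant if preserved by all these operators. Restriction: assume the parabolic ideal of $D$ is $H_c$-invariant. Let $x_0\in\pi$ be generic, $U\subset\pi$ a small neighbourhood of $x_0$ in $\pi$, $U^W=\bigcup_{w\in W}w(U)$. An analytic function $f_\pi$ on $U$ determines a $W$-invariant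 function $f$ on $U^W$ with $f|_U=f_\pi$; let $\bar f$ be any $W$-invariant analytic extension of $f$ to $\bigcup_{w\in W}w(\tilde U)$, where $\tilde U\supset U$ is a small neighbourhood of $x_0$ in $V$. For $\sigma\in\mathbb C[x]^W$, $\sigma(\nabla)^{Res_\pi}$ is the operator $f_\pi\mapsto(\sigma(\nabla)\bar f)|_U$; the result does not depend on the choice of extension $\bar f$, by invariance of the ideal. A differential operator $L$ acting in $n$-dimensional space is called quantum integrable if there exist $n$ pairwise commuting differential operators $L_1=L,L_2,\dots,L_n$ which are algebraically independent. *)

theory Defs
  imports "HOL-Analysis.Analysis" "HOL-Library.Poly_Mapping"
begin

section \<open>Reflection groups in complexified Euclidean space\<close>

text \<open>The complex bilinear (not Hermitian) scalar product.\<close>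

definition bil :: "complex^'n \<Rightarrow> complex^'n \<Rightarrow> complex" where
  "bil x y = (\<Sum>i\<in>UNIV. x $ i * y $ i)"

definition refl :: "complex^'n \<Rightarrow> complex^'n \<Rightarrow> complex^'n" where
  "refl \<alpha> x = x - (2 * bil \<alpha> x / bil \<alpha> \<alpha>) *s \<alpha>"

text \<open>Roots are vectors with real entries inside the complexified space; lengths of roots are
  arbitrary, no crystallographic condition is imposed, and the roots need not span.\<close>

definition root_system :: "(complex^'n) set \<Rightarrow> bool" where
  "root_system R \<longleftrightarrow>
     finite R \<and> 0 \<notin> R \<and> (\<forall>\<alpha>\<in>R. \<forall>i. \<alpha> $ i \<in> \<real>) \<and>
     (\<forall>\<alpha>\<in>R. refl \<alpha> ` R = R) \<and>
     (\<forall>\<alpha>\<in>R. \<forall>t::real. t *\<^sub>R \<alpha> \<in> R \<longleftrightarrow> t = 1 \<or> t = -1)"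

text \<open>The group generated by the reflections; inverses are not needed as the generators are
  involutions.\<close>

inductive_set refl_group :: "(complex^'n) set \<Rightarrow> (complex^'n \<Rightarrow> complex^'n) set"
  for R :: "(complex^'n) set" where
  id: "id \<in> refl_group R"
| refl: "\<alpha> \<in> R \<Longrightarrow> w \<in> refl_group R \<Longrightarrow> refl \<alpha> \<circ> w \<in> refl_group R"

definition positive_roots :: "(complex^'n) set \<Rightarrow> (complex^'n) set \<Rightarrow> (complex^'n) set" where
  "positive_roots R \<Delta> =
     {\<alpha>\<in>R. \<exists>k::complex^'n \<Rightarrow> real. (\<forall>\<delta>\<in>\<Delta>. 0 \<le> k \<delta>) \<and> \<alpha> = (\<Sum>\<delta>\<in>\<Delta>. k \<delta> *\<^sub>R \<delta>)}"

text \<open>Here \<open>independent\<close> means linearly independent over the reals.\<close>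

definition simple_system :: "(complex^'n) set \<Rightarrow> (complex^'n) set \<Rightarrow> bool" where
  "simple_system R \<Delta> \<longleftrightarrow>
     \<Delta> \<subseteq> R \<and> independent \<Delta> \<and>
     (\<forall>\<alpha>\<in>R. \<alpha> \<in> positive_roots R \<Delta> \<or> - \<alpha> \<in> positive_roots R \<Delta>)"

definition invariant_multiplicity :: "(complex^'n) set \<Rightarrow> (complex^'n \<Rightarrow> complex) \<Rightarrow> bool" where
  "invariant_multiplicity R c \<longleftrightarrow> (\<forall>w\<in>refl_group R. \<forall>\<alpha>\<in>R. c (w \<alpha>) = c \<alpha>)"

definition orbit_union :: "(complex^'n) set \<Rightarrow> (complex^'n) set \<Rightarrow> (complex^'n) set" where
  "orbit_union R S = (\<Union>w\<in>refl_group R. w ` S)"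

definition orth_proj :: "(complex^'n) set \<Rightarrow> complex^'n \<Rightarrow> complex^'n" where
  "orth_proj S v = (THE p. p \<in> S \<and> (\<forall>q\<in>S. bil (v - p) q = 0))"


section \<open>Operators on functions and substitution into polynomials\<close>

type_synonym 'n operator = "(complex^'n \<Rightarrow> complex) \<Rightarrow> complex^'n \<Rightarrow> complex"

text \<open>A polynomial in variables indexed by \<^typ>\<open>'i\<close> is a finitely supported map from exponent
  vectors to coefficients.\<close>

type_synonym 'i mpoly = "('i \<Rightarrow>\<^sub>0 nat) \<Rightarrow>\<^sub>0 complex"

definition poly_eval :: "('n::finite) mpoly \<Rightarrow> complex^'n \<Rightarrow> complex" where
  "poly_eval p x = (\<Sum>m\<in>Poly_Mapping.keys p.
     Poly_Mapping.lookup p m * (\<Prod>i\<in>UNIV. (x $ i) ^ Poly_Mapping.lookup m i))"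

definition invariant_poly :: "(complex^'n) set \<Rightarrow> 'n mpoly \<Rightarrow> bool" where
  "invariant_poly R p \<longleftrightarrow> (\<forall>w\<in>refl_group R. \<forall>x. poly_eval p (w x) = poly_eval p x)"

text \<open>Substitution of operators \<open>T i\<close> for the variables listed in \<open>is\<close>. The list only fixes
  an order of the factors, which matters just for operators that do not commute.\<close>

definition op_monom :: "'i list \<Rightarrow> ('i \<Rightarrow> 'n operator) \<Rightarrow> ('i \<Rightarrow> nat) \<Rightarrow> 'n operator" where
  "op_monom is T m f = fold (\<lambda>i. T i ^^ m i) is f"

definition op_poly :: "'i list \<Rightarrow> ('i \<Rightarrow> 'n operator) \<Rightarrow> 'i mpoly \<Rightarrow> 'n operator" where
  "op_poly is T p f x = (\<Sum>m\<in>Poly_Mapping.keys p.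
     Poly_Mapping.lookup p m * op_monom is T (Poly_Mapping.lookup m) f x)"


section \<open>Analytic functions and differential operators\<close>

text \<open>Complex differentiability on \<open>S\<close>, where \<open>S\<close> is open in the whole space or relatively open
  in a complex subspace; in the latter case this is differentiability along that subspace.\<close>

definition analytic_fun :: "(complex^'n \<Rightarrow> complex) \<Rightarrow> (complex^'n) set \<Rightarrow> bool" where
  "analytic_fun f S \<longleftrightarrow>
     (\<forall>x\<in>S. \<exists>f'. (f has_derivative f') (at x within S) \<and> (\<forall>a v. f' (a *s v) = a * f' v))"

definition dderiv :: "complex^'n \<Rightarrow> 'n operator" where
  "dderiv \<xi> f x = deriv (\<lambda>t. f (x + t *s \<xi>)) 0"

definition orthonormal_coords ::
    "(complex^'n) set \<Rightarrow> nat \<Rightarrow> (nat \<Rightarrow> complex^'n) \<Rightarrow> bool" where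
  "orthonormal_coords S n e \<longleftrightarrow>
     S = range (\<lambda>y :: nat \<Rightarrow> complex. \<Sum>i<n. y i *s e i) \<and>
     (\<forall>i<n. \<forall>j<n. bil (e i) (e j) = (if i = j then 1 else 0))"

text \<open>The following notions concern operators on analytic functions on a relatively open subset
  \<open>U\<close> of an \<open>n\<close>-dimensional subspace with orthonormal basis \<open>e 0, \<dots>, e (n - 1)\<close>; the operator
  \<open>dderiv (e i)\<close> is the partial derivative in the \<open>i\<close>-th coordinate. Operators are considered
  only through their values on \<open>U\<close>.\<close>

definition diff_op ::
    "nat \<Rightarrow> (nat \<Rightarrow> complex^'n) \<Rightarrow> (complex^'n) set \<Rightarrow> 'n operator \<Rightarrow> bool" where
  "diff_op n e U L \<longleftrightarrow>
     (\<exists>(M :: (nat \<Rightarrow> nat) set) a. finite M \<and> (\<forall>m\<in>M. analytic_fun (a m) U) \<and>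
        (\<forall>f. analytic_fun f U \<longrightarrow>
          (\<forall>x\<in>U. L f x = (\<Sum>m\<in>M. a m x * op_monom [0..<n] (\<lambda>i. dderiv (e i)) m f x))))"

definition ops_commute :: "(complex^'n) set \<Rightarrow> 'n operator \<Rightarrow> 'n operator \<Rightarrow> bool" where
  "ops_commute U L L' \<longleftrightarrow> (\<forall>f. analytic_fun f U \<longrightarrow> (\<forall>x\<in>U. L (L' f) x = L' (L f) x))"

definition ops_alg_independent ::
    "nat \<Rightarrow> (complex^'n) set \<Rightarrow> (nat \<Rightarrow> 'n operator) \<Rightarrow> bool" where
  "ops_alg_independent n U Ls \<longleftrightarrow>
     (\<forall>p :: nat mpoly. (\<forall>m\<in>Poly_Mapping.keys p. Poly_Mapping.keys m \<subseteq> {..<n}) \<longrightarrow>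
        (\<forall>f. analytic_fun f U \<longrightarrow> (\<forall>x\<in>U. op_poly [0..<n] Ls p f x = 0)) \<longrightarrow> p = 0)"

text \<open>The commuting family is numbered from \<open>0\<close>, with \<open>L\<close> as its first member. On a
  zero-dimensional space the condition is void.\<close>

definition quantum_integrable ::
    "nat \<Rightarrow> (nat \<Rightarrow> complex^'n) \<Rightarrow> (complex^'n) set \<Rightarrow> 'n operator \<Rightarrow> bool" where
  "quantum_integrable n e U L \<longleftrightarrow>
     (\<exists>Ls. Ls 0 = L \<and> (\<forall>i<n. diff_op n e U (Ls i)) \<and>
        (\<forall>i<n. \<forall>j<n. ops_commute U (Ls i) (Ls j)) \<and> ops_alg_independent n U Ls)"


section \<open>Dunkl operators and the polynomial representation\<close>

text \<open>The quotient \<open>(f - f \<circ> s\<^sub>\<alpha>) / (\<alpha>, x)\<close> has a removable singularity along the mirror, where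
  it is extended by continuity.\<close>

definition refl_quotient :: "complex^'n \<Rightarrow> 'n operator" where
  "refl_quotient \<alpha> f x =
     (let q = (\<lambda>y. (f y - f (refl \<alpha> y)) / bil \<alpha> y)
      in if bil \<alpha> x \<noteq> 0 then q x else Lim (at x within {y. bil \<alpha> y \<noteq> 0}) q)"

definition dunkl ::
    "(complex^'n) set \<Rightarrow> (complex^'n \<Rightarrow> complex) \<Rightarrow> complex^'n \<Rightarrow> 'n operator" where
  "dunkl Rp c \<xi> f x = dderiv \<xi> f x - (\<Sum>\<alpha>\<in>Rp. c \<alpha> * bil \<alpha> \<xi> * refl_quotient \<alpha> f x)"

text \<open>Dunkl operators commute on analytic functions, so the enumeration of the coordinates chosen
  here is irrelevant.\<close>

definition poly_dunkl ::
    "(complex^'n) set \<Rightarrow> (complex^'n \<Rightarrow> complex) \<Rightarrow> 'n mpoly \<Rightarrow> 'n operator" where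
  "poly_dunkl Rp c \<sigma> =
     op_poly (SOME is. distinct is \<and> set is = UNIV) (\<lambda>i. dunkl Rp c (axis i 1)) \<sigma>"

definition dunkl_laplacian ::
    "(complex^'n) set \<Rightarrow> (complex^'n \<Rightarrow> complex) \<Rightarrow> 'n operator" where
  "dunkl_laplacian Rp c f x =
     (\<Sum>i\<in>UNIV. dunkl Rp c (axis i 1) (dunkl Rp c (axis i 1) f) x)"

inductive_set cherednik_algebra ::
    "(complex^'n) set \<Rightarrow> (complex^'n) set \<Rightarrow> (complex^'n \<Rightarrow> complex) \<Rightarrow> 'n operator set"
  for R Rp :: "(complex^'n) set" and c :: "complex^'n \<Rightarrow> complex" where
  mult: "(\<lambda>f x. poly_eval p x * f x) \<in> cherednik_algebra R Rp c"
| group: "w \<in> refl_group R \<Longrightarrow> (\<lambda>f x. f (w x)) \<in> cherednik_algebra R Rp c"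
| dunkl: "dunkl Rp c \<xi> \<in> cherednik_algebra R Rp c"
| add: "A \<in> cherednik_algebra R Rp c \<Longrightarrow> B \<in> cherednik_algebra R Rp c \<Longrightarrow>
    (\<lambda>f x. A f x + B f x) \<in> cherednik_algebra R Rp c"
| comp: "A \<in> cherednik_algebra R Rp c \<Longrightarrow> B \<in> cherednik_algebra R Rp c \<Longrightarrow>
    (\<lambda>f. A (B f)) \<in> cherednik_algebra R Rp c"

text \<open>Polynomials are identified with polynomial functions.\<close>

definition vanishing_ideal :: "(complex^'n) set \<Rightarrow> (complex^'n \<Rightarrow> complex) set" where
  "vanishing_ideal D = {f \<in> range poly_eval. \<forall>x\<in>D. f x = 0}"

definition cherednik_invariant ::
    "(complex^'n) set \<Rightarrow> (complex^'n) set \<Rightarrow> (complex^'n \<Rightarrow> complex) \<Rightarrow>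
     (complex^'n \<Rightarrow> complex) set \<Rightarrow> bool" where
  "cherednik_invariant R Rp c I \<longleftrightarrow> (\<forall>A\<in>cherednik_algebra R Rp c. \<forall>f\<in>I. A f \<in> I)"


section \<open>Restriction to a stratum\<close>

definition generic_point :: "(complex^'n) set \<Rightarrow> (complex^'n) set \<Rightarrow> complex^'n \<Rightarrow> bool" where
  "generic_point R P x \<longleftrightarrow>
     x \<in> P \<and> (\<forall>\<alpha>\<in>R. bil \<alpha> x = 0 \<longrightarrow> (\<forall>y\<in>P. bil \<alpha> y = 0))"

text \<open>Smallness of \<open>U\<close> is the condition needed for every function on \<open>U\<close> to have an invariant
  extension to the orbit of \<open>U\<close>; it forces all points of \<open>U\<close> to be generic.\<close>

definition small_neighbourhood ::
    "(complex^'n) set \<Rightarrow> (complex^'n) set \<Rightarrow> complex^'n \<Rightarrow> (complex^'n) set \<Rightarrow> bool" where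
  "small_neighbourhood R P x U \<longleftrightarrow>
     openin (top_of_set P) U \<and> x \<in> U \<and>
     (\<forall>w\<in>refl_group R. w ` U \<inter> U = {} \<or> (\<forall>u\<in>U. w u = u))"

definition invariant_extension ::
    "(complex^'n) set \<Rightarrow> (complex^'n) set \<Rightarrow> (complex^'n \<Rightarrow> complex) \<Rightarrow>
     (complex^'n \<Rightarrow> complex) \<Rightarrow> bool" where
  "invariant_extension R U f g \<longleftrightarrow>
     (\<exists>V. open V \<and> U \<subseteq> V \<and> analytic_fun g (orbit_union R V) \<and>
        (\<forall>w\<in>refl_group R. \<forall>x\<in>orbit_union R V. g (w x) = g x) \<and> (\<forall>x\<in>U. g x = f x))"

text \<open>The restriction of an operator \<open>A\<close> to functions on \<open>U\<close>. For \<open>A = \<sigma>(\<nabla>)\<close> and an invariant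
  parabolic ideal the values on \<open>U\<close> do not depend on the chosen extension.\<close>

definition restr_op :: "(complex^'n) set \<Rightarrow> (complex^'n) set \<Rightarrow> 'n operator \<Rightarrow> 'n operator" where
  "restr_op R U A f = A (SOME g. invariant_extension R U f g)"

end

theory Submission
  imports Defs "HOL-Complex_Analysis.Complex_Analysis"
begin

text \<open>Values of \<open>\<sigma>(\<nabla>)f\<close> at a point \<open>x\<close> depend only on finite jets of \<open>f\<close> on the \<open>W\<close>-orbit of \<open>x\<close>.
  Hence analytic functions may be replaced by polynomials with the same jets. An invariant analytic
  function which vanishes on the stratum agrees on the orbit, to any given order, with a polynomial
  of the parabolic ideal (multiply a Taylor polynomial by a polynomial which is 1 near \<open>x\<close> and 0 near
  the rest of the orbit and on the other components of the stratum, to high order, and average over \<open>W\<close>), so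
  invariance of the ideal shows that restrictions do not depend on the extension. With the extension
  that is constant in the normal directions, the Laplacian formula is a direct computation, and
  dependence on finite jets along \<open>\<pi>\<close> makes the restrictions differential operators. The Dunkl
  operators commute because their commutators commute with multiplication by linear functions.

  For integrability, invariant polynomials have arbitrary differentials along \<open>\<pi>\<close> at a generic point,
  and so do the homogeneous ones. This gives homogeneous invariants, \<open>\<Sum> x\<^sub>i\<^sup>2\<close> among them, which are
  algebraically independent on \<open>\<pi>\<close>; their restrictions to \<open>\<pi>\<close> are the symbols of the operators, so a
  relation between the operators would give one between the symbols.\<close>

text \<open>The hypothesis concerns polynomials, the conclusion analytic functions on a small open
  set; jets are what both share. Dunkl operators are nonlocal, so a jet at one point is not enough:
  the order of vanishing is controlled on a whole orbit, and functions live on open sets stable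
  under the reflections. Order of vanishing is a growth bound (\<open>vord\<close>). A derivative
  costs one order, and so does a reflection quotient on its mirror, where an integral formula
  replaces the division. \<open>restr_op\<close> picks an arbitrary extension with unknown domain,
  so every computation first passes to the extension by \<open>ret\<close>, which lives on the fixed
  set \<open>Om\<close>. Symbols are read off without a symbol calculus: apply the operator to a
  power of a linear form and keep the lowest order term at \<open>x\<close>. For a direction along
  the stratum, the reflections fixing \<open>x\<close> leave that linear form invariant and drop
  out. As the chosen invariants may have different degrees, a relation is sorted by weighted degree.
  The form \<open>bil\<close> has isotropic vectors; where definiteness is needed it comes from
  conjugation, since roots are real.\<close>

no_notation fps_nth (infixl "$" 75)

section \<open>The complex bilinear form and continuity of linear operations\<close>

lemma bil_add_left: "bil (x + y) z = bil x z + bil y z"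
  by (simp add: bil_def distrib_right sum.distrib)

lemma bil_add_right: "bil x (y + z) = bil x y + bil x z"
  by (simp add: bil_def distrib_left sum.distrib)

lemma bil_smult_left: "bil (a *s x) y = a * bil x y"
  by (simp add: bil_def sum_distrib_left mult.assoc)

lemma bil_smult_right: "bil x (a *s y) = a * bil x y"
  by (simp add: bil_def sum_distrib_left mult_ac)

lemma bil_commute: "bil x y = bil y x"
  by (simp add: bil_def mult.commute)

lemma bil_zero_left [simp]: "bil 0 x = 0" and bil_zero_right [simp]: "bil x 0 = 0"
  by (simp_all add: bil_def)

lemma bil_minus_left: "bil (- x) y = - bil x y"
  by (simp add: bil_def sum_negf)

lemma bil_minus_right: "bil x (- y) = - bil x y"
  by (simp add: bil_def sum_negf)

lemma bil_diff_left: "bil (x - y) z = bil x z - bil y z"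
  using bil_add_left[of x "- y" z] by (simp add: bil_minus_left)

lemma bil_diff_right: "bil x (y - z) = bil x y - bil x z"
  using bil_add_right[of x y "- z"] by (simp add: bil_minus_right)

lemma bil_sum_left: "bil (sum f A) y = (\<Sum>i\<in>A. bil (f i) y)"
  by (induction A rule: infinite_finite_induct) (auto simp: bil_add_left)

lemma bil_sum_right: "bil x (sum f A) = (\<Sum>i\<in>A. bil x (f i))"
  by (induction A rule: infinite_finite_induct) (auto simp: bil_add_right)

lemma bil_axis_left [simp]: "bil (axis i a) x = a * x $ i"
proof -
  have "bil (axis i a) x = (\<Sum>j\<in>UNIV. if j = i then a * x $ j else 0)"
    unfolding bil_def by (rule sum.cong) (auto simp: axis_def)
  then show ?thesis by simp
qed

lemma bil_axis_right [simp]: "bil x (axis i a) = a * x $ i"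
  using bil_axis_left bil_commute by metis

lemmas bil_simps = bil_add_left bil_add_right bil_smult_left bil_smult_right
  bil_minus_left bil_minus_right bil_diff_left bil_diff_right bil_sum_left bil_sum_right

lemma scaleR_eq_smult: "r *\<^sub>R (x::complex^'n) = of_real r *s x"
  by (simp add: vec_eq_iff scaleR_conv_of_real[where 'a=complex])

lemma norm_smult: "norm (a *s (x::complex^'n)) = cmod a * norm x"
  by (simp add: norm_vec_def L2_set_right_distrib norm_mult)

lemma linear_smult_left: "linear (\<lambda>t. t *s (x::complex^'n))"
  by (rule linearI) (auto simp: vec_eq_iff distrib_right scaleR_conv_of_real[where 'a=complex])

lemma linear_bil: "linear (\<lambda>x. bil a x)"
  by (rule linearI) (auto simp: bil_add_right scaleR_eq_smult bil_smult_right scaleR_conv_of_real)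

lemma bounded_linear_bil: "bounded_linear (\<lambda>x. bil a x)"
  using linear_bil linear_conv_bounded_linear by blast

lemma continuous_on_bil [continuous_intros]:
  "continuous_on S f \<Longrightarrow> continuous_on S (\<lambda>x. bil a (f x))"
  using bounded_linear.continuous_on[OF bounded_linear_bil] by blast

lemma continuous_on_smult [continuous_intros]:
  fixes g :: "'a::topological_space \<Rightarrow> complex^'n"
  assumes "continuous_on S f" "continuous_on S g"
  shows "continuous_on S (\<lambda>x. f x *s g x)"
  unfolding vector_scalar_mult_def
  by (intro continuous_on_vec_lambda continuous_intros assms)

section \<open>Analytic functions of several variables\<close>

lemma analytic_fun_open:
  assumes "open S"
  shows "analytic_fun f S \<longleftrightarrow>
    (\<forall>x\<in>S. \<exists>f'. (f has_derivative f') (at x) \<and> (\<forall>a v. f' (a *s v) = a * f' v))"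
  unfolding analytic_fun_def using at_within_open[OF _ assms] by auto

lemma analytic_fun_subset: "analytic_fun f T \<Longrightarrow> S \<subseteq> T \<Longrightarrow> analytic_fun f S"
  unfolding analytic_fun_def by (meson has_derivative_subset subset_iff)

lemma analytic_fun_cong:
  "analytic_fun f S \<Longrightarrow> (\<And>x. x \<in> S \<Longrightarrow> f x = g x) \<Longrightarrow> analytic_fun g S"
  unfolding analytic_fun_def by (metis has_derivative_transform)

lemma analytic_fun_local:
  assumes "\<And>x. x \<in> S \<Longrightarrow> \<exists>T. open T \<and> x \<in> T \<and> analytic_fun f (S \<inter> T)"
  shows "analytic_fun f S"
  unfolding analytic_fun_def
proof
  fix x assume x: "x \<in> S"
  from assms[OF x] obtain T where T: "open T" "x \<in> T" "analytic_fun f (S \<inter> T)" by blast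
  then have "at x within S \<inter> T = at x within S"
    by (intro at_within_nhd[of x T]) auto
  with T x show "\<exists>f'. (f has_derivative f') (at x within S) \<and> (\<forall>a v. f' (a *s v) = a * f' v)"
    unfolding analytic_fun_def by (metis IntI)
qed

lemma analytic_fun_const [simp]: "analytic_fun (\<lambda>x. a) S"
  unfolding analytic_fun_def by (auto intro!: exI[of _ "\<lambda>_. 0"])

lemma analytic_fun_bil: "analytic_fun (bil a) S"
  unfolding analytic_fun_def
  by (auto intro!: exI[of _ "bil a"] bounded_linear_imp_has_derivative bounded_linear_bil
      simp: bil_smult_right)

lemma analytic_fun_add:
  assumes "analytic_fun f S" "analytic_fun g S"
  shows "analytic_fun (\<lambda>x. f x + g x) S"
  unfolding analytic_fun_def
proof
  fix x assume x: "x \<in> S"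
  obtain f' g' where "(f has_derivative f') (at x within S)" "\<forall>a v. f' (a *s v) = a * f' v"
    "(g has_derivative g') (at x within S)" "\<forall>a v. g' (a *s v) = a * g' v"
    using assms x unfolding analytic_fun_def by metis
  then show "\<exists>h'. ((\<lambda>x. f x + g x) has_derivative h') (at x within S) \<and>
      (\<forall>a v. h' (a *s v) = a * h' v)"
    by (intro exI[of _ "\<lambda>v. f' v + g' v"]) (auto intro!: derivative_eq_intros simp: algebra_simps)
qed

lemma analytic_fun_mult:
  assumes "analytic_fun f S" "analytic_fun g S"
  shows "analytic_fun (\<lambda>x. f x * g x) S"
  unfolding analytic_fun_def
proof
  fix x assume x: "x \<in> S"
  obtain f' g' where "(f has_derivative f') (at x within S)" "\<forall>a v. f' (a *s v) = a * f' v"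
    "(g has_derivative g') (at x within S)" "\<forall>a v. g' (a *s v) = a * g' v"
    using assms x unfolding analytic_fun_def by metis
  then show "\<exists>h'. ((\<lambda>x. f x * g x) has_derivative h') (at x within S) \<and>
      (\<forall>a v. h' (a *s v) = a * h' v)"
    by (intro exI[of _ "\<lambda>v. f x * g' v + f' v * g x"])
      (auto intro!: derivative_eq_intros simp: algebra_simps)
qed

lemma analytic_fun_inverse:
  assumes "analytic_fun f S" "\<And>x. x \<in> S \<Longrightarrow> f x \<noteq> 0"
  shows "analytic_fun (\<lambda>x. inverse (f x)) S"
  unfolding analytic_fun_def
proof
  fix x assume x: "x \<in> S"
  obtain f' where "(f has_derivative f') (at x within S)" "\<forall>a v. f' (a *s v) = a * f' v"
    using assms x unfolding analytic_fun_def by metis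
  then show "\<exists>h'. ((\<lambda>x. inverse (f x)) has_derivative h') (at x within S) \<and>
      (\<forall>a v. h' (a *s v) = a * h' v)"
    using assms(2)[OF x]
    by (intro exI[of _ "\<lambda>v. - (inverse (f x) * f' v * inverse (f x))"])
      (auto intro!: derivative_eq_intros simp: algebra_simps)
qed

lemma analytic_fun_divide:
  assumes "analytic_fun f S" "analytic_fun g S" "\<And>x. x \<in> S \<Longrightarrow> g x \<noteq> 0"
  shows "analytic_fun (\<lambda>x. f x / g x) S"
  unfolding divide_inverse by (intro analytic_fun_mult analytic_fun_inverse assms)

lemma analytic_fun_cmult: "analytic_fun f S \<Longrightarrow> analytic_fun (\<lambda>x. a * f x) S"
  by (intro analytic_fun_mult analytic_fun_const)

lemma analytic_fun_diff:
  assumes "analytic_fun f S" "analytic_fun g S"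
  shows "analytic_fun (\<lambda>x. f x - g x) S"
  using analytic_fun_add[OF assms(1) analytic_fun_cmult[OF assms(2), of "-1"]] by simp

lemma analytic_fun_sum:
  "(\<And>i. i \<in> I \<Longrightarrow> analytic_fun (f i) S) \<Longrightarrow> analytic_fun (\<lambda>x. \<Sum>i\<in>I. f i x) S"
  by (induction I rule: infinite_finite_induct) (auto intro: analytic_fun_add)

lemma analytic_fun_prod:
  "(\<And>i. i \<in> I \<Longrightarrow> analytic_fun (f i) S) \<Longrightarrow> analytic_fun (\<lambda>x. \<Prod>i\<in>I. f i x) S"
  by (induction I rule: infinite_finite_induct) (auto intro: analytic_fun_mult)

lemma analytic_fun_power: "analytic_fun f S \<Longrightarrow> analytic_fun (\<lambda>x. f x ^ k) S"
  by (induction k) (auto intro: analytic_fun_mult)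

text \<open>No openness is assumed, so this also covers \<open>proj\<close>, which maps an open set
  into the merely relatively open \<open>U\<close>.\<close>

lemma analytic_fun_compose:
  assumes f: "analytic_fun f T" and L: "linear L" "\<And>a v. L (a *s v) = a *s L v"
    and sub: "\<And>x. x \<in> S \<Longrightarrow> b + L x \<in> T"
  shows "analytic_fun (\<lambda>x. f (b + L x)) S"
  unfolding analytic_fun_def
proof
  fix x assume x: "x \<in> S"
  obtain f' where f': "(f has_derivative f') (at (b + L x) within T)" "\<forall>a v. f' (a *s v) = a * f' v"
    using f sub[OF x] unfolding analytic_fun_def by metis
  have 1: "((\<lambda>x. b + L x) has_derivative L) (at x within S)"
    using has_derivative_add[OF has_derivative_const[of b] bounded_linear_imp_has_derivative[of L]] L(1)
    by (simp add: linear_conv_bounded_linear)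
  have "(f has_derivative f') (at (b + L x) within (\<lambda>x. b + L x) ` S)"
    by (rule has_derivative_subset[OF f'(1)]) (use sub in blast)
  from has_derivative_in_compose[OF 1 this]
  have "((\<lambda>x. f (b + L x)) has_derivative (\<lambda>v. f' (L v))) (at x within S)" .
  with f'(2) L(2) show "\<exists>h'. ((\<lambda>x. f (b + L x)) has_derivative h') (at x within S) \<and>
      (\<forall>a v. h' (a *s v) = a * h' v)"
    by (intro exI[of _ "\<lambda>v. f' (L v)"]) auto
qed

lemma analytic_fun_compose_linear:
  assumes "analytic_fun f T" "linear L" "\<And>a v. L (a *s v) = a *s L v"
    and "\<And>x. x \<in> S \<Longrightarrow> L x \<in> T"
  shows "analytic_fun (\<lambda>x. f (L x)) S"
  using analytic_fun_compose[of f T L S 0] assms by simp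

lemma analytic_fun_continuous: "analytic_fun f S \<Longrightarrow> continuous_on S f"
  unfolding analytic_fun_def
  by (meson continuous_on_eq_continuous_within has_derivative_continuous)

lemma line_has_derivative: "((\<lambda>t. x + t *s \<xi>) has_derivative (\<lambda>h. h *s \<xi>)) (at t within T)"
  for \<xi> :: "complex^'n"
proof -
  have "bounded_linear (\<lambda>t. t *s \<xi>)"
    using linear_smult_left linear_conv_bounded_linear by blast
  from bounded_linear_imp_has_derivative[OF this] show ?thesis
    by (auto intro!: derivative_eq_intros)
qed

text \<open>Bridge to one complex variable: Cauchy's formula and estimates, Taylor's formula and the
  identity theorem are all applied on such lines.\<close>

lemma analytic_fun_slice:
  assumes "open S" "analytic_fun f S" "x + t *s \<xi> \<in> S"
  shows "((\<lambda>t. f (x + t *s \<xi>)) has_field_derivative dderiv \<xi> f (x + t *s \<xi>)) (at t)"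
    and "\<exists>f'. (f has_derivative f') (at (x + t *s \<xi>)) \<and> f' \<xi> = dderiv \<xi> f (x + t *s \<xi>)"
proof -
  obtain f' where f': "(f has_derivative f') (at (x + t *s \<xi>))" "\<And>a v. f' (a *s v) = a * f' v"
    using assms analytic_fun_open by metis
  have *: "((\<lambda>t. f (z + t *s \<xi>)) has_field_derivative f' \<xi>) (at s)" if "z + s *s \<xi> = x + t *s \<xi>" for z s
  proof -
    have "(f has_derivative f') (at (z + s *s \<xi>))" using f' that by simp
    from has_derivative_compose[OF line_has_derivative this]
    have "((\<lambda>t. f (z + t *s \<xi>)) has_derivative (\<lambda>h. f' (h *s \<xi>))) (at s)" .
    moreover have "(\<lambda>h. f' (h *s \<xi>)) = (*) (f' \<xi>)" by (auto simp: f'(2))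
    ultimately show ?thesis by (simp add: has_field_derivative_def)
  qed
  have "f' \<xi> = dderiv \<xi> f (x + t *s \<xi>)"
    unfolding dderiv_def using *[of "x + t *s \<xi>" 0] DERIV_imp_deriv by fastforce
  with *[of x t] f' show "((\<lambda>t. f (x + t *s \<xi>)) has_field_derivative dderiv \<xi> f (x + t *s \<xi>)) (at t)"
    and "\<exists>f'. (f has_derivative f') (at (x + t *s \<xi>)) \<and> f' \<xi> = dderiv \<xi> f (x + t *s \<xi>)"
    by auto
qed

lemma has_derivative_dderiv:
  assumes "open S" "analytic_fun f S" "x \<in> S"
  shows "(f has_derivative (\<lambda>\<xi>. dderiv \<xi> f x)) (at x)"
proof -
  obtain f' where f': "(f has_derivative f') (at x)"
    using assms analytic_fun_open by metis
  have "f' \<xi> = dderiv \<xi> f x" for \<xi>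
    using analytic_fun_slice(2)[OF assms(1,2), of x 0 \<xi>] assms(3) f' has_derivative_unique
    by (metis add.right_neutral vector_smult_lzero)
  then have "f' = (\<lambda>\<xi>. dderiv \<xi> f x)" by auto
  with f' show ?thesis by simp
qed

text \<open>\<open>has_derivative\<close> yields a real-linear map only; the last premise makes it
  complex linear, as \<open>deriv\<close> along a complex line requires.\<close>

lemma dderiv_eqI:
  assumes "(f has_derivative f') (at x)" "f' \<xi> = d" "\<And>a v. f' (a *s v) = a * f' v"
  shows "dderiv \<xi> f x = d"
proof -
  have "((\<lambda>t. f (x + t *s \<xi>)) has_derivative (\<lambda>h. f' (h *s \<xi>))) (at 0)"
    using has_derivative_compose[OF line_has_derivative, of f f' x 0 \<xi>] assms(1) by simp
  moreover have "(\<lambda>h. f' (h *s \<xi>)) = (*) (f' \<xi>)" by (auto simp: assms(3))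
  ultimately have "((\<lambda>t. f (x + t *s \<xi>)) has_field_derivative f' \<xi>) (at 0)"
    by (simp add: has_field_derivative_def)
  then show ?thesis unfolding dderiv_def using DERIV_imp_deriv assms(2) by blast
qed

lemma dderiv_cong_open:
  assumes "open S" "x \<in> S" "\<And>y. y \<in> S \<Longrightarrow> f y = g y"
  shows "dderiv \<xi> f x = dderiv \<xi> g x"
proof -
  have "continuous_on UNIV (\<lambda>t. x + t *s \<xi>)" by (intro continuous_intros)
  then have "open ((\<lambda>t. x + t *s \<xi>) -` S)" using assms(1) open_vimage by blast
  then have "eventually (\<lambda>t. t \<in> (\<lambda>t. x + t *s \<xi>) -` S) (nhds 0)"
    using assms(2) by (intro eventually_nhds_in_open) auto
  then have "eventually (\<lambda>t. f (x + t *s \<xi>) = g (x + t *s \<xi>)) (nhds 0)"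
    by (rule eventually_mono) (use assms(3) in auto)
  then show ?thesis unfolding dderiv_def by (intro deriv_cong_ev) auto
qed

lemma dderiv_smult_dir:
  assumes "open S" "analytic_fun f S" "x \<in> S"
  shows "dderiv (a *s \<xi>) f x = a * dderiv \<xi> f x"
proof -
  obtain f' where f': "(f has_derivative f') (at x)" "\<And>a v. f' (a *s v) = a * f' v"
    using assms analytic_fun_open by metis
  show ?thesis using dderiv_eqI[OF f'(1) _ f'(2)] f'(2) by metis
qed

lemma dderiv_add_dir:
  assumes "open S" "analytic_fun f S" "x \<in> S"
  shows "dderiv (\<xi> + \<eta>) f x = dderiv \<xi> f x + dderiv \<eta> f x"
  using has_derivative_linear[OF has_derivative_dderiv[OF assms]] linear_add by blast

lemma dderiv_sum_dir:
  assumes "open S" "analytic_fun f S" "x \<in> S"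
  shows "dderiv (\<Sum>i\<in>I. a i *s v i) f x = (\<Sum>i\<in>I. a i * dderiv (v i) f x)"
  using linear_sum[OF has_derivative_linear[OF has_derivative_dderiv[OF assms]], of "\<lambda>i. a i *s v i" I]
  by (simp add: dderiv_smult_dir[OF assms])

lemma vec_eq_sum_axis: "(v :: complex^'n) = (\<Sum>i\<in>UNIV. v $ i *s axis i 1)"
  using basis_expansion[of v] by (simp add: vec_eq_iff)

lemma dderiv_eq_sum:
  assumes "open S" "analytic_fun f S" "x \<in> S"
  shows "dderiv v f x = (\<Sum>i\<in>UNIV. v $ i * dderiv (axis i 1) f x)"
  using dderiv_sum_dir[OF assms, of "\<lambda>i. v $ i" "\<lambda>i. axis i 1" UNIV] vec_eq_sum_axis[of v] by simp

lemma dderiv_add: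
  assumes "open S" "analytic_fun f S" "analytic_fun g S" "x \<in> S"
  shows "dderiv \<xi> (\<lambda>x. f x + g x) x = dderiv \<xi> f x + dderiv \<xi> g x"
  by (rule dderiv_eqI[OF has_derivative_add[OF has_derivative_dderiv has_derivative_dderiv]])
    (use assms in \<open>auto simp: dderiv_smult_dir algebra_simps\<close>)

lemma dderiv_mult:
  assumes "open S" "analytic_fun f S" "analytic_fun g S" "x \<in> S"
  shows "dderiv \<xi> (\<lambda>x. f x * g x) x = f x * dderiv \<xi> g x + dderiv \<xi> f x * g x"
  by (rule dderiv_eqI[OF has_derivative_mult[OF has_derivative_dderiv has_derivative_dderiv]])
    (use assms in \<open>auto simp: dderiv_smult_dir algebra_simps\<close>)

lemma dderiv_const [simp]: "dderiv \<xi> (\<lambda>x. a) x = 0"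
  by (simp add: dderiv_def)

lemma dderiv_bil [simp]: "dderiv \<xi> (bil a) x = bil a \<xi>"
  by (rule dderiv_eqI[OF bounded_linear_imp_has_derivative[OF bounded_linear_bil]])
    (auto simp: bil_smult_right)

lemma dderiv_cmult:
  assumes "open S" "analytic_fun f S" "x \<in> S"
  shows "dderiv \<xi> (\<lambda>x. a * f x) x = a * dderiv \<xi> f x"
  using dderiv_mult[of S "\<lambda>_. a" f x \<xi>] assms by simp

lemma dderiv_diff:
  assumes "open S" "analytic_fun f S" "analytic_fun g S" "x \<in> S"
  shows "dderiv \<xi> (\<lambda>x. f x - g x) x = dderiv \<xi> f x - dderiv \<xi> g x"
  using dderiv_add[OF assms(1,2) analytic_fun_cmult[OF assms(3), of "-1"] assms(4), of \<xi>]
    dderiv_cmult[OF assms(1,3,4), of \<xi> "-1"] by simp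

lemma dderiv_sum:
  assumes "open S" "\<And>i. i \<in> I \<Longrightarrow> analytic_fun (f i) S" "x \<in> S"
  shows "dderiv \<xi> (\<lambda>x. \<Sum>i\<in>I. f i x) x = (\<Sum>i\<in>I. dderiv \<xi> (f i) x)"
  using assms(2)
proof (induction I rule: infinite_finite_induct)
  case (insert i I)
  have "dderiv \<xi> (\<lambda>x. f i x + (\<Sum>i\<in>I. f i x)) x = dderiv \<xi> (f i) x + dderiv \<xi> (\<lambda>x. \<Sum>i\<in>I. f i x) x"
    by (rule dderiv_add[OF assms(1) _ _ assms(3)]) (use insert in \<open>auto intro!: analytic_fun_sum\<close>)
  then show ?case using insert by simp
qed auto

lemma dderiv_linear_compose:
  assumes "\<And>u v. L (u + v) = L u + L v" "\<And>a v. L (a *s v) = a *s L v"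
  shows "dderiv \<xi> (\<lambda>x. f (b + L x)) x = dderiv (L \<xi>) f (b + L x)"
  by (simp add: dderiv_def assms add.assoc)

section \<open>Cauchy integrals and analyticity of derivatives\<close>

text \<open>The circle is parametrised over a fixed real interval, so that the formula can be
  differentiated in \<open>x\<close> under an ordinary integral sign.\<close>

lemma dderiv_Cauchy:
  fixes f :: "complex^'n \<Rightarrow> complex"
  assumes "open S" "analytic_fun f S" "0 < r" "\<And>t. cmod t \<le> r \<Longrightarrow> x + t *s \<xi> \<in> S"
  shows "((\<lambda>s. f (x + (of_real r * exp (2 * of_real pi * \<i> * of_real s)) *s \<xi>) /
      (of_real r * exp (2 * of_real pi * \<i> * of_real s))) has_integral dderiv \<xi> f x) {0..1}"
proof -
  define g where "g t = f (x + t *s \<xi>)" for t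
  have g: "(g has_field_derivative dderiv \<xi> f (x + t *s \<xi>)) (at t)" if "cmod t \<le> r" for t
    unfolding g_def using analytic_fun_slice(1)[OF assms(1,2)] assms(4) that by blast
  have hol: "g holomorphic_on cball 0 r"
    unfolding holomorphic_on_def using g
    by (metis field_differentiable_at_within field_differentiable_def mem_cball_0)
  have "((\<lambda>u. g u / (u - 0) ^ Suc 1) has_contour_integral
      (2 * pi * \<i> / fact 1 * (deriv ^^ 1) g 0)) (circlepath 0 r)"
    by (rule Cauchy_has_contour_integral_higher_derivative_circlepath)
      (use hol assms(3) in \<open>auto intro: holomorphic_on_imp_continuous_on holomorphic_on_subset\<close>)
  moreover have "deriv g 0 = dderiv \<xi> f x"
    using DERIV_imp_deriv[OF g[of 0]] assms(3) by simp
  ultimately have "((\<lambda>s. g (circlepath 0 r s) / circlepath 0 r s ^ 2 *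
      vector_derivative (circlepath 0 r) (at s within {0..1})) has_integral
      (2 * pi * \<i> * dderiv \<xi> f x)) {0..1}"
    by (simp add: has_contour_integral_def power2_eq_square)
  then have "((\<lambda>s. (1 / (2 * pi * \<i>)) * (g (circlepath 0 r s) / circlepath 0 r s ^ 2 *
      vector_derivative (circlepath 0 r) (at s within {0..1}))) has_integral
      (1 / (2 * pi * \<i>)) * (2 * pi * \<i> * dderiv \<xi> f x)) {0..1}"
    by (rule has_integral_mult_right)
  moreover have "(1 / (2 * pi * \<i>)) * (g (circlepath 0 r s) / circlepath 0 r s ^ 2 *
      vector_derivative (circlepath 0 r) (at s within {0..1})) =
    g (of_real r * exp (2 * of_real pi * \<i> * of_real s)) /
      (of_real r * exp (2 * of_real pi * \<i> * of_real s))" if "s \<in> {0..1}" for s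
  proof -
    have "0 \<le> s" "s \<le> 1" using that by auto
    from vector_derivative_circlepath01[OF this, of 0 r] show ?thesis
      using assms(3) by (simp only: circlepath) (simp add: divide_simps power2_eq_square)
  qed
  ultimately show ?thesis
    unfolding g_def
    by (subst (asm) has_integral_cong) (auto simp: g_def)
qed

text \<open>Differentiation under the integral sign needs a jointly continuous derivative. Cauchy's
  formula writes the derivative as an integral of \<open>F\<close> over a circle, so joint
  continuity of \<open>F\<close> suffices.\<close>

lemma analytic_fun_integral:
  fixes F :: "complex^'n \<Rightarrow> real \<Rightarrow> complex"
  assumes S: "open S" and F: "\<And>t. t \<in> {0..1} \<Longrightarrow> analytic_fun (\<lambda>x. F x t) S"
    and cont: "continuous_on (S \<times> {0..1}) (\<lambda>(x, t). F x t)"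
  shows "analytic_fun (\<lambda>x. integral {0..1} (F x)) S"
  unfolding analytic_fun_open[OF S]
proof
  fix x0 assume "x0 \<in> S"
  then obtain e where e: "0 < e" "ball x0 e \<subseteq> S" using S openE by blast
  \<comment> \<open>Half the radius keeps circles of radius \<open>r\<close> about points of
    \<open>U\<close> inside \<open>ball x0 e\<close>.\<close>
  define r where "r = e / 2"
  have r: "0 < r" using e by (simp add: r_def)
  define U where "U = ball x0 r"
  define E where "E s = of_real r * exp (2 * of_real pi * \<i> * of_real s)" for s :: real
  have normE: "cmod (E s) = r" for s using r by (simp add: E_def norm_mult)
  have US: "y + t *s axis i 1 \<in> S" if "y \<in> U" "cmod t \<le> r" for y t and i :: 'n
  proof -
    have "dist x0 (y + t *s axis i 1) \<le> dist x0 y + dist y (y + t *s axis i 1)"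
      by (rule dist_triangle)
    also have "dist y (y + t *s axis i 1) = cmod t" by (simp add: dist_norm norm_smult norm_axis_1)
    also have "dist x0 y + cmod t < e" using that by (simp add: U_def r_def)
    finally show ?thesis using e by auto
  qed
  have US0: "U \<subseteq> S" using e r by (auto simp: U_def r_def)
  define G where "G i x t = dderiv (axis i 1) (\<lambda>x. F x t) x" for i x t
  have G: "G i x t = integral (cbox 0 1) (\<lambda>s. F (x + E s *s axis i 1) t / E s)"
    if "x \<in> U" "t \<in> {0..1}" for i x t
    unfolding G_def E_def cbox_interval
    by (rule integral_unique[OF dderiv_Cauchy[OF S F[OF that(2)] r US[OF that(1)]], symmetric])
  have contE: "continuous_on T (\<lambda>x. E (h x))" if "continuous_on T h" for T and h :: "_ \<Rightarrow> real"
    unfolding E_def by (intro continuous_intros that)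
  have "continuous_on (U \<times> {0..1}) (\<lambda>p. integral (cbox 0 1) (\<lambda>s. F (fst p + E s *s axis i 1) (snd p) / E s))" for i
  proof (rule integral_continuous_on_param)
    have "continuous_on ((U \<times> {0..1}) \<times> cbox 0 1)
       (\<lambda>q. (\<lambda>(x, t). F x t) (fst (fst q) + E (snd q) *s axis i 1, snd (fst q)))"
      by (rule continuous_on_compose2[OF cont])
        (use US in \<open>auto intro!: continuous_intros contE simp: normE\<close>)
    moreover have "E s \<noteq> 0" for s using normE[of s] r by auto
    ultimately show "continuous_on ((U \<times> {0..1}) \<times> cbox 0 1)
        (\<lambda>(p, s). F (fst p + E s *s axis i 1) (snd p) / E s)"
      unfolding case_prod_unfold by (intro continuous_intros contE) auto
  qed
  then have contG: "continuous_on (U \<times> {0..1}) (\<lambda>p. G i (fst p) (snd p))" for i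
    by (rule continuous_on_eq) (use G in auto)
  \<comment> \<open>\<open>leibniz_rule\<close> asks for continuity in the operator norm, so the
    derivative is assembled from partial derivatives and coordinate functionals.\<close>
  define pr :: "'n \<Rightarrow> (complex^'n) \<Rightarrow>\<^sub>L complex" where "pr i = Blinfun (\<lambda>v. v $ i)" for i
  have pr: "blinfun_apply (pr i) v = v $ i" for i v
    unfolding pr_def by (simp add: bounded_linear_Blinfun_apply bounded_linear_vec_nth)
  define fx where "fx x t = (\<Sum>i\<in>UNIV. blinfun_mult_left (G i x t) o\<^sub>L pr i)" for x t
  have fx: "blinfun_apply (fx x t) v = dderiv v (\<lambda>x. F x t) x" if "x \<in> S" "t \<in> {0..1}" for x t v
    using dderiv_eq_sum[OF S F[OF that(2)] that(1), of v]
    by (simp add: fx_def blinfun.sum_left pr G_def)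
  have contfx: "continuous_on (U \<times> cbox 0 1) (\<lambda>(x, t). fx x t)"
    unfolding fx_def case_prod_unfold
    by (rule continuous_on_sum, rule bounded_bilinear.continuous_on[OF bounded_bilinear_blinfun_compose],
        rule bounded_linear.continuous_on[OF bounded_linear_blinfun_mult_left])
      (use contG in simp_all)
  have x0: "x0 \<in> U" using r by (simp add: U_def)
  have "((\<lambda>x. integral (cbox 0 1) (F x)) has_derivative integral (cbox 0 1) (fx x0)) (at x0 within U)"
  proof (rule leibniz_rule)
    fix x t assume xt: "x \<in> U" "t \<in> cbox 0 (1::real)"
    have "((\<lambda>x. F x t) has_derivative (\<lambda>v. dderiv v (\<lambda>x. F x t) x)) (at x)"
      using has_derivative_dderiv[OF S F] xt US0 by auto
    moreover have "blinfun_apply (fx x t) = (\<lambda>v. dderiv v (\<lambda>x. F x t) x)"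
      using fx[of x t] xt US0 by auto
    ultimately show "((\<lambda>x. F x t) has_derivative blinfun_apply (fx x t)) (at x within U)"
      by (simp add: has_derivative_at_withinI)
  next
    fix x assume x: "x \<in> U"
    have "continuous_on (cbox 0 1) (\<lambda>t. (\<lambda>(x, t). F x t) (x, t))"
      by (rule continuous_on_compose2[OF cont]) (use x US0 in \<open>auto intro!: continuous_intros\<close>)
    then show "F x integrable_on cbox 0 1" by (intro integrable_continuous) simp
  qed (use contfx x0 in \<open>auto simp: U_def\<close>)
  then have d: "((\<lambda>x. integral {0..1} (F x)) has_derivative integral (cbox 0 1) (fx x0)) (at x0)"
    using at_within_open[of x0 U] x0 by (simp add: U_def)
  have "continuous_on (cbox 0 1) (\<lambda>t. (\<lambda>(x, t). fx x t) (x0, t))"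
    by (rule continuous_on_compose2[OF contfx]) (use x0 in \<open>auto intro!: continuous_intros\<close>)
  then have int: "fx x0 integrable_on cbox 0 1" by (intro integrable_continuous) simp
  have "blinfun_apply (integral (cbox 0 1) (fx x0)) (a *s v) =
      a * blinfun_apply (integral (cbox 0 1) (fx x0)) v" for a v
  proof -
    have "blinfun_apply (integral (cbox 0 1) (fx x0)) (a *s v) =
        integral (cbox 0 1) (\<lambda>t. fx x0 t (a *s v))"
      by (rule blinfun_apply_integral[OF int])
    also have "\<dots> = integral (cbox 0 1) (\<lambda>t. a * fx x0 t v)"
      by (rule integral_cong)
        (use x0 US0 in \<open>auto simp: fx dderiv_smult_dir[OF S F] subset_iff\<close>)
    also have "\<dots> = a * integral (cbox 0 1) (\<lambda>t. fx x0 t v)" by simp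
    finally show ?thesis by (simp only: blinfun_apply_integral[OF int])
  qed
  with d show "\<exists>f'. ((\<lambda>x. integral {0..1} (F x)) has_derivative f') (at x0) \<and>
      (\<forall>a v. f' (a *s v) = a * f' v)" by blast
qed

text \<open>By Cauchy's formula the derivative is locally an integral of scaled translates of
  \<open>f\<close>, each analytic in \<open>x\<close>.\<close>

lemma analytic_fun_dderiv:
  fixes f :: "complex^'n \<Rightarrow> complex"
  assumes S: "open S" and f: "analytic_fun f S"
  shows "analytic_fun (dderiv \<xi> f) S"
proof (rule analytic_fun_local)
  fix x0 assume "x0 \<in> S"
  then obtain e where e: "0 < e" "ball x0 e \<subseteq> S" using S openE by blast
  \<comment> \<open>Points of the circle move by \<open>r * norm \<xi>\<close>, at most
    \<open>e / 2\<close>; the summand 1 covers \<open>\<xi> = 0\<close>.\<close>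
  define r where "r = e / (2 * (1 + norm \<xi>))"
  have n: "0 < 1 + norm \<xi>" by (simp add: add_pos_nonneg)
  have r: "0 < r" using e n by (simp add: r_def)
  have rx: "r * norm \<xi> \<le> e / 2" using e n by (simp add: r_def field_simps)
  define U where "U = ball x0 (e / 2)"
  define E where "E s = of_real r * exp (2 * of_real pi * \<i> * of_real s)" for s :: real
  have normE: "cmod (E s) = r" for s using r by (simp add: E_def norm_mult)
  have US: "y + t *s \<xi> \<in> S" if "y \<in> U" "cmod t \<le> r" for y t
  proof -
    have "dist x0 (y + t *s \<xi>) \<le> dist x0 y + dist y (y + t *s \<xi>)" by (rule dist_triangle)
    also have "dist y (y + t *s \<xi>) = cmod t * norm \<xi>" by (simp add: dist_norm norm_smult)
    also have "\<dots> \<le> r * norm \<xi>" using that by (simp add: mult_right_mono)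
    finally have "dist x0 (y + t *s \<xi>) < e" using that rx by (simp add: U_def)
    then show ?thesis using e by auto
  qed
  have contE: "continuous_on T (\<lambda>x. E (h x))" if "continuous_on T h" for T and h :: "_ \<Rightarrow> real"
    unfolding E_def by (intro continuous_intros that)
  have E0: "E s \<noteq> 0" for s using normE[of s] r by auto
  have "analytic_fun (\<lambda>x. integral {0..1} (\<lambda>s. f (x + E s *s \<xi>) / E s)) U"
  proof (rule analytic_fun_integral)
    show "analytic_fun (\<lambda>x. f (x + E t *s \<xi>) / E t) U" for t
      using analytic_fun_cmult[OF analytic_fun_compose[OF f linear_id, of U "E t *s \<xi>"], of "1 / E t"]
        US normE by (simp add: add.commute)
    have "continuous_on (U \<times> {0..1}) (\<lambda>p. f (fst p + E (snd p) *s \<xi>))"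
      by (rule continuous_on_compose2[OF analytic_fun_continuous[OF f]])
        (use US in \<open>auto intro!: continuous_intros contE simp: normE\<close>)
    then show "continuous_on (U \<times> {0..1}) (\<lambda>(x, s). f (x + E s *s \<xi>) / E s)"
      unfolding case_prod_unfold
      by (intro continuous_intros contE) (auto simp: E0)
  qed (simp add: U_def)
  moreover have "integral {0..1} (\<lambda>s. f (x + E s *s \<xi>) / E s) = dderiv \<xi> f x" if "x \<in> U" for x
    unfolding E_def by (rule integral_unique[OF dderiv_Cauchy[OF S f r US[OF that]]])
  ultimately have "analytic_fun (dderiv \<xi> f) U" by (rule analytic_fun_cong)
  then show "\<exists>T. open T \<and> x0 \<in> T \<and> analytic_fun (dderiv \<xi> f) (S \<inter> T)"
    using e by (intro exI[of _ U]) (auto simp: U_def intro: analytic_fun_subset)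
qed

section \<open>Polynomials as finitely supported maps\<close>

text \<open>Evaluation at a point and substitution of operators are both linear extensions from
  monomials, so the product formula \<open>lin_ext_mult\<close> serves both.\<close>

definition lin_ext :: "('k \<Rightarrow>\<^sub>0 complex) \<Rightarrow> ('k \<Rightarrow> complex) \<Rightarrow> complex" where
  "lin_ext p \<phi> = (\<Sum>m\<in>Poly_Mapping.keys p. Poly_Mapping.lookup p m * \<phi> m)"

lemma lin_ext_superset:
  "finite A \<Longrightarrow> Poly_Mapping.keys p \<subseteq> A \<Longrightarrow> lin_ext p \<phi> = (\<Sum>m\<in>A. Poly_Mapping.lookup p m * \<phi> m)"
  unfolding lin_ext_def by (rule sum.mono_neutral_left) (auto simp: in_keys_iff)

lemma lin_ext_zero [simp]: "lin_ext 0 \<phi> = 0"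
  by (simp add: lin_ext_def)

lemma lin_ext_add: "lin_ext (p + q) \<phi> = lin_ext p \<phi> + lin_ext q \<phi>"
proof -
  have "lin_ext r \<phi> = (\<Sum>m\<in>Poly_Mapping.keys p \<union> Poly_Mapping.keys q \<union> Poly_Mapping.keys (p + q). Poly_Mapping.lookup r m * \<phi> m)"
    if "r = p \<or> r = q \<or> r = p + q" for r
    by (rule lin_ext_superset) (use that in auto)
  then show ?thesis by (simp add: lookup_add distrib_right sum.distrib)
qed

lemma lin_ext_sum: "lin_ext (sum p I) \<phi> = (\<Sum>i\<in>I. lin_ext (p i) \<phi>)"
  by (induction I rule: infinite_finite_induct) (auto simp: lin_ext_add)

lemma lin_ext_single [simp]: "lin_ext (Poly_Mapping.single m a) \<phi> = a * \<phi> m"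
  using lin_ext_superset[of "{m}" "Poly_Mapping.single m a"] by simp

lemma poly_mapping_eq_sum_single:
  "(\<Sum>m\<in>Poly_Mapping.keys p. Poly_Mapping.single m (Poly_Mapping.lookup p m)) = p"
proof (rule poly_mapping_eqI)
  fix k
  show "Poly_Mapping.lookup (\<Sum>m\<in>Poly_Mapping.keys p. Poly_Mapping.single m (Poly_Mapping.lookup p m)) k
    = Poly_Mapping.lookup p k"
    by (simp add: lookup_sum lookup_single when_def in_keys_iff)
qed

lemma lin_ext_mult:
  fixes p q :: "'k::comm_monoid_add \<Rightarrow>\<^sub>0 complex"
  shows "lin_ext (p * q) \<phi> = lin_ext p (\<lambda>m. lin_ext q (\<lambda>m'. \<phi> (m + m')))"
proof -
  have "p * q = (\<Sum>m\<in>Poly_Mapping.keys p. \<Sum>m'\<in>Poly_Mapping.keys q.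
      Poly_Mapping.single (m + m') (Poly_Mapping.lookup p m * Poly_Mapping.lookup q m'))"
    by (subst (1 2) poly_mapping_eq_sum_single[symmetric])
      (simp add: sum_product mult_single)
  then show ?thesis
    by (simp add: lin_ext_sum) (simp add: lin_ext_def sum_distrib_left mult.assoc)
qed

section \<open>Evaluation of polynomials and its injectivity\<close>

text \<open>The index type may be infinite, since relations between operators have variables in
  \<open>nat\<close>; hence the product over the support.\<close>

definition mono_eval :: "('i \<Rightarrow>\<^sub>0 nat) \<Rightarrow> ('i \<Rightarrow> complex) \<Rightarrow> complex" where
  "mono_eval m s = (\<Prod>i\<in>Poly_Mapping.keys m. s i ^ Poly_Mapping.lookup m i)"

lemma mono_eval_superset:
  "finite A \<Longrightarrow> Poly_Mapping.keys m \<subseteq> A \<Longrightarrow> mono_eval m s = (\<Prod>i\<in>A. s i ^ Poly_Mapping.lookup m i)"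
  unfolding mono_eval_def by (rule prod.mono_neutral_left) (auto simp: in_keys_iff)

lemma mono_eval_zero [simp]: "mono_eval 0 s = 1"
  by (simp add: mono_eval_def)

lemma mono_eval_add: "mono_eval (m + m') s = mono_eval m s * mono_eval m' s"
proof -
  have "mono_eval r s = (\<Prod>i\<in>Poly_Mapping.keys m \<union> Poly_Mapping.keys m' \<union> Poly_Mapping.keys (m + m'). s i ^ Poly_Mapping.lookup r i)"
    if "r = m \<or> r = m' \<or> r = m + m'" for r
    by (rule mono_eval_superset) (use that in auto)
  then show ?thesis by (simp add: lookup_add power_add prod.distrib)
qed

lemma mono_eval_single [simp]: "mono_eval (Poly_Mapping.single i k) s = s i ^ k"
  using mono_eval_superset[of "{i}" "Poly_Mapping.single i k" s] by simp

lemma mono_eval_mult_arg: "mono_eval m (\<lambda>i. s i * t i) = mono_eval m s * mono_eval m t"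
  by (simp add: mono_eval_def power_mult_distrib prod.distrib)

text \<open>Test at the point with 2 in a coordinate where the exponents differ and 1 elsewhere:
  distinct powers of 2 are different.\<close>

lemma mono_eval_distinct:
  assumes "m \<noteq> m'"
  shows "\<exists>s. mono_eval m s \<noteq> mono_eval m' s"
proof -
  obtain i where i: "Poly_Mapping.lookup m i \<noteq> Poly_Mapping.lookup m' i"
    using poly_mapping_eqI[of m m'] assms by auto
  define s :: "'a \<Rightarrow> complex" where "s j = (if j = i then 2 else 1)" for j
  have "mono_eval r s = 2 ^ Poly_Mapping.lookup r i" for r
  proof -
    define A where "A = insert i (Poly_Mapping.keys r)"
    have A: "finite A" "i \<in> A" "Poly_Mapping.keys r \<subseteq> A" by (auto simp: A_def)
    have "mono_eval r s = (\<Prod>j\<in>A. s j ^ Poly_Mapping.lookup r j)"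
      by (rule mono_eval_superset[OF A(1,3)])
    also have "\<dots> = (\<Prod>j\<in>A. if i = j then 2 ^ Poly_Mapping.lookup r j else 1)"
      by (rule prod.cong) (auto simp: s_def)
    also have "\<dots> = 2 ^ Poly_Mapping.lookup r i"
      using A by (simp add: prod.delta')
    finally show ?thesis .
  qed
  moreover have "(2::complex) ^ a \<noteq> 2 ^ b" if "a \<noteq> b" for a b :: nat
  proof
    assume "(2::complex) ^ a = 2 ^ b"
    then have "cmod (2 ^ a) = cmod (2 ^ b)" by simp
    then show False using that by (simp add: norm_power)
  qed
  ultimately show ?thesis using i by metis
qed

text \<open>Monomials are pairwise distinct characters of the multiplicative monoid of points, so
  Dedekind's argument applies.\<close>

lemma mono_eval_independent:
  assumes "finite M" "\<And>s. (\<Sum>m\<in>M. a m * mono_eval m s) = 0" "m \<in> M"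
  shows "a m = 0"
  using assms
proof (induction M arbitrary: a m rule: finite_induct)
  case (insert b M)
  have M: "a m = 0" if m: "m \<in> M" for m
  proof -
    obtain t where t: "mono_eval m t \<noteq> mono_eval b t"
      using mono_eval_distinct[of m b] m insert.hyps by blast
    \<comment> \<open>The relation at the product point \<open>t i * s i\<close>, minus
      \<open>mono_eval b t\<close> times the relation at \<open>s\<close>, has no \<open>b\<close>
      term.\<close>
    have "(\<Sum>m\<in>M. (a m * (mono_eval m t - mono_eval b t)) * mono_eval m s) = 0" for s
    proof -
      have "(\<Sum>m\<in>insert b M. a m * mono_eval m (\<lambda>i. t i * s i)) -
          mono_eval b t * (\<Sum>m\<in>insert b M. a m * mono_eval m s) = 0"
        by (simp only: insert.prems(1)) simp
      then show ?thesis using insert.hyps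
        by (simp add: mono_eval_mult_arg sum_distrib_left sum_subtractf[symmetric] algebra_simps)
    qed
    from insert.IH[OF this m] show ?thesis using t by simp
  qed
  then have "a b = 0"
    using insert.prems(1)[of "\<lambda>_. 1"] insert.hyps by (simp add: mono_eval_def)
  with M insert.prems(2) show ?case by blast
qed simp

definition peval :: "'i mpoly \<Rightarrow> ('i \<Rightarrow> complex) \<Rightarrow> complex" where
  "peval p s = lin_ext p (\<lambda>m. mono_eval m s)"

lemma peval_zero [simp]: "peval 0 s = 0"
  and peval_add: "peval (p + q) s = peval p s + peval q s"
  and peval_sum: "peval (sum f I) s = (\<Sum>i\<in>I. peval (f i) s)"
  and peval_single [simp]: "peval (Poly_Mapping.single m a) s = a * mono_eval m s"
  by (simp_all add: peval_def lin_ext_add lin_ext_sum)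

lemma peval_mult: "peval (p * q) s = peval p s * peval q s"
proof -
  have "peval (p * q) s = (\<Sum>m\<in>Poly_Mapping.keys p. \<Sum>m'\<in>Poly_Mapping.keys q.
      (Poly_Mapping.lookup p m * mono_eval m s) * (Poly_Mapping.lookup q m' * mono_eval m' s))"
    unfolding peval_def lin_ext_mult mono_eval_add
    by (simp add: lin_ext_def sum_distrib_left mult_ac)
  then show ?thesis by (simp only: sum_product peval_def lin_ext_def)
qed

lemma peval_one [simp]: "peval 1 s = 1"
  using peval_single[of 0 1 s] by (simp flip: single_one)

lemma peval_power: "peval (p ^ k) s = peval p s ^ k"
  by (induction k) (simp_all add: peval_mult)

lemma peval_prod: "peval (prod f I) s = (\<Prod>i\<in>I. peval (f i) s)"
  by (induction I rule: infinite_finite_induct) (auto simp: peval_mult)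

lemma peval_eq_zero:
  assumes "\<And>s. peval p s = 0"
  shows "p = 0"
proof (rule poly_mapping_eqI)
  fix m
  have "m \<in> Poly_Mapping.keys p \<Longrightarrow> Poly_Mapping.lookup p m = 0"
    using mono_eval_independent[of "Poly_Mapping.keys p" "Poly_Mapping.lookup p" m] assms
    by (simp add: peval_def lin_ext_def)
  then show "Poly_Mapping.lookup p m = Poly_Mapping.lookup 0 m"
    by (auto simp: in_keys_iff)
qed

lemma poly_eval_eq_peval: "poly_eval p x = peval p (\<lambda>i. x $ i)"
  unfolding poly_eval_def peval_def lin_ext_def
  by (intro sum.cong refl arg_cong[where f="\<lambda>z. _ * z"] mono_eval_superset[symmetric]) auto

lemma peval_eq_poly_eval: "peval p s = poly_eval p (\<chi> i. s i)"
  by (simp add: poly_eval_eq_peval)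

lemma poly_eval_inj:
  assumes "\<And>x. poly_eval p x = poly_eval q x"
  shows "p = q"
proof -
  have "peval (p + Poly_Mapping.single 0 (-1) * q) s = 0" for s
    using assms[of "\<chi> i. s i"] by (simp add: peval_add peval_mult poly_eval_eq_peval)
  then have "p + Poly_Mapping.single 0 (-1) * q = 0" by (rule peval_eq_zero)
  moreover have "Poly_Mapping.single 0 (-1::complex) = - (1 :: 'a mpoly)"
    by (simp flip: single_one add: single_uminus)
  ultimately show ?thesis by simp
qed

section \<open>Polynomial functions\<close>

definition polyfun :: "(complex^'n \<Rightarrow> complex) set" where
  "polyfun = range poly_eval"

lemma polyfun_const [simp]: "(\<lambda>x. a) \<in> polyfun"
  unfolding polyfun_def
  by (intro image_eqI[of _ _ "Poly_Mapping.single 0 a"]) (auto simp: poly_eval_eq_peval)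

lemma polyfun_coord [simp]: "(\<lambda>x. x $ i) \<in> polyfun"
  unfolding polyfun_def
  by (intro image_eqI[of _ _ "Poly_Mapping.single (Poly_Mapping.single i 1) 1"])
    (auto simp: poly_eval_eq_peval)

lemma polyfun_add: "f \<in> polyfun \<Longrightarrow> g \<in> polyfun \<Longrightarrow> (\<lambda>x. f x + g x) \<in> polyfun"
  unfolding polyfun_def
  by (elim imageE) (auto intro!: image_eqI[of _ _ "_ + _"] simp: poly_eval_eq_peval peval_add)

lemma polyfun_mult: "f \<in> polyfun \<Longrightarrow> g \<in> polyfun \<Longrightarrow> (\<lambda>x. f x * g x) \<in> polyfun"
  unfolding polyfun_def
  by (elim imageE) (auto intro!: image_eqI[of _ _ "_ * _"] simp: poly_eval_eq_peval peval_mult)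

lemma polyfun_diff: "f \<in> polyfun \<Longrightarrow> g \<in> polyfun \<Longrightarrow> (\<lambda>x. f x - g x) \<in> polyfun"
  using polyfun_add[OF _ polyfun_mult[OF polyfun_const[of "-1"]], of f g] by simp

lemma polyfun_sum: "(\<And>i. i \<in> I \<Longrightarrow> f i \<in> polyfun) \<Longrightarrow> (\<lambda>x. \<Sum>i\<in>I. f i x) \<in> polyfun"
  by (induction I rule: infinite_finite_induct) (auto intro: polyfun_add)

lemma polyfun_prod: "(\<And>i. i \<in> I \<Longrightarrow> f i \<in> polyfun) \<Longrightarrow> (\<lambda>x. \<Prod>i\<in>I. f i x) \<in> polyfun"
  by (induction I rule: infinite_finite_induct) (auto intro: polyfun_mult)

lemma polyfun_power: "f \<in> polyfun \<Longrightarrow> (\<lambda>x. f x ^ k) \<in> polyfun"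
  by (induction k) (auto intro: polyfun_mult)

lemma polyfun_bil: "(\<lambda>x. bil a x) \<in> polyfun"
  unfolding bil_def by (intro polyfun_sum polyfun_mult polyfun_const polyfun_coord)

lemma polyfun_compose:
  assumes "p \<in> polyfun" "\<And>i. (\<lambda>x. g x $ i) \<in> polyfun"
  shows "(\<lambda>x. p (g x)) \<in> polyfun"
proof -
  obtain P where "p = poly_eval P" using assms(1) unfolding polyfun_def by blast
  then show ?thesis unfolding poly_eval_def
    using assms(2) by (auto intro!: polyfun_sum polyfun_mult polyfun_prod polyfun_power)
qed

text \<open>Products are built one coordinate at a time, which suits operators known to commute with
  linear functions, as in \<open>dk_comm_polyfun_mult\<close>.\<close>

lemma polyfun_induct [consumes 1, case_names const add coord]:
  assumes f: "f \<in> polyfun"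
    and const: "\<And>a. Q (\<lambda>x. a)"
    and add: "\<And>f g. f \<in> polyfun \<Longrightarrow> g \<in> polyfun \<Longrightarrow> Q f \<Longrightarrow> Q g \<Longrightarrow> Q (\<lambda>x. f x + g x)"
    and coord: "\<And>f i. f \<in> polyfun \<Longrightarrow> Q f \<Longrightarrow> Q (\<lambda>x. x $ i * f x)"
  shows "Q f"
proof -
  have pow: "(\<lambda>x. x $ i ^ k * f x) \<in> polyfun \<and> Q (\<lambda>x. x $ i ^ k * f x)" if "f \<in> polyfun" "Q f" for f i k
  proof (induction k)
    case (Suc k)
    then show ?case using coord[of "\<lambda>x. x $ i ^ k * f x" i]
      polyfun_mult[OF polyfun_coord, of "\<lambda>x. x $ i ^ k * f x" i] by (simp add: mult.assoc)
  qed (use that in simp)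
  have mon: "(\<lambda>x. (\<Prod>i\<in>A. x $ i ^ k i) * a) \<in> polyfun \<and> Q (\<lambda>x. (\<Prod>i\<in>A. x $ i ^ k i) * a)"
    if "finite A" for A k a
    using that
  proof (induction A rule: finite_induct)
    case (insert i A)
    then show ?case using pow[of "\<lambda>x. (\<Prod>i\<in>A. x $ i ^ k i) * a" i "k i"] by (simp add: mult.assoc)
  qed (simp add: const)
  have "(\<lambda>x. \<Sum>m\<in>M. (\<Prod>i\<in>UNIV. x $ i ^ k m i) * a m) \<in> polyfun \<and>
      Q (\<lambda>x. \<Sum>m\<in>M. (\<Prod>i\<in>UNIV. x $ i ^ k m i) * a m)" if "finite M" for M a and k :: "_ \<Rightarrow> _ \<Rightarrow> nat"
    using that
  proof (induction M rule: finite_induct)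
    case (insert m M)
    then show ?case using mon[of UNIV "k m" "a m"]
      by (auto intro!: add polyfun_add)
  qed (simp add: const)
  from this[OF finite_keys]
  have "Q (\<lambda>x. \<Sum>m\<in>Poly_Mapping.keys P. (\<Prod>i\<in>UNIV. x $ i ^ Poly_Mapping.lookup m i) * Poly_Mapping.lookup P m)" for P
    by blast
  moreover obtain P where "f = poly_eval P" using f unfolding polyfun_def by blast
  ultimately show ?thesis by (simp add: poly_eval_def[abs_def] mult.commute)
qed

lemma analytic_fun_polyfun: "p \<in> polyfun \<Longrightarrow> analytic_fun p S"
proof (induction rule: polyfun_induct)
  case (coord f i)
  have "analytic_fun (\<lambda>x. x $ i) S" using analytic_fun_bil[of "axis i 1" S] by (simp add: bil_axis_left[abs_def])
  with coord show ?case by (intro analytic_fun_mult)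
qed (auto intro: analytic_fun_add)

section \<open>Order of vanishing at a point\<close>

text \<open>A growth bound makes sums, products and linear substitutions immediate. Since
  \<open>nhds\<close> includes \<open>x\<close> itself, order at least 1 forces
  \<open>f x = 0\<close>; order 0 is local boundedness, as \<open>0 ^ 0 = 1\<close>.\<close>

definition vord :: "nat \<Rightarrow> (complex^'n \<Rightarrow> complex) \<Rightarrow> complex^'n \<Rightarrow> bool" where
  "vord k f x \<longleftrightarrow> (\<exists>C. eventually (\<lambda>z. cmod (f z) \<le> C * norm (z - x) ^ k) (nhds x))"

lemma vordE:
  assumes "vord k f x"
  obtains C where "0 \<le> C" "eventually (\<lambda>z. cmod (f z) \<le> C * norm (z - x) ^ k) (nhds x)"
proof -
  obtain C where C: "eventually (\<lambda>z. cmod (f z) \<le> C * norm (z - x) ^ k) (nhds x)"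
    using assms unfolding vord_def by blast
  have "eventually (\<lambda>z. cmod (f z) \<le> \<bar>C\<bar> * norm (z - x) ^ k) (nhds x)"
    using C
  proof (rule eventually_mono)
    fix z assume "cmod (f z) \<le> C * norm (z - x) ^ k"
    also have "\<dots> \<le> \<bar>C\<bar> * norm (z - x) ^ k" by (intro mult_right_mono) auto
    finally show "cmod (f z) \<le> \<bar>C\<bar> * norm (z - x) ^ k" .
  qed
  then show ?thesis using that[of "\<bar>C\<bar>"] by simp
qed

lemma vord_cong:
  assumes "vord k f x" "open S" "x \<in> S" "\<And>z. z \<in> S \<Longrightarrow> f z = g z"
  shows "vord k g x"
proof -
  obtain C where "eventually (\<lambda>z. cmod (f z) \<le> C * norm (z - x) ^ k) (nhds x)"
    using assms(1) unfolding vord_def by blast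
  moreover have "eventually (\<lambda>z. z \<in> S) (nhds x)" using assms by (intro eventually_nhds_in_open)
  ultimately have "eventually (\<lambda>z. cmod (g z) \<le> C * norm (z - x) ^ k) (nhds x)"
    by eventually_elim (use assms(4) in auto)
  then show ?thesis unfolding vord_def by blast
qed

lemma vord_add:
  assumes "vord k f x" "vord k g x"
  shows "vord k (\<lambda>z. f z + g z) x"
proof -
  obtain C C' where "eventually (\<lambda>z. cmod (f z) \<le> C * norm (z - x) ^ k) (nhds x)"
    "eventually (\<lambda>z. cmod (g z) \<le> C' * norm (z - x) ^ k) (nhds x)"
    using assms unfolding vord_def by blast
  then have "eventually (\<lambda>z. cmod (f z + g z) \<le> (C + C') * norm (z - x) ^ k) (nhds x)"
    by eventually_elim (auto simp: distrib_right intro: order_trans[OF norm_triangle_ineq])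
  then show ?thesis unfolding vord_def by blast
qed

lemma vord_mult:
  assumes "vord k f x" "vord l g x"
  shows "vord (k + l) (\<lambda>z. f z * g z) x"
proof -
  obtain C where C: "0 \<le> C" "eventually (\<lambda>z. cmod (f z) \<le> C * norm (z - x) ^ k) (nhds x)"
    by (rule vordE[OF assms(1)])
  obtain C' where C': "0 \<le> C'" "eventually (\<lambda>z. cmod (g z) \<le> C' * norm (z - x) ^ l) (nhds x)"
    by (rule vordE[OF assms(2)])
  from C(2) C'(2) have "eventually (\<lambda>z. cmod (f z * g z) \<le> (C * C') * norm (z - x) ^ (k + l)) (nhds x)"
  proof eventually_elim
    case (elim z)
    have "cmod (f z * g z) \<le> (C * norm (z - x) ^ k) * (C' * norm (z - x) ^ l)"
      unfolding norm_mult by (rule mult_mono) (use elim C(1) C'(1) in auto)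
    then show ?case by (simp add: power_add mult_ac)
  qed
  then show ?thesis unfolding vord_def by blast
qed

lemma vord_mono:
  assumes "vord l f x" "k \<le> l"
  shows "vord k f x"
proof -
  obtain C where C: "0 \<le> C" "eventually (\<lambda>z. cmod (f z) \<le> C * norm (z - x) ^ l) (nhds x)"
    by (rule vordE[OF assms(1)])
  have "eventually (\<lambda>z. dist z x < 1) (nhds x)" by (auto simp: eventually_nhds_metric intro!: exI[of _ 1])
  with C(2) have "eventually (\<lambda>z. cmod (f z) \<le> C * norm (z - x) ^ k) (nhds x)"
  proof eventually_elim
    case (elim z)
    have "norm (z - x) ^ l \<le> norm (z - x) ^ k"
      by (rule power_decreasing[OF assms(2)]) (use elim in \<open>auto simp: dist_norm\<close>)
    with elim C(1) show ?case by (meson mult_left_mono order_trans)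
  qed
  then show ?thesis unfolding vord_def by blast
qed

lemma vord_continuous:
  assumes "continuous (at x) f"
  shows "vord 0 f x"
proof -
  have "(f \<longlongrightarrow> f x) (nhds x)" using assms by (simp add: continuous_at tendsto_at_iff_tendsto_nhds)
  then have "eventually (\<lambda>z. dist (f z) (f x) < 1) (nhds x)" by (simp add: tendsto_iff)
  then have "eventually (\<lambda>z. cmod (f z) \<le> (cmod (f x) + 1) * norm (z - x) ^ 0) (nhds x)"
    by (rule eventually_mono) (auto simp: dist_norm, smt (verit) norm_triangle_sub)
  then show ?thesis unfolding vord_def by blast
qed

lemma vord_analytic:
  assumes "open S" "analytic_fun f S" "x \<in> S"
  shows "vord 0 f x"
  using vord_continuous analytic_fun_continuous[OF assms(2)] continuous_on_eq_continuous_at[OF assms(1)] assms(3)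
  by blast

lemma vord_cmult: "vord k f x \<Longrightarrow> vord k (\<lambda>z. a * f z) x"
  using vord_mult[OF vord_continuous[of x "\<lambda>_. a"], of k f] by simp

lemma vord_diff: "vord k f x \<Longrightarrow> vord k g x \<Longrightarrow> vord k (\<lambda>z. f z - g z) x"
  using vord_add[OF _ vord_cmult[of k g x "-1"]] by simp

lemma vord_zero_fun [simp]: "vord k (\<lambda>z. 0) x"
  unfolding vord_def by (intro exI[of _ 0]) auto

lemma vord_sum: "(\<And>i. i \<in> I \<Longrightarrow> vord k (f i) x) \<Longrightarrow> vord k (\<lambda>z. \<Sum>i\<in>I. f i z) x"
  by (induction I rule: infinite_finite_induct) (auto intro: vord_add)

lemma vord_power: "vord k f x \<Longrightarrow> vord (k * j) (\<lambda>z. f z ^ j) x"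
  by (induction j) (auto intro: vord_mult vord_continuous)

lemma vord_Suc_zero: "vord (Suc k) f x \<Longrightarrow> f x = 0"
  using eventually_nhds_x_imp_x unfolding vord_def by fastforce

lemma vord_compose:
  assumes "vord k f (g x)" "eventually (\<lambda>z. norm (g z - g x) \<le> K * norm (z - x)) (nhds x)"
  shows "vord k (\<lambda>z. f (g z)) x"
proof -
  obtain C where C: "0 \<le> C" "eventually (\<lambda>z. cmod (f z) \<le> C * norm (z - g x) ^ k) (nhds (g x))"
    by (rule vordE[OF assms(1)])
  have "((\<lambda>z. norm (g z - g x)) \<longlongrightarrow> 0) (nhds x)"
  proof (rule tendsto_sandwich[of "\<lambda>_. 0" _ _ "\<lambda>z. K * norm (z - x)"])
    have "((\<lambda>z. K * norm (z - x)) \<longlongrightarrow> K * norm (x - x)) (nhds x)"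
      by (intro tendsto_intros filterlim_ident)
    then show "((\<lambda>z. K * norm (z - x)) \<longlongrightarrow> 0) (nhds x)" by simp
  qed (use assms(2) in auto)
  then have "filterlim g (nhds (g x)) (nhds x)"
    by (rule LIM_zero_cancel[OF tendsto_norm_zero_cancel])
  then have "eventually (\<lambda>z. cmod (f (g z)) \<le> C * norm (g z - g x) ^ k) (nhds x)"
    by (rule eventually_compose_filterlim[OF C(2)])
  with assms(2) have "eventually (\<lambda>z. cmod (f (g z)) \<le> (C * K ^ k) * norm (z - x) ^ k) (nhds x)"
  proof eventually_elim
    case (elim z)
    have "norm (g z - g x) ^ k \<le> (K * norm (z - x)) ^ k" by (rule power_mono) (use elim in auto)
    with elim C(1) show ?case
      by (smt (verit, best) mult.assoc mult_left_mono power_mult_distrib)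
  qed
  then show ?thesis unfolding vord_def by blast
qed

lemma vord_linear_compose:
  fixes L :: "complex^'n \<Rightarrow> complex^'n"
  assumes "vord k f (b + L x)" "linear L"
  shows "vord k (\<lambda>z. f (b + L z)) x"
proof -
  obtain K where K: "\<And>z. norm (L z) \<le> K * norm z"
    using assms(2) linear_bounded by blast
  show ?thesis
    by (rule vord_compose[of k f "\<lambda>z. b + L z" x K])
      (use assms K in \<open>auto simp: linear_diff[symmetric]\<close>)
qed

lemma vord_bil: "vord 1 (\<lambda>z. bil a z - bil a x) x"
proof -
  obtain K where K: "\<And>z. norm (bil a z) \<le> K * norm z"
    using linear_bounded[OF linear_bil] by blast
  then show ?thesis unfolding vord_def
    by (intro exI[of _ K] always_eventually) (simp add: bil_diff_right[symmetric])
qed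

text \<open>Cauchy's estimate on discs of radius proportional to the distance from \<open>x\<close>.\<close>

lemma vord_dderiv:
  fixes f :: "complex^'n \<Rightarrow> complex"
  assumes S: "open S" and f: "analytic_fun f S" and x: "x \<in> S" and v: "vord (Suc k) f x"
  shows "vord k (dderiv \<xi> f) x"
proof (cases "\<xi> = 0")
  case True
  have "dderiv \<xi> f = (\<lambda>z. 0)" by (simp add: True dderiv_def fun_eq_iff)
  then show ?thesis by simp
next
  case False
  obtain C where C: "0 \<le> C" "eventually (\<lambda>z. cmod (f z) \<le> C * norm (z - x) ^ Suc k) (nhds x)"
    by (rule vordE[OF v])
  have "eventually (\<lambda>z. z \<in> S) (nhds x)" using S x by (intro eventually_nhds_in_open)
  with C(2) have "eventually (\<lambda>z. z \<in> S \<and> cmod (f z) \<le> C * norm (z - x) ^ Suc k) (nhds x)"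
    by eventually_elim auto
  then obtain r where r: "0 < r" "\<And>z. dist z x < r \<Longrightarrow> z \<in> S \<and> cmod (f z) \<le> C * norm (z - x) ^ Suc k"
    unfolding eventually_nhds_metric by blast
  define D where "D = C * 2 ^ Suc k * norm \<xi>"
  have est: "cmod (dderiv \<xi> f z) \<le> D * norm (z - x) ^ k" if z: "dist z x < r / 2" "z \<noteq> x" for z
  proof -
    define d where "d = norm (z - x)"
    \<comment> \<open>For \<open>cmod t \<le> \<rho>\<close> the point moves by at most
      \<open>d\<close>, hence stays within \<open>2 * d\<close> of \<open>x\<close>.\<close>
    define \<rho> where "\<rho> = d / norm \<xi>"
    have d: "0 < d" "d < r / 2" using z by (auto simp: d_def dist_norm)
    have \<rho>: "0 < \<rho>" using d False by (simp add: \<rho>_def)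
    have near: "norm (z + t *s \<xi> - x) \<le> 2 * d" if "cmod t \<le> \<rho>" for t
    proof -
      have "norm (z + t *s \<xi> - x) \<le> norm (z - x) + norm (t *s \<xi>)"
        by (metis add_diff_eq diff_add_eq norm_triangle_ineq)
      also have "norm (t *s \<xi>) \<le> \<rho> * norm \<xi>" using that by (simp add: norm_smult mult_right_mono)
      finally show ?thesis using False by (simp add: \<rho>_def d_def)
    qed
    have inS: "z + t *s \<xi> \<in> S" and bd: "cmod (f (z + t *s \<xi>)) \<le> C * (2 * d) ^ Suc k"
      if "cmod t \<le> \<rho>" for t
    proof -
      have dd: "dist (z + t *s \<xi>) x < r" using near[OF that] d by (simp add: dist_norm)
      then show "z + t *s \<xi> \<in> S" using r by blast
      have "cmod (f (z + t *s \<xi>)) \<le> C * norm (z + t *s \<xi> - x) ^ Suc k" using r dd by blast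
      also have "\<dots> \<le> C * (2 * d) ^ Suc k"
        by (intro mult_left_mono power_mono near that C) auto
      finally show "cmod (f (z + t *s \<xi>)) \<le> C * (2 * d) ^ Suc k" .
    qed
    define g where "g t = f (z + t *s \<xi>)" for t
    have g: "(g has_field_derivative dderiv \<xi> f (z + t *s \<xi>)) (at t)" if "cmod t \<le> \<rho>" for t
      unfolding g_def using analytic_fun_slice(1)[OF S f inS[OF that]] .
    have hol: "g holomorphic_on cball 0 \<rho>"
      unfolding holomorphic_on_def using g
      by (metis field_differentiable_at_within field_differentiable_def mem_cball_0)
    have "cmod ((deriv ^^ 1) g 0) \<le> fact 1 * (C * (2 * d) ^ Suc k) / \<rho> ^ 1"
    proof (rule Cauchy_inequality[OF _ _ \<rho>])
      show "g holomorphic_on ball 0 \<rho>" using hol holomorphic_on_subset by fastforce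
      show "continuous_on (cball 0 \<rho>) g" using hol by (rule holomorphic_on_imp_continuous_on)
    qed (use bd in \<open>auto simp: g_def dist_norm\<close>)
    moreover have "deriv g 0 = dderiv \<xi> f z" using DERIV_imp_deriv[OF g[of 0]] \<rho> by simp
    ultimately have "cmod (dderiv \<xi> f z) \<le> C * (2 * d) ^ Suc k / \<rho>" by simp
    also have "\<dots> = D * d ^ k" using d False by (simp add: D_def \<rho>_def field_simps power_mult_distrib)
    finally show ?thesis by (simp add: d_def)
  qed
  \<comment> \<open>At \<open>x\<close> itself the disc degenerates; continuity of the derivative
    gives the bound there.\<close>
  have "cmod (dderiv \<xi> f x) \<le> D * norm (x - x) ^ k"
  proof (rule tendsto_le[OF at_neq_bot])
    have "isCont (dderiv \<xi> f) x"
      using analytic_fun_continuous[OF analytic_fun_dderiv[OF S f]] S x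
        continuous_on_eq_continuous_at by blast
    then show "((\<lambda>z. cmod (dderiv \<xi> f z)) \<longlongrightarrow> cmod (dderiv \<xi> f x)) (at x)"
      by (intro tendsto_norm) (simp add: isCont_def)
    show "((\<lambda>z. D * norm (z - x) ^ k) \<longlongrightarrow> D * norm (x - x) ^ k) (at x)"
      by (intro tendsto_intros)
    show "\<forall>\<^sub>F z in at x. cmod (dderiv \<xi> f z) \<le> D * norm (z - x) ^ k"
      unfolding eventually_at using est r(1) by (intro exI[of _ "r / 2"]) auto
  qed
  with est have "\<forall>z. dist z x < r / 2 \<longrightarrow> cmod (dderiv \<xi> f z) \<le> D * norm (z - x) ^ k" by metis
  then show ?thesis unfolding vord_def eventually_nhds_metric using r(1)
    by (intro exI[of _ D] exI[of _ "r / 2"]) auto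
qed

section \<open>Taylor polynomials\<close>

lemma analytic_fun_iter:
  "open S \<Longrightarrow> analytic_fun F S \<Longrightarrow> analytic_fun ((dderiv v ^^ j) F) S"
  by (induction j) (auto intro: analytic_fun_dderiv)

lemma dderiv_iter_cong:
  assumes "open S" "y \<in> S" "\<And>y. y \<in> S \<Longrightarrow> F y = G y"
  shows "(dderiv v ^^ j) F y = (dderiv v ^^ j) G y"
  using assms(2)
proof (induction j arbitrary: y)
  case (Suc j)
  have "dderiv v ((dderiv v ^^ j) F) y = dderiv v ((dderiv v ^^ j) G) y"
    by (rule dderiv_cong_open[OF assms(1) Suc.prems Suc.IH])
  then show ?case by simp
qed (use assms(3) in simp)

lemma dderiv_iter_sum:
  assumes S: "open S" and F: "\<And>i. i \<in> I \<Longrightarrow> analytic_fun (F i) S" and y: "y \<in> S"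
  shows "(dderiv v ^^ j) (\<lambda>y. \<Sum>i\<in>I. a i * F i y) y = (\<Sum>i\<in>I. a i * (dderiv v ^^ j) (F i) y)"
  using y
proof (induction j arbitrary: y)
  case (Suc j)
  have "(dderiv v ^^ Suc j) (\<lambda>y. \<Sum>i\<in>I. a i * F i y) y =
      dderiv v (\<lambda>y. \<Sum>i\<in>I. a i * (dderiv v ^^ j) (F i) y) y"
    using dderiv_cong_open[OF S Suc.prems Suc.IH, where \<xi> = v] by simp
  also have "\<dots> = (\<Sum>i\<in>I. dderiv v (\<lambda>y. a i * (dderiv v ^^ j) (F i) y) y)"
    by (rule dderiv_sum[OF S _ Suc.prems]) (intro analytic_fun_cmult analytic_fun_iter S F)
  also have "\<dots> = (\<Sum>i\<in>I. a i * dderiv v ((dderiv v ^^ j) (F i)) y)"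
    by (rule sum.cong[OF HOL.refl]) (rule dderiv_cmult[OF S analytic_fun_iter[OF S F] Suc.prems])
  finally show ?case by simp
qed simp

text \<open>Peeling off one derivative in coordinates gives a recursion over all \<open>F\<close> at
  once; polynomiality in \<open>v\<close> and bounds uniform in \<open>v\<close> both follow from
  it.\<close>

lemma dderiv_iter_Suc:
  assumes S: "open S" and F: "analytic_fun F S" and y: "y \<in> S"
  shows "(dderiv v ^^ Suc j) F y = (\<Sum>i\<in>UNIV. v $ i * (dderiv v ^^ j) (dderiv (axis i 1) F) y)"
proof -
  have "(dderiv v ^^ Suc j) F y = (dderiv v ^^ j) (dderiv v F) y"
    by (simp only: funpow_Suc_right o_apply)
  also have "\<dots> = (dderiv v ^^ j) (\<lambda>y. \<Sum>i\<in>UNIV. v $ i * dderiv (axis i 1) F y) y"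
    by (rule dderiv_iter_cong[OF S y dderiv_eq_sum[OF S F]])
  also have "\<dots> = (\<Sum>i\<in>UNIV. v $ i * (dderiv v ^^ j) (dderiv (axis i 1) F) y)"
    by (rule dderiv_iter_sum[OF S analytic_fun_dderiv[OF S F] y])
  finally show ?thesis .
qed

lemma dderiv_iter_polyfun:
  assumes S: "open S" and F: "analytic_fun F S" and x: "x \<in> S"
  shows "(\<lambda>v. (dderiv v ^^ j) F x) \<in> polyfun"
  using F
proof (induction j arbitrary: F)
  case (Suc j)
  have "(\<lambda>v. (dderiv v ^^ Suc j) F x) =
      (\<lambda>v. \<Sum>i\<in>UNIV. v $ i * (dderiv v ^^ j) (dderiv (axis i 1) F) x)"
    using dderiv_iter_Suc[OF S Suc.prems x] by blast
  also have "\<dots> \<in> polyfun"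
    by (intro polyfun_sum polyfun_mult polyfun_coord Suc.IH analytic_fun_dderiv S Suc.prems)
  finally show ?case .
qed simp

lemma dderiv_iter_bound:
  assumes S: "open S" and F: "analytic_fun F S" and x: "x \<in> S"
  shows "\<exists>C\<ge>0. eventually (\<lambda>y. \<forall>v. cmod ((dderiv v ^^ j) F y) \<le> C * norm v ^ j) (nhds x)"
  using F
proof (induction j arbitrary: F)
  case 0
  obtain C where "0 \<le> C" "eventually (\<lambda>z. cmod (F z) \<le> C * norm (z - x) ^ 0) (nhds x)"
    by (rule vordE[OF vord_analytic[OF S 0 x]])
  then show ?case by (auto intro!: exI[of _ C])
next
  case (Suc j)
  have "\<forall>i. \<exists>C\<ge>0. eventually (\<lambda>y. \<forall>v. cmod ((dderiv v ^^ j) (dderiv (axis i 1) F) y) \<le> C * norm v ^ j) (nhds x)"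
    using Suc.IH[OF analytic_fun_dderiv[OF S Suc.prems]] by blast
  from choice[OF this] obtain C where C: "\<And>i. 0 \<le> C i"
    "\<And>i. eventually (\<lambda>y. \<forall>v. cmod ((dderiv v ^^ j) (dderiv (axis i 1) F) y) \<le> C i * norm v ^ j) (nhds x)"
    by blast
  have "eventually (\<lambda>y. y \<in> S) (nhds x)" using S x by (intro eventually_nhds_in_open)
  moreover have "eventually (\<lambda>y. \<forall>i. \<forall>v. cmod ((dderiv v ^^ j) (dderiv (axis i 1) F) y) \<le> C i * norm v ^ j) (nhds x)"
    using C(2) by (rule eventually_all_finite)
  ultimately have "eventually (\<lambda>y. \<forall>v. cmod ((dderiv v ^^ Suc j) F y) \<le> (\<Sum>i\<in>UNIV. C i) * norm v ^ Suc j) (nhds x)"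
  proof eventually_elim
    case (elim y)
    show ?case
    proof
      fix v
      have "cmod ((dderiv v ^^ Suc j) F y) \<le> (\<Sum>i\<in>UNIV. cmod (v $ i * (dderiv v ^^ j) (dderiv (axis i 1) F) y))"
        unfolding dderiv_iter_Suc[OF S Suc.prems elim(1)] by (rule norm_sum)
      also have "\<dots> \<le> (\<Sum>i\<in>UNIV. norm v * (C i * norm v ^ j))"
    unfolding norm_mult using elim(2)
        by (intro sum_mono mult_mono Finite_Cartesian_Product.norm_nth_le) (simp_all add: mult_nonneg_nonneg)
      also have "\<dots> = (\<Sum>i\<in>UNIV. C i) * norm v ^ Suc j"
        by (simp add: sum_distrib_left sum_distrib_right mult_ac)
      finally show "cmod ((dderiv v ^^ Suc j) F y) \<le> (\<Sum>i\<in>UNIV. C i) * norm v ^ Suc j" .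
    qed
  qed
  then show ?case using C(1) by (intro exI[of _ "\<Sum>i\<in>UNIV. C i"]) (auto intro: sum_nonneg)
qed

lemma dderiv_iter_zero:
  assumes S: "open S" and F: "analytic_fun F S"
    and zero: "\<And>t. x + t *s v \<in> S \<Longrightarrow> F (x + t *s v) = 0" and t: "x + t *s v \<in> S"
  shows "(dderiv v ^^ j) F (x + t *s v) = 0"
  using t
proof (induction j arbitrary: t)
  case (Suc j)
  define G where "G = (dderiv v ^^ j) F"
  have cont: "continuous_on UNIV (\<lambda>t. x + t *s v)" by (intro continuous_intros)
  have "((\<lambda>s. G (x + s *s v)) has_field_derivative dderiv v G (x + t *s v)) (at t)"
    by (rule analytic_fun_slice(1)[OF S _ Suc.prems]) (simp add: G_def analytic_fun_iter[OF S F])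
  moreover have "((\<lambda>s. G (x + s *s v)) has_field_derivative 0) (at t)"
    by (rule has_field_derivative_transform_within_open[OF DERIV_const[of 0] open_vimage[OF S cont]])
      (use Suc in \<open>auto simp: G_def\<close>)
  ultimately show ?case using DERIV_unique by (fastforce simp: G_def)
qed (use zero in simp)

text \<open>By the last property the polynomial inherits vanishing on linear subspaces through
  \<open>x\<close>: its value at \<open>z\<close> is built from derivatives along the line joining
  \<open>x\<close> to \<open>z\<close>.\<close>

lemma Taylor_polyfun:
  fixes F :: "complex^'n \<Rightarrow> complex"
  assumes S: "open S" and F: "analytic_fun F S" and x: "x \<in> S"
  obtains T where "T \<in> polyfun" "vord k (\<lambda>z. F z - T z) x"
    "\<And>z. (\<And>t. x + t *s (z - x) \<in> S \<Longrightarrow> F (x + t *s (z - x)) = 0) \<Longrightarrow> T z = 0"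
proof (cases k)
  case 0
  then show ?thesis using that[of "\<lambda>_. 0"] vord_analytic[OF S F x] by simp
next
  case (Suc n)
  \<comment> \<open>The one-variable Taylor polynomial of the slice from \<open>x\<close> towards
    \<open>z\<close>, taken at parameter 1; stopping at \<open>n\<close> leaves an error of order
    \<open>k = Suc n\<close>.\<close>
  define T where "T z = (\<Sum>i\<le>n. (dderiv (z - x) ^^ i) F x / fact i)" for z
  have "T \<in> polyfun"
  proof -
    have "(\<lambda>z. (dderiv (z - x) ^^ i) F x) \<in> polyfun" for i
      by (rule polyfun_compose[OF dderiv_iter_polyfun[OF S F x, of i], of "\<lambda>z. z - x"])
        (auto intro: polyfun_diff)
    then have "(\<lambda>z. \<Sum>i\<le>n. (dderiv (z - x) ^^ i) F x * (1 / fact i)) \<in> polyfun"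
      by (intro polyfun_sum polyfun_mult polyfun_const)
    then show ?thesis by (simp add: T_def[abs_def])
  qed
  moreover have "vord k (\<lambda>z. F z - T z) x"
  proof -
    obtain C where C: "0 \<le> C"
      "eventually (\<lambda>y. \<forall>v. cmod ((dderiv v ^^ k) F y) \<le> C * norm v ^ k) (nhds x)"
      using dderiv_iter_bound[OF S F x] by blast
    have "eventually (\<lambda>y. y \<in> S) (nhds x)" using S x by (intro eventually_nhds_in_open)
    with C(2) have "eventually (\<lambda>y. y \<in> S \<and> (\<forall>v. cmod ((dderiv v ^^ k) F y) \<le> C * norm v ^ k)) (nhds x)"
      by eventually_elim auto
    then obtain r where r: "0 < r"
      "\<And>y. dist y x < r \<Longrightarrow> y \<in> S" "\<And>y v. dist y x < r \<Longrightarrow> cmod ((dderiv v ^^ k) F y) \<le> C * norm v ^ k"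
      unfolding eventually_nhds_metric by blast
    have "cmod (F z - T z) \<le> (C / fact n) * norm (z - x) ^ k" if z: "dist z x < r" for z
    proof -
      define v where "v = z - x"
      have near: "dist (x + t *s v) x < r" if "cmod t \<le> 1" for t
      proof -
        have "norm (t *s v) \<le> 1 * norm v" unfolding norm_smult using that by (intro mult_right_mono) auto
        then show ?thesis using z by (simp add: dist_norm v_def)
      qed
      have "cmod ((dderiv v ^^ 0) F (x + 1 *s v) -
          (\<Sum>i\<le>n. (dderiv v ^^ i) F (x + 0 *s v) * (1 - 0) ^ i / fact i))
        \<le> (C * norm v ^ k) * cmod (1 - 0) ^ Suc n / fact n"
      proof (rule complex_Taylor[where S = "cball 0 1" and f = "\<lambda>i t. (dderiv v ^^ i) F (x + t *s v)"])
        fix i :: nat and t :: complex assume t: "t \<in> cball 0 1"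
        show "((\<lambda>t. (dderiv v ^^ i) F (x + t *s v)) has_field_derivative
            (dderiv v ^^ Suc i) F (x + t *s v)) (at t within cball 0 1)"
          using analytic_fun_slice(1)[OF S analytic_fun_iter[OF S F], of x t v i v] r(2) near t
          by (auto intro: has_field_derivative_at_within)
      next
        fix t :: complex assume "t \<in> cball 0 1"
        then show "cmod ((dderiv v ^^ Suc n) F (x + t *s v)) \<le> C * norm v ^ k"
          using r(3)[OF near, of t v] Suc by auto
      qed auto
      then show ?thesis by (simp add: T_def v_def)
    qed
    then show ?thesis unfolding vord_def eventually_nhds_metric using r(1) by blast
  qed
  moreover have "T z = 0" if "\<And>t. x + t *s (z - x) \<in> S \<Longrightarrow> F (x + t *s (z - x)) = 0" for z
    using dderiv_iter_zero[OF S F that, of 0] x by (simp add: T_def)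
  ultimately show ?thesis using that by blast
qed

section \<open>Reflections\<close>

lemma refl_add: "refl \<alpha> (x + y) = refl \<alpha> x + refl \<alpha> y"
  by (simp add: refl_def bil_simps distrib_left add_divide_distrib vec_eq_iff algebra_simps)

lemma refl_smult: "refl \<alpha> (a *s x) = a *s refl \<alpha> x"
  by (simp add: refl_def bil_simps vec_eq_iff algebra_simps)

lemma refl_linear: "linear (refl \<alpha>)"
  by (rule linearI) (auto simp: refl_add scaleR_eq_smult refl_smult)

lemma refl_diff: "refl \<alpha> (x - y) = refl \<alpha> x - refl \<alpha> y"
  using linear_diff[OF refl_linear] .

lemma refl_fixed: "bil \<alpha> x = 0 \<Longrightarrow> refl \<alpha> x = x"
  by (simp add: refl_def)

lemma refl_minus_root: "refl (- \<alpha>) = refl \<alpha>"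
  by (auto simp: refl_def bil_simps fun_eq_iff vec_eq_iff)

lemma bil_refl_self: "bil \<alpha> \<alpha> \<noteq> 0 \<Longrightarrow> bil \<alpha> (refl \<alpha> x) = - bil \<alpha> x"
  by (simp add: refl_def bil_simps)

lemma refl_involution: "bil \<alpha> \<alpha> \<noteq> 0 \<Longrightarrow> refl \<alpha> (refl \<alpha> x) = x"
  using bil_refl_self[of \<alpha> x] by (simp add: refl_def[of \<alpha> "refl \<alpha> x"]) (simp add: refl_def vec_eq_iff)

lemma refl_self: "bil \<alpha> \<alpha> \<noteq> 0 \<Longrightarrow> refl \<alpha> \<alpha> = - \<alpha>"
  by (simp add: refl_def vec_eq_iff)

lemma bil_refl_refl: "bil \<alpha> \<alpha> \<noteq> 0 \<Longrightarrow> bil (refl \<alpha> x) (refl \<alpha> y) = bil x y"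
  by (simp add: refl_def bil_simps field_simps bil_commute[of x \<alpha>])

lemma bil_refl_swap: "bil \<alpha> \<alpha> \<noteq> 0 \<Longrightarrow> bil (refl \<alpha> x) y = bil x (refl \<alpha> y)"
  using bil_refl_refl[of \<alpha> x "refl \<alpha> y"] by (simp add: refl_involution)

text \<open>Conjugation turns the bilinear form, which has isotropic vectors, into the Hermitian
  norm; reflections commute with it because roots are real.\<close>

definition cnjv :: "complex^'n \<Rightarrow> complex^'n" where "cnjv x = (\<chi> i. cnj (x $ i))"

lemma bil_cnjv: "bil x (cnjv x) = of_real ((norm x)\<^sup>2)"
  unfolding bil_def norm_vec_def L2_set_def
  by (simp add: cnjv_def complex_norm_square sum_nonneg flip: of_real_power)

lemma bil_cnjv_cnjv: "bil (cnjv x) (cnjv y) = cnj (bil x y)"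
  by (simp add: bil_def cnjv_def)

locale root_sys =
  fixes R :: "(complex^'n) set"
  assumes root_system: "root_system R"
begin

lemma finite_R: "finite R"
  using root_system by (simp add: root_system_def)

lemma root_cnjv: "\<alpha> \<in> R \<Longrightarrow> cnjv \<alpha> = \<alpha>"
  using root_system by (auto simp: root_system_def cnjv_def vec_eq_iff Reals_cnj_iff)

lemma root_nonzero: "\<alpha> \<in> R \<Longrightarrow> \<alpha> \<noteq> 0"
  using root_system by (auto simp: root_system_def)

lemma bil_root: "\<alpha> \<in> R \<Longrightarrow> bil \<alpha> \<alpha> \<noteq> 0"
  using bil_cnjv[of \<alpha>] root_cnjv[of \<alpha>] root_nonzero[of \<alpha>] by simp

lemma refl_in_R: "\<alpha> \<in> R \<Longrightarrow> \<beta> \<in> R \<Longrightarrow> refl \<alpha> \<beta> \<in> R"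
  using root_system unfolding root_system_def by blast

lemma minus_in_R: "\<alpha> \<in> R \<Longrightarrow> - \<alpha> \<in> R"
  using refl_in_R[of \<alpha> \<alpha>] refl_self[OF bil_root] by metis

lemma refl_refl: "\<alpha> \<in> R \<Longrightarrow> refl \<alpha> (refl \<alpha> x) = x"
  by (simp add: refl_involution bil_root)

lemma norm_refl: "\<alpha> \<in> R \<Longrightarrow> norm (refl \<alpha> x) = norm x"
proof -
  assume a: "\<alpha> \<in> R"
  have "cnjv (refl \<alpha> x) = refl \<alpha> (cnjv x)"
    using bil_cnjv_cnjv[of \<alpha> x] bil_cnjv_cnjv[of \<alpha> \<alpha>] root_cnjv[OF a]
    by (simp add: refl_def vec_eq_iff cnjv_def[of "_ - _"]) (metis cnjv_def vec_lambda_beta)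
  then have "of_real ((norm (refl \<alpha> x))\<^sup>2) = (of_real ((norm x)\<^sup>2) :: complex)"
    using bil_refl_refl[OF bil_root[OF a], of x "cnjv x"] by (simp only: bil_cnjv[symmetric])
  then show ?thesis by (simp only: of_real_eq_iff) simp
qed

section \<open>Stable domains and reflection quotients\<close>

text \<open>The value of a Dunkl operator at a point involves the reflected points, so domains have
  to be stable.\<close>

definition refl_dom :: "(complex^'n) set \<Rightarrow> bool" where
  "refl_dom \<Omega> \<longleftrightarrow> open \<Omega> \<and> (\<forall>\<alpha>\<in>R. \<forall>x\<in>\<Omega>. refl \<alpha> x \<in> \<Omega>)"

lemma refl_dom_open: "refl_dom \<Omega> \<Longrightarrow> open \<Omega>"
  and refl_dom_refl: "refl_dom \<Omega> \<Longrightarrow> \<alpha> \<in> R \<Longrightarrow> x \<in> \<Omega> \<Longrightarrow> refl \<alpha> x \<in> \<Omega>"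
  by (auto simp: refl_dom_def)

lemma refl_dom_UNIV [simp]: "refl_dom UNIV"
  by (simp add: refl_dom_def)

lemma analytic_fun_refl:
  "refl_dom \<Omega> \<Longrightarrow> \<alpha> \<in> R \<Longrightarrow> analytic_fun f \<Omega> \<Longrightarrow> analytic_fun (\<lambda>x. f (refl \<alpha> x)) \<Omega>"
  by (rule analytic_fun_compose_linear[OF _ refl_linear refl_smult refl_dom_refl])

text \<open>Runs from \<open>z\<close> at \<open>\<tau> = 0\<close> to
  \<open>refl \<alpha> z\<close> at \<open>\<tau> = 1\<close>.\<close>

definition seg :: "complex^'n \<Rightarrow> complex^'n \<Rightarrow> real \<Rightarrow> complex^'n" where
  "seg \<alpha> z \<tau> = z - (of_real \<tau> * (2 * bil \<alpha> z / bil \<alpha> \<alpha>)) *s \<alpha>"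

text \<open>For \<open>x\<close> on the mirror both ends of the segment are equally far from
  \<open>x\<close>, as reflections preserve the Hermitian norm; convexity does the rest.\<close>

lemma seg_cball:
  assumes "\<alpha> \<in> R" "bil \<alpha> x = 0" "\<tau> \<in> {0..1}"
  shows "norm (seg \<alpha> z \<tau> - x) \<le> norm (z - x)"
proof -
  have "seg \<alpha> z \<tau> - x = (1 - \<tau>) *\<^sub>R (z - x) + \<tau> *\<^sub>R (refl \<alpha> z - refl \<alpha> x)"
    unfolding refl_fixed[OF assms(2)]
    by (simp add: seg_def refl_def scaleR_eq_smult vec_eq_iff algebra_simps)
  also have "norm \<dots> \<le> (1 - \<tau>) * norm (z - x) + \<tau> * norm (refl \<alpha> z - refl \<alpha> x)"
    using assms(3) by (intro order_trans[OF norm_triangle_ineq]) simp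
  also have "\<dots> = norm (z - x)"
    using norm_refl[OF assms(1), of "z - x"] by (simp add: refl_diff algebra_simps)
  finally show ?thesis .
qed

text \<open>The analytic factor of Hadamard's lemma: integrating the derivative along the segment
  shows that \<open>f z - f (refl \<alpha> z)\<close> is divisible by \<open>bil \<alpha> z\<close>,
  which removes the singularity of the quotient.\<close>

definition mean_dderiv :: "complex^'n \<Rightarrow> (complex^'n \<Rightarrow> complex) \<Rightarrow> complex^'n \<Rightarrow> complex" where
  "mean_dderiv \<alpha> f z = integral {0..1} (\<lambda>\<tau>. dderiv \<alpha> f (seg \<alpha> z \<tau>))"

text \<open>Moving off the mirror along the root itself shows that the limit in
  \<open>refl_quotient\<close> is taken at a limit point, hence is uniquely determined.\<close>

lemma mirror_limpt:
  assumes "\<alpha> \<in> R" "bil \<alpha> z = 0"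
  shows "at z within {y. bil \<alpha> y \<noteq> 0} \<noteq> bot"
proof -
  have "\<exists>y\<in>{y. bil \<alpha> y \<noteq> 0}. y \<noteq> z \<and> dist y z < e" if "0 < e" for e :: real
  proof -
    define t where "t = e / (2 * norm \<alpha>)"
    have n: "0 < norm \<alpha>" using root_nonzero[OF assms(1)] by simp
    then have t: "0 < t" "t * norm \<alpha> < e" using that by (simp_all add: t_def)
    define y where "y = z + of_real t *s \<alpha>"
    have "bil \<alpha> y = of_real t * bil \<alpha> \<alpha>" by (simp add: y_def bil_simps assms)
    then have "bil \<alpha> y \<noteq> 0" using t bil_root[OF assms(1)] by simp
    moreover have "dist y z < e" using t by (simp add: y_def dist_norm norm_smult)
    ultimately show ?thesis using assms(2) by (intro bexI[of _ y]) auto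
  qed
  then have "z islimpt {y. bil \<alpha> y \<noteq> 0}" unfolding islimpt_approachable by blast
  then show ?thesis by (simp add: trivial_limit_within)
qed

lemma mean_dderiv:
  fixes f :: "complex^'n \<Rightarrow> complex"
  assumes S: "open S" and f: "analytic_fun f S" and a: "\<alpha> \<in> R"
    and x: "bil \<alpha> x = 0" and r: "ball x r \<subseteq> S"
  shows "analytic_fun (mean_dderiv \<alpha> f) (ball x r)"
    and "z \<in> ball x r \<Longrightarrow> f z - f (refl \<alpha> z) = 2 * bil \<alpha> z / bil \<alpha> \<alpha> * mean_dderiv \<alpha> f z"
    and "z \<in> ball x r \<Longrightarrow> bil \<alpha> z = 0 \<Longrightarrow> mean_dderiv \<alpha> f z = dderiv \<alpha> f z"
    and "z \<in> ball x r \<Longrightarrow> refl_quotient \<alpha> f z = 2 / bil \<alpha> \<alpha> * mean_dderiv \<alpha> f z"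
proof -
  have seg: "seg \<alpha> z \<tau> \<in> ball x r" if "z \<in> ball x r" "\<tau> \<in> {0..1}" for z \<tau>
    using seg_cball[OF a x that(2), of z] that(1) by (auto simp: dist_norm norm_minus_commute)
  have df: "analytic_fun (dderiv \<alpha> f) (ball x r)"
    by (rule analytic_fun_subset[OF analytic_fun_dderiv[OF S f] r])
  show an: "analytic_fun (mean_dderiv \<alpha> f) (ball x r)"
    unfolding mean_dderiv_def
  proof (rule analytic_fun_integral)
    fix t :: real assume t: "t \<in> {0..1}"
    have "linear (\<lambda>z. seg \<alpha> z t)"
      by (rule linearI) (auto simp: seg_def bil_simps scaleR_eq_smult vec_eq_iff field_simps add_divide_distrib)
    then show "analytic_fun (\<lambda>z. dderiv \<alpha> f (seg \<alpha> z t)) (ball x r)"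
      by (rule analytic_fun_compose_linear[OF df])
        (use seg t in \<open>auto simp: seg_def bil_simps vec_eq_iff algebra_simps\<close>)
  next
    have "continuous_on (ball x r \<times> {0..1}) (\<lambda>p. dderiv \<alpha> f (seg \<alpha> (fst p) (snd p)))"
    proof (rule continuous_on_compose2[OF analytic_fun_continuous[OF df]])
      show "continuous_on (ball x r \<times> {0..1}) (\<lambda>p. seg \<alpha> (fst p) (snd p))"
        unfolding seg_def using bil_root[OF a] by (intro continuous_intros) auto
    qed (use seg in auto)
    then show "continuous_on (ball x r \<times> {0..1}) (\<lambda>(z, \<tau>). dderiv \<alpha> f (seg \<alpha> z \<tau>))"
      by (simp add: case_prod_unfold)
  qed simp
  show quot: "f z - f (refl \<alpha> z) = 2 * bil \<alpha> z / bil \<alpha> \<alpha> * mean_dderiv \<alpha> f z" if z: "z \<in> ball x r" for z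
  proof -
    define u where "u = 2 * bil \<alpha> z / bil \<alpha> \<alpha>"
    have segu: "seg \<alpha> z \<tau> = z + (- (of_real \<tau> * u)) *s \<alpha>" for \<tau>
      by (simp add: seg_def u_def vec_eq_iff)
    have "((\<lambda>\<tau>. f (seg \<alpha> z \<tau>)) has_vector_derivative - u * dderiv \<alpha> f (seg \<alpha> z \<tau>)) (at \<tau> within {0..1})"
      if "\<tau> \<in> {0..1}" for \<tau>
    proof -
      have A: "((\<lambda>t. f (z + t *s \<alpha>)) has_field_derivative dderiv \<alpha> f (seg \<alpha> z \<tau>)) (at (- (of_real \<tau> * u)))"
        unfolding segu by (rule analytic_fun_slice(1)[OF S f]) (use seg[OF z that] r segu in auto)
      have B: "((\<lambda>\<tau>. - (of_real \<tau> * u)) has_vector_derivative - u) (at \<tau> within {0..1})"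
        unfolding has_vector_derivative_def
        by (auto intro!: derivative_eq_intros simp: scaleR_conv_of_real)
      have "(((\<lambda>t. f (z + t *s \<alpha>)) \<circ> (\<lambda>\<tau>. - (of_real \<tau> * u))) has_vector_derivative
          - u * dderiv \<alpha> f (seg \<alpha> z \<tau>)) (at \<tau> within {0..1})"
        by (rule field_vector_diff_chain_within[OF B has_field_derivative_at_within[OF A]])
      then show ?thesis by (simp add: o_def segu)
    qed
    then have "((\<lambda>\<tau>. - u * dderiv \<alpha> f (seg \<alpha> z \<tau>)) has_integral f (seg \<alpha> z 1) - f (seg \<alpha> z 0)) {0..1}"
      by (intro fundamental_theorem_of_calculus) auto
    from integral_unique[OF this] have "- u * mean_dderiv \<alpha> f z = f (seg \<alpha> z 1) - f (seg \<alpha> z 0)"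
      by (simp add: mean_dderiv_def)
    then show ?thesis by (simp add: seg_def refl_def u_def algebra_simps)
  qed
  show mirror: "mean_dderiv \<alpha> f z = dderiv \<alpha> f z" if "z \<in> ball x r" "bil \<alpha> z = 0" for z
    using that by (simp add: mean_dderiv_def seg_def)
  show "refl_quotient \<alpha> f z = 2 / bil \<alpha> \<alpha> * mean_dderiv \<alpha> f z" if z: "z \<in> ball x r" for z
  proof (cases "bil \<alpha> z = 0")
    case False
    then show ?thesis by (simp add: refl_quotient_def quot[OF z])
  next
    case True
    have "isCont (mean_dderiv \<alpha> f) z"
      using analytic_fun_continuous[OF an] z continuous_on_eq_continuous_at by blast
    then have "(mean_dderiv \<alpha> f \<longlongrightarrow> mean_dderiv \<alpha> f z) (at z within {y. bil \<alpha> y \<noteq> 0})"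
      using isCont_def tendsto_within_subset by blast
    then have lim: "((\<lambda>y. 2 / bil \<alpha> \<alpha> * mean_dderiv \<alpha> f y) \<longlongrightarrow> 2 / bil \<alpha> \<alpha> * mean_dderiv \<alpha> f z)
        (at z within {y. bil \<alpha> y \<noteq> 0})"
      by (intro tendsto_intros)
    have "((\<lambda>y. (f y - f (refl \<alpha> y)) / bil \<alpha> y) \<longlongrightarrow> 2 / bil \<alpha> \<alpha> * mean_dderiv \<alpha> f z)
        (at z within {y. bil \<alpha> y \<noteq> 0})"
      by (rule Lim_transform_eventually[OF lim])
        (use z in \<open>auto simp: eventually_at_topological quot intro!: exI[of _ "ball x r"]\<close>)
    from tendsto_Lim[OF mirror_limpt[OF a True] this] show ?thesis
      by (simp add: refl_quotient_def True)
  qed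
qed

text \<open>Trades the \<open>Lim\<close> of the definition for a derivative, so that later
  identities for Dunkl operators reduce to algebra in two cases.\<close>

lemma refl_quotient_eq:
  assumes "refl_dom \<Omega>" "analytic_fun f \<Omega>" "\<alpha> \<in> R" "x \<in> \<Omega>"
  shows "refl_quotient \<alpha> f x =
    (if bil \<alpha> x \<noteq> 0 then (f x - f (refl \<alpha> x)) / bil \<alpha> x else 2 / bil \<alpha> \<alpha> * dderiv \<alpha> f x)"
proof (cases "bil \<alpha> x = 0")
  case True
  obtain r where r: "0 < r" "ball x r \<subseteq> \<Omega>" using assms refl_dom_open openE by blast
  have x: "x \<in> ball x r" using r by simp
  show ?thesis
    using mean_dderiv(3,4)[OF refl_dom_open[OF assms(1)] assms(2,3) True r(2) x] True by simp
qed (simp add: refl_quotient_def)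

lemma refl_quotient_analytic:
  assumes dom: "refl_dom \<Omega>" and f: "analytic_fun f \<Omega>" and a: "\<alpha> \<in> R"
  shows "analytic_fun (refl_quotient \<alpha> f) \<Omega>"
proof (rule analytic_fun_local)
  fix x assume x: "x \<in> \<Omega>"
  show "\<exists>T. open T \<and> x \<in> T \<and> analytic_fun (refl_quotient \<alpha> f) (\<Omega> \<inter> T)"
  proof (cases "bil \<alpha> x = 0")
    case True
    obtain r where r: "0 < r" "ball x r \<subseteq> \<Omega>" using x dom refl_dom_open openE by blast
    note m = mean_dderiv[OF refl_dom_open[OF dom] f a True r(2)]
    have "analytic_fun (\<lambda>z. 2 / bil \<alpha> \<alpha> * mean_dderiv \<alpha> f z) (ball x r)"
      by (intro analytic_fun_cmult m)
    then have "analytic_fun (refl_quotient \<alpha> f) (ball x r)"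
      by (rule analytic_fun_cong) (simp add: m(4))
    then show ?thesis using r by (intro exI[of _ "ball x r"]) (auto intro: analytic_fun_subset)
  next
    case False
    define T where "T = {y. bil \<alpha> y \<noteq> 0}"
    have "open T" unfolding T_def by (intro open_Collect_neq continuous_intros)
    moreover have "analytic_fun (\<lambda>z. (f z - f (refl \<alpha> z)) / bil \<alpha> z) (\<Omega> \<inter> T)"
      by (rule analytic_fun_subset[of _ "\<Omega> \<inter> T"], intro analytic_fun_divide analytic_fun_diff analytic_fun_bil)
        (auto simp: T_def intro: analytic_fun_subset[OF f] analytic_fun_subset[OF analytic_fun_refl[OF dom a f]])
    then have "analytic_fun (refl_quotient \<alpha> f) (\<Omega> \<inter> T)"
      by (rule analytic_fun_cong) (auto simp: refl_quotient_def T_def)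
    ultimately show ?thesis using False by (intro exI[of _ T]) (auto simp: T_def)
  qed
qed

text \<open>The quotient averages a derivative over points no farther from \<open>x\<close> than
  \<open>z\<close>, so it loses one order exactly as the derivative does.\<close>

lemma refl_quotient_vord_mirror:
  assumes S: "open S" and f: "analytic_fun f S" and a: "\<alpha> \<in> R" and x: "x \<in> S" "bil \<alpha> x = 0"
    and v: "vord (Suc k) f x"
  shows "vord k (refl_quotient \<alpha> f) x"
proof -
  obtain r where r: "0 < r" "ball x r \<subseteq> S" using x S openE by blast
  obtain C where C: "0 \<le> C" "eventually (\<lambda>z. cmod (dderiv \<alpha> f z) \<le> C * norm (z - x) ^ k) (nhds x)"
    by (rule vordE[OF vord_dderiv[OF S f x(1) v]])
  then obtain d where d: "0 < d" "\<And>z. dist z x < d \<Longrightarrow> cmod (dderiv \<alpha> f z) \<le> C * norm (z - x) ^ k"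
    unfolding eventually_nhds_metric by blast
  define e where "e = min r d"
  have e: "0 < e" "e \<le> r" "e \<le> d" using r d by (auto simp: e_def)
  have "cmod (mean_dderiv \<alpha> f z) \<le> C * norm (z - x) ^ k" if z: "dist z x < e" for z
  proof -
    have "cmod (dderiv \<alpha> f (seg \<alpha> z \<tau>)) \<le> C * norm (z - x) ^ k" if t: "\<tau> \<in> {0..1}" for \<tau>
    proof -
      have s: "norm (seg \<alpha> z \<tau> - x) \<le> norm (z - x)" by (rule seg_cball[OF a x(2) t])
      have "cmod (dderiv \<alpha> f (seg \<alpha> z \<tau>)) \<le> C * norm (seg \<alpha> z \<tau> - x) ^ k"
        using s z e d(2) by (auto simp: dist_norm)
      also have "\<dots> \<le> C * norm (z - x) ^ k" by (intro mult_left_mono power_mono s C(1)) auto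
      finally show ?thesis .
    qed
    moreover have "(\<lambda>\<tau>. dderiv \<alpha> f (seg \<alpha> z \<tau>)) integrable_on {0..1}"
    proof (rule integrable_continuous_interval, rule continuous_on_compose2[OF analytic_fun_continuous[OF analytic_fun_dderiv[OF S f]]])
      show "continuous_on {0..1} (seg \<alpha> z)"
        unfolding seg_def by (intro continuous_intros)
      show "seg \<alpha> z ` {0..1} \<subseteq> S"
      proof
        fix y assume "y \<in> seg \<alpha> z ` {0..1}"
        then obtain \<tau> where "\<tau> \<in> {0..1}" "y = seg \<alpha> z \<tau>" by blast
        then have "norm (y - x) \<le> norm (z - x)" using seg_cball[OF a x(2)] by blast
        then have "y \<in> ball x r" using z e by (auto simp: dist_norm norm_minus_commute)
        then show "y \<in> S" using r by blast
      qed
    qed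
    ultimately have "norm (integral (cbox 0 1) (\<lambda>\<tau>. dderiv \<alpha> f (seg \<alpha> z \<tau>))) \<le>
        C * norm (z - x) ^ k * measure lborel (cbox 0 (1::real))"
      by (intro integrable_bound) (use C(1) in \<open>auto intro!: mult_nonneg_nonneg\<close>)
    then show ?thesis by (simp add: mean_dderiv_def)
  qed
  then have m: "vord k (mean_dderiv \<alpha> f) x"
    unfolding vord_def eventually_nhds_metric using e(1) by blast
  show ?thesis
    by (rule vord_cong[OF vord_cmult[OF m, of "2 / bil \<alpha> \<alpha>"], where S = "ball x r"])
      (use r mean_dderiv(4)[OF S f a x(2) r(2)] in auto)
qed

text \<open>Off the mirror the denominator is harmless and no order is lost, but the order at the
  reflected point enters as well.\<close>

lemma refl_quotient_vord:
  assumes a: "\<alpha> \<in> R" and x: "bil \<alpha> x \<noteq> 0" and v: "vord k f x" "vord k f (refl \<alpha> x)"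
  shows "vord k (refl_quotient \<alpha> f) x"
proof -
  define T where "T = {y. bil \<alpha> y \<noteq> 0}"
  have T: "open T" unfolding T_def by (intro open_Collect_neq continuous_intros)
  have "analytic_fun (\<lambda>z. 1 / bil \<alpha> z) T"
    by (intro analytic_fun_divide analytic_fun_const analytic_fun_bil) (simp add: T_def)
  then have "vord 0 (\<lambda>z. 1 / bil \<alpha> z) x" by (rule vord_analytic[OF T]) (use x in \<open>simp add: T_def\<close>)
  moreover have "vord k (\<lambda>z. f (refl \<alpha> z)) x"
    using vord_linear_compose[of k f 0 "refl \<alpha>" x] v(2) refl_linear[of \<alpha>] by simp
  ultimately have "vord (0 + k) (\<lambda>z. 1 / bil \<alpha> z * (f z - f (refl \<alpha> z))) x"
    by (intro vord_mult vord_diff v)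
  then have "vord (0 + k) (refl_quotient \<alpha> f) x"
    by (rule vord_cong[OF _ T]) (use x in \<open>auto simp: T_def refl_quotient_def\<close>)
  then show ?thesis by simp
qed

end

section \<open>Dunkl operators on analytic functions\<close>

locale dunkl_data = root_sys R for R :: "(complex^'n) set" +
  fixes Rp :: "(complex^'n) set" and c :: "complex^'n \<Rightarrow> complex"
  assumes Rp_sub: "Rp \<subseteq> R"
    and Rp_cover: "\<alpha> \<in> R \<Longrightarrow> \<alpha> \<in> Rp \<or> - \<alpha> \<in> Rp"
    and Rp_neg: "\<alpha> \<in> Rp \<Longrightarrow> - \<alpha> \<notin> Rp"
    and c_inv: "invariant_multiplicity R c"
begin

abbreviation dk :: "complex^'n \<Rightarrow> 'n operator" where "dk \<equiv> dunkl Rp c"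

lemma Rp_R: "\<alpha> \<in> Rp \<Longrightarrow> \<alpha> \<in> R"
  using Rp_sub by blast

lemma finite_Rp: "finite Rp"
  using finite_subset[OF Rp_sub finite_R] .

lemma c_refl: "\<alpha> \<in> R \<Longrightarrow> \<beta> \<in> R \<Longrightarrow> c (refl \<beta> \<alpha>) = c \<alpha>"
proof -
  assume a: "\<alpha> \<in> R" "\<beta> \<in> R"
  have "refl \<beta> \<circ> id \<in> refl_group R" by (intro refl_group.intros a)
  then show ?thesis using c_inv a unfolding invariant_multiplicity_def by fastforce
qed

lemma c_minus: "\<alpha> \<in> R \<Longrightarrow> c (- \<alpha>) = c \<alpha>"
  using c_refl[of \<alpha> \<alpha>] refl_self[OF bil_root] by metis

lemma refl_quotient_cong:
  assumes dom: "refl_dom \<Omega>" and f: "analytic_fun f \<Omega>" and eq: "\<And>y. y \<in> \<Omega> \<Longrightarrow> f y = g y"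
    and x: "x \<in> \<Omega>" and a: "\<alpha> \<in> R"
  shows "refl_quotient \<alpha> f x = refl_quotient \<alpha> g x"
  using refl_quotient_eq[OF dom f a x] refl_quotient_eq[OF dom analytic_fun_cong[OF f eq] a x]
    eq[OF x] eq[OF refl_dom_refl[OF dom a x]] dderiv_cong_open[OF refl_dom_open[OF dom] x eq, where \<xi> = \<alpha>]
  by simp

lemma dunkl_cong:
  assumes dom: "refl_dom \<Omega>" and f: "analytic_fun f \<Omega>" and eq: "\<And>y. y \<in> \<Omega> \<Longrightarrow> f y = g y"
    and x: "x \<in> \<Omega>"
  shows "dk \<xi> f x = dk \<xi> g x"
proof -
  have "refl_quotient \<alpha> f x = refl_quotient \<alpha> g x" if "\<alpha> \<in> Rp" for \<alpha>
    by (rule refl_quotient_cong[OF dom f eq x Rp_R[OF that]])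
  moreover have "dderiv \<xi> f x = dderiv \<xi> g x"
    by (rule dderiv_cong_open[OF refl_dom_open[OF dom] x eq])
  ultimately show ?thesis unfolding dunkl_def by simp
qed

lemma dunkl_analytic:
  assumes "refl_dom \<Omega>" "analytic_fun f \<Omega>"
  shows "analytic_fun (dk \<xi> f) \<Omega>"
proof -
  have "analytic_fun (\<lambda>x. dderiv \<xi> f x - (\<Sum>\<alpha>\<in>Rp. c \<alpha> * bil \<alpha> \<xi> * refl_quotient \<alpha> f x)) \<Omega>"
    by (intro analytic_fun_diff analytic_fun_sum analytic_fun_cmult refl_quotient_analytic
        analytic_fun_dderiv refl_dom_open assms Rp_R)
  then show ?thesis by (simp add: dunkl_def[abs_def])
qed

lemma refl_quotient_add:
  assumes "refl_dom \<Omega>" "analytic_fun f \<Omega>" "analytic_fun g \<Omega>" "\<alpha> \<in> R" "x \<in> \<Omega>"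
  shows "refl_quotient \<alpha> (\<lambda>x. f x + g x) x = refl_quotient \<alpha> f x + refl_quotient \<alpha> g x"
  by (simp add: refl_quotient_eq[OF assms(1) _ assms(4,5)] analytic_fun_add assms(2,3)
      dderiv_add[OF refl_dom_open[OF assms(1)] assms(2,3,5)] algebra_simps add_divide_distrib diff_divide_distrib)

lemma dunkl_add:
  assumes "refl_dom \<Omega>" "analytic_fun f \<Omega>" "analytic_fun g \<Omega>" "x \<in> \<Omega>"
  shows "dk \<xi> (\<lambda>x. f x + g x) x = dk \<xi> f x + dk \<xi> g x"
  unfolding dunkl_def dderiv_add[OF refl_dom_open[OF assms(1)] assms(2-4)]
  by (simp add: refl_quotient_add[OF assms(1-3) Rp_R assms(4)] distrib_left sum.distrib)

lemma refl_quotient_cmult: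
  assumes "refl_dom \<Omega>" "analytic_fun f \<Omega>" "\<alpha> \<in> R" "x \<in> \<Omega>"
  shows "refl_quotient \<alpha> (\<lambda>x. a * f x) x = a * refl_quotient \<alpha> f x"
  by (simp add: refl_quotient_eq[OF assms(1) _ assms(3,4)] analytic_fun_cmult assms(2)
      dderiv_cmult[OF refl_dom_open[OF assms(1)] assms(2,4)] algebra_simps)

lemma dunkl_cmult:
  assumes "refl_dom \<Omega>" "analytic_fun f \<Omega>" "x \<in> \<Omega>"
  shows "dk \<xi> (\<lambda>x. a * f x) x = a * dk \<xi> f x"
  unfolding dunkl_def dderiv_cmult[OF refl_dom_open[OF assms(1)] assms(2,3)]
  by (simp add: refl_quotient_cmult[OF assms(1,2) Rp_R assms(3)] algebra_simps sum_distrib_left)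

lemma refl_quotient_const: "refl_quotient \<alpha> (\<lambda>x. a) x = 0" if "\<alpha> \<in> R"
  using refl_quotient_eq[OF refl_dom_UNIV analytic_fun_const that, where x = x] by simp

lemma dunkl_const [simp]: "dk \<xi> (\<lambda>x. a) x = 0"
  by (simp add: dunkl_def refl_quotient_const Rp_R)

lemma dunkl_sum:
  assumes "refl_dom \<Omega>" "\<And>i. i \<in> I \<Longrightarrow> analytic_fun (f i) \<Omega>" "x \<in> \<Omega>"
  shows "dk \<xi> (\<lambda>x. \<Sum>i\<in>I. f i x) x = (\<Sum>i\<in>I. dk \<xi> (f i) x)"
  using assms(2)
proof (induction I rule: infinite_finite_induct)
  case (insert i I)
  have "dk \<xi> (\<lambda>x. f i x + (\<Sum>i\<in>I. f i x)) x = dk \<xi> (f i) x + dk \<xi> (\<lambda>x. \<Sum>i\<in>I. f i x) x"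
    by (rule dunkl_add[OF assms(1) _ _ assms(3)]) (use insert in \<open>auto intro!: analytic_fun_sum\<close>)
  then show ?case using insert by simp
qed auto

lemma dunkl_diff:
  assumes "refl_dom \<Omega>" "analytic_fun f \<Omega>" "analytic_fun g \<Omega>" "x \<in> \<Omega>"
  shows "dk \<xi> (\<lambda>x. f x - g x) x = dk \<xi> f x - dk \<xi> g x"
  using dunkl_add[OF assms(1,2) analytic_fun_cmult[OF assms(3), of "-1"] assms(4), of \<xi>]
    dunkl_cmult[OF assms(1,3,4), of \<xi> "-1"] by simp

lemma dunkl_dir_diff_smult:
  assumes "refl_dom \<Omega>" "analytic_fun f \<Omega>" "x \<in> \<Omega>"
  shows "dk (\<xi> - a *s \<eta>) f x = dk \<xi> f x - a * dk \<eta> f x"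
proof -
  have "dderiv (\<xi> - a *s \<eta>) f x = dderiv \<xi> f x - a * dderiv \<eta> f x"
    using dderiv_add_dir[OF refl_dom_open[OF assms(1)] assms(2,3), of \<xi> "(- a) *s \<eta>"]
      dderiv_smult_dir[OF refl_dom_open[OF assms(1)] assms(2,3), of "- a" \<eta>]
    by (simp add: vec.scale_minus_left)
  then show ?thesis
    by (simp add: dunkl_def bil_simps algebra_simps sum.distrib sum_subtractf sum_distrib_left)
qed

lemma dunkl_dir_sum:
  assumes "refl_dom \<Omega>" "analytic_fun f \<Omega>" "x \<in> \<Omega>"
  shows "dk (\<Sum>i\<in>I. a i *s v i) f x = (\<Sum>i\<in>I. a i * dk (v i) f x)"
proof -
  have "(\<Sum>i\<in>I. \<Sum>\<alpha>\<in>Rp. a i * (c \<alpha> * bil \<alpha> (v i) * refl_quotient \<alpha> f x)) =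
      (\<Sum>\<alpha>\<in>Rp. \<Sum>i\<in>I. a i * (c \<alpha> * bil \<alpha> (v i) * refl_quotient \<alpha> f x))"
    by (rule sum.swap)
  then show ?thesis
    by (simp add: dunkl_def dderiv_sum_dir[OF refl_dom_open[OF assms(1)] assms(2,3)] bil_simps
        sum_subtractf right_diff_distrib sum_distrib_left sum_distrib_right mult_ac)
qed

text \<open>The summand of a Dunkl operator is even in the root, so the sum over positive roots is half
  the sum over all roots, which is manifestly invariant under the reflections.\<close>

lemma sum_Rp_half:
  assumes "\<And>\<alpha>. \<alpha> \<in> R \<Longrightarrow> h (- \<alpha>) = h \<alpha>"
  shows "(\<Sum>\<alpha>\<in>Rp. h \<alpha>) = (\<Sum>\<alpha>\<in>R. h \<alpha>) / (2::complex)"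
proof -
  have R: "R = Rp \<union> uminus ` Rp"
    using Rp_sub Rp_cover minus_in_R by (auto simp: image_iff) (metis minus_minus)
  have "Rp \<inter> uminus ` Rp = {}" using Rp_neg by auto
  then have "(\<Sum>\<alpha>\<in>R. h \<alpha>) = (\<Sum>\<alpha>\<in>Rp. h \<alpha>) + (\<Sum>\<alpha>\<in>uminus ` Rp. h \<alpha>)"
    by (subst R) (intro sum.union_disjoint finite_imageI finite_Rp)
  also have "(\<Sum>\<alpha>\<in>uminus ` Rp. h \<alpha>) = (\<Sum>\<alpha>\<in>Rp. h (- \<alpha>))"
    by (subst sum.reindex) (auto simp: inj_on_def)
  also have "\<dots> = (\<Sum>\<alpha>\<in>Rp. h \<alpha>)" using assms Rp_R by (intro sum.cong) auto
  finally show ?thesis by simp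
qed

lemma refl_quotient_minus_root:
  assumes "refl_dom \<Omega>" "analytic_fun f \<Omega>" "\<alpha> \<in> R" "x \<in> \<Omega>"
  shows "refl_quotient (- \<alpha>) f x = - refl_quotient \<alpha> f x"
proof -
  have "dderiv (- \<alpha>) f x = - dderiv \<alpha> f x"
    using dderiv_smult_dir[OF refl_dom_open[OF assms(1)] assms(2,4), of "-1" \<alpha>]
    by (simp add: vec.scale_minus_left)
  then show ?thesis
    by (simp add: refl_quotient_eq[OF assms(1,2) _ assms(4)] minus_in_R assms(3) refl_minus_root bil_simps)
qed

lemma refl_quotient_refl:
  assumes dom: "refl_dom \<Omega>" and f: "analytic_fun f \<Omega>" and a: "\<alpha> \<in> R" and b: "\<beta> \<in> R" and x: "x \<in> \<Omega>"
  shows "refl_quotient \<alpha> (\<lambda>z. f (refl \<beta> z)) x = refl_quotient (refl \<beta> \<alpha>) f (refl \<beta> x)"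
proof -
  have "refl \<beta> (refl \<alpha> x) = refl (refl \<beta> \<alpha>) (refl \<beta> x)"
    by (simp add: refl_def[of \<alpha>] refl_def[of "refl \<beta> \<alpha>"] refl_diff refl_smult
        bil_refl_refl[OF bil_root[OF b]])
  moreover have "dderiv \<alpha> (\<lambda>z. f (refl \<beta> z)) x = dderiv (refl \<beta> \<alpha>) f (refl \<beta> x)"
    using dderiv_linear_compose[of "refl \<beta>" \<alpha> f 0 x] by (simp add: refl_add refl_smult)
  ultimately show ?thesis
    by (simp add: refl_quotient_eq[OF dom analytic_fun_refl[OF dom b f] a x]
      refl_quotient_eq[OF dom f refl_in_R[OF b a] refl_dom_refl[OF dom b x]]
      bil_refl_refl[OF bil_root[OF b]])
qed

lemma dunkl_refl:
  assumes dom: "refl_dom \<Omega>" and f: "analytic_fun f \<Omega>" and b: "\<beta> \<in> R" and x: "x \<in> \<Omega>"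
  shows "dk \<xi> (\<lambda>z. f (refl \<beta> z)) x = dk (refl \<beta> \<xi>) f (refl \<beta> x)"
proof -
  define h where "h g \<eta> y \<alpha> = c \<alpha> * bil \<alpha> \<eta> * refl_quotient \<alpha> g y" for g \<eta> y \<alpha>
  have half: "(\<Sum>\<alpha>\<in>Rp. h g \<eta> y \<alpha>) = (\<Sum>\<alpha>\<in>R. h g \<eta> y \<alpha>) / 2"
    if "analytic_fun g \<Omega>" "y \<in> \<Omega>" for g \<eta> y
    by (rule sum_Rp_half)
      (simp add: h_def c_minus bil_simps refl_quotient_minus_root[OF dom that(1) _ that(2)])
  have bij: "bij_betw (refl \<beta>) R R"
    by (rule bij_betw_byWitness[of _ "refl \<beta>"]) (use b refl_in_R in \<open>auto simp: refl_refl\<close>)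
  have "(\<Sum>\<alpha>\<in>R. h (\<lambda>z. f (refl \<beta> z)) \<xi> x \<alpha>) = (\<Sum>\<alpha>\<in>R. h f (refl \<beta> \<xi>) (refl \<beta> x) (refl \<beta> \<alpha>))"
    by (rule sum.cong) (simp_all add: h_def c_refl b bil_refl_refl[OF bil_root[OF b]]
        refl_quotient_refl[OF dom f _ b x])
  also have "\<dots> = (\<Sum>\<alpha>\<in>R. h f (refl \<beta> \<xi>) (refl \<beta> x) \<alpha>)"
    by (rule sum.reindex_bij_betw[OF bij])
  finally have "(\<Sum>\<alpha>\<in>Rp. h (\<lambda>z. f (refl \<beta> z)) \<xi> x \<alpha>) = (\<Sum>\<alpha>\<in>Rp. h f (refl \<beta> \<xi>) (refl \<beta> x) \<alpha>)"
    by (simp add: half analytic_fun_refl[OF dom b f] f x refl_dom_refl[OF dom b x])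
  moreover have "dderiv \<xi> (\<lambda>z. f (refl \<beta> z)) x = dderiv (refl \<beta> \<xi>) f (refl \<beta> x)"
    using dderiv_linear_compose[of "refl \<beta>" \<xi> f 0 x] by (simp add: refl_add refl_smult)
  ultimately show ?thesis by (simp add: dunkl_def h_def)
qed

text \<open>A Dunkl operator costs one order of vanishing, like a derivative. The order must be
  known on a reflection-stable set \<open>X\<close>, because the value at \<open>x\<close> sees
  \<open>f\<close> at the reflected points.\<close>

lemma dunkl_vord:
  assumes dom: "refl_dom \<Omega>" and f: "analytic_fun f \<Omega>" and X: "X \<subseteq> \<Omega>" "\<And>\<alpha> x. \<alpha> \<in> R \<Longrightarrow> x \<in> X \<Longrightarrow> refl \<alpha> x \<in> X"
    and v: "\<And>x. x \<in> X \<Longrightarrow> vord (Suc k) f x" and x: "x \<in> X"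
  shows "vord k (dk \<xi> f) x"
proof -
  have x': "x \<in> \<Omega>" using x X by blast
  have "vord k (refl_quotient \<alpha> f) x" if "\<alpha> \<in> Rp" for \<alpha>
  proof (cases "bil \<alpha> x = 0")
    case True
    show ?thesis
      by (rule refl_quotient_vord_mirror[OF refl_dom_open[OF dom] f Rp_R[OF that] x' True v[OF x]])
  next
    case False
    have "vord k f y" if "y \<in> X" for y
      by (rule vord_mono[OF v[OF that]]) simp
    from refl_quotient_vord[OF Rp_R[OF that] False this this] show ?thesis
      using x X(2)[OF Rp_R[OF that] x] by blast
  qed
  moreover have "vord k (dderiv \<xi> f) x" by (rule vord_dderiv[OF refl_dom_open[OF dom] f x' v[OF x]])
  ultimately have "vord k (\<lambda>x. dderiv \<xi> f x - (\<Sum>\<alpha>\<in>Rp. c \<alpha> * bil \<alpha> \<xi> * refl_quotient \<alpha> f x)) x"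
    by (intro vord_diff vord_sum vord_cmult)
  then show ?thesis by (simp add: dunkl_def[abs_def])
qed

end

section \<open>The reflection group\<close>

context root_sys
begin

abbreviation W :: "(complex^'n \<Rightarrow> complex^'n) set" where "W \<equiv> refl_group R"

lemma refl_in_W: "\<alpha> \<in> R \<Longrightarrow> refl \<alpha> \<in> W"
  using refl_group.refl[OF _ refl_group.id, of \<alpha> R] by simp

lemma W_comp: "u \<in> W \<Longrightarrow> v \<in> W \<Longrightarrow> u \<circ> v \<in> W"
  by (induction rule: refl_group.induct) (auto simp: comp_assoc intro: refl_group.intros)

lemma W_inverse:
  assumes "w \<in> W"
  obtains w' where "w' \<in> W" "\<And>x. w (w' x) = x" "\<And>x. w' (w x) = x"
proof -
  have "\<exists>w'\<in>W. (\<forall>x. w (w' x) = x) \<and> (\<forall>x. w' (w x) = x)"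
    using assms
  proof (induction rule: refl_group.induct)
    case id
    show ?case by (rule bexI[of _ id]) (auto intro: refl_group.id)
  next
    case (refl \<alpha> w)
    then obtain w' where "w' \<in> W" "\<forall>x. w (w' x) = x" "\<forall>x. w' (w x) = x" by blast
    with refl(1) show ?case
      by (intro bexI[of _ "w' \<circ> refl \<alpha>"]) (auto simp: refl_refl intro!: W_comp refl_in_W)
  qed
  then show ?thesis using that by blast
qed

lemma W_add: "w \<in> W \<Longrightarrow> w (x + y) = w x + w y"
  by (induction rule: refl_group.induct) (auto simp: refl_add)

lemma W_smult: "w \<in> W \<Longrightarrow> w (a *s x) = a *s w x"
  by (induction rule: refl_group.induct) (auto simp: refl_smult)

lemma W_linear: "w \<in> W \<Longrightarrow> linear w"
  by (rule linearI) (auto simp: W_add scaleR_eq_smult W_smult)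

lemma W_diff: "w \<in> W \<Longrightarrow> w (x - y) = w x - w y"
  using linear_diff[OF W_linear] .

lemma W_bil: "w \<in> W \<Longrightarrow> bil (w x) (w y) = bil x y"
  by (induction rule: refl_group.induct) (auto simp: bil_refl_refl[OF bil_root])

lemma W_norm: "w \<in> W \<Longrightarrow> norm (w x) = norm x"
  by (induction rule: refl_group.induct) (auto simp: norm_refl)

lemma W_dist: "w \<in> W \<Longrightarrow> dist (w x) (w y) = dist x y"
  using W_norm[of w "x - y"] by (simp add: W_diff dist_norm)

lemma W_root: "w \<in> W \<Longrightarrow> \<alpha> \<in> R \<Longrightarrow> w \<alpha> \<in> R"
  by (induction rule: refl_group.induct) (auto simp: refl_in_R)

lemma W_dom: "w \<in> W \<Longrightarrow> refl_dom \<Omega> \<Longrightarrow> x \<in> \<Omega> \<Longrightarrow> w x \<in> \<Omega>"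
  by (induction rule: refl_group.induct) (auto intro: refl_dom_refl)

text \<open>The roots need not span, so a group element is compared with the identity: only the span
  of the roots is affected.\<close>

lemma W_displacement: "w \<in> W \<Longrightarrow> \<exists>a. w x - x = (\<Sum>\<alpha>\<in>R. a \<alpha> *s \<alpha>)"
proof (induction rule: refl_group.induct)
  case id
  show ?case by (rule exI[of _ "\<lambda>_. 0"]) simp
next
  case (refl \<alpha> w)
  then obtain a where a: "w x - x = (\<Sum>\<alpha>\<in>R. a \<alpha> *s \<alpha>)" by blast
  define k where "k = 2 * bil \<alpha> (w x) / bil \<alpha> \<alpha>"
  have "(refl \<alpha> \<circ> w) x - x = (\<Sum>\<beta>\<in>R. a \<beta> *s \<beta>) - k *s \<alpha>"
    using a by (simp add: refl_def k_def algebra_simps)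
  also have "\<dots> = (\<Sum>\<beta>\<in>R. (a \<beta> - (if \<beta> = \<alpha> then k else 0)) *s \<beta>)"
    using refl(1) finite_R
    by (simp add: vec.scale_left_diff_distrib sum_subtractf if_distrib[of "\<lambda>t. t *s _"] cong: if_cong)
  finally show ?case by (rule exI[of _ "\<lambda>\<beta>. a \<beta> - (if \<beta> = \<alpha> then k else 0)"])
qed

text \<open>The span of the roots is stable under conjugation, so \<open>u\<close> is orthogonal to
  \<open>cnjv u\<close>, and this product is the squared norm.\<close>

lemma root_span_nondegenerate:
  assumes u: "u = (\<Sum>\<alpha>\<in>R. a \<alpha> *s \<alpha>)" and zero: "\<And>\<beta>. \<beta> \<in> R \<Longrightarrow> bil u \<beta> = 0"
  shows "u = 0"
proof -
  have "cnjv u = (\<Sum>\<alpha>\<in>R. cnj (a \<alpha>) *s \<alpha>)"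
  proof -
    have "cnj (\<alpha> $ i) = \<alpha> $ i" if "\<alpha> \<in> R" for \<alpha> i
      using root_cnjv[OF that] by (metis cnjv_def vec_lambda_beta)
    then show ?thesis by (simp add: u cnjv_def vec_eq_iff)
  qed
  then have "bil u (cnjv u) = 0" by (simp add: bil_simps zero)
  then show ?thesis by (simp add: bil_cnjv)
qed

text \<open>The difference of the two images of \<open>x\<close> lies in the span of the roots;
  moving the group elements across \<open>bil\<close> shows that it is orthogonal to every root.
  Finiteness of the group follows, as the elements embed into maps of the finite set
  \<open>R\<close>.\<close>

lemma W_determined_by_roots:
  assumes w: "w1 \<in> W" "w2 \<in> W" and eq: "\<And>\<alpha>. \<alpha> \<in> R \<Longrightarrow> w1 \<alpha> = w2 \<alpha>"
  shows "w1 = w2"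
proof
  fix x
  obtain a where a: "w1 x - x = (\<Sum>\<alpha>\<in>R. a \<alpha> *s \<alpha>)"
    using W_displacement[OF w(1)] by blast
  obtain b where b: "w2 x - x = (\<Sum>\<alpha>\<in>R. b \<alpha> *s \<alpha>)"
    using W_displacement[OF w(2)] by blast
  obtain w' where w': "w' \<in> W" "\<And>x. w1 (w' x) = x" by (rule W_inverse[OF w(1)]) blast
  have "w1 x - w2 x = (w1 x - x) - (w2 x - x)" by simp
  also have "\<dots> = (\<Sum>\<alpha>\<in>R. (a \<alpha> - b \<alpha>) *s \<alpha>)"
    unfolding a b by (simp add: vec.scale_left_diff_distrib sum_subtractf)
  finally have "w1 x - w2 x = (\<Sum>\<alpha>\<in>R. (a \<alpha> - b \<alpha>) *s \<alpha>)" .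
  moreover have "bil (w1 x - w2 x) \<beta> = 0" if "\<beta> \<in> R" for \<beta>
  proof -
    have g: "w' \<beta> \<in> R" using W_root[OF w'(1) that] .
    have "bil (w1 x) \<beta> = bil x (w' \<beta>)" using W_bil[OF w(1), of x "w' \<beta>"] w'(2) by simp
    moreover have "bil (w2 x) \<beta> = bil x (w' \<beta>)"
      using W_bil[OF w(2), of x "w' \<beta>"] eq[OF g] w'(2) by simp
    ultimately show ?thesis by (simp add: bil_simps)
  qed
  ultimately have "w1 x - w2 x = 0" by (rule root_span_nondegenerate)
  then show "w1 x = w2 x" by simp
qed

lemma finite_W: "finite W"
proof -
  have "inj_on (\<lambda>w. restrict w R) W"
    by (rule inj_onI) (metis W_determined_by_roots restrict_apply')
  moreover have "(\<lambda>w. restrict w R) ` W \<subseteq> R \<rightarrow>\<^sub>E R"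
    using W_root by auto
  ultimately show ?thesis
    using finite_PiE[OF finite_R, of "\<lambda>_. R"] finite_R finite_imageD finite_subset by metis
qed

definition orb :: "complex^'n \<Rightarrow> (complex^'n) set" where "orb x = (\<lambda>w. w x) ` W"

lemma finite_orb: "finite (orb x)"
  by (simp add: orb_def finite_W)

lemma orb_self: "x \<in> orb x"
  unfolding orb_def by (rule image_eqI[OF _ refl_group.id]) simp

lemma orb_refl: "\<alpha> \<in> R \<Longrightarrow> y \<in> orb x \<Longrightarrow> refl \<alpha> y \<in> orb x"
  unfolding orb_def by (auto intro!: image_eqI[of _ _ "refl \<alpha> \<circ> _"] refl_group.refl)

lemma orb_sub: "refl_dom \<Omega> \<Longrightarrow> x \<in> \<Omega> \<Longrightarrow> orb x \<subseteq> \<Omega>"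
  by (auto simp: orb_def W_dom)

end

section \<open>Polynomials with prescribed jets on finitely many sets\<close>

lemma separating_polyfun:
  assumes "finite I" "\<And>i. i \<in> I \<Longrightarrow> \<exists>r\<in>polyfun. (\<forall>y\<in>Z i. r y = 0) \<and> r x \<noteq> 0"
  shows "\<exists>r\<in>polyfun. (\<forall>y\<in>(\<Union>i\<in>I. Z i). r y = 0) \<and> r x = 1"
  using assms
proof (induction I rule: finite_induct)
  case empty
  show ?case by (rule bexI[of _ "\<lambda>_. 1"]) auto
next
  case (insert i I)
  obtain r where r: "r \<in> polyfun" "\<forall>y\<in>(\<Union>i\<in>I. Z i). r y = 0" "r x = 1"
    using insert.IH insert.prems by blast
  obtain s where s: "s \<in> polyfun" "\<forall>y\<in>Z i. s y = 0" "s x \<noteq> 0"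
    using insert.prems[of i] by blast
  have "(\<lambda>z. (1 / s x) * s z * r z) \<in> polyfun"
    by (intro polyfun_mult polyfun_const r s)
  then show ?case using r s by (intro bexI[of _ "\<lambda>z. (1 / s x) * s z * r z"]) auto
qed

lemma polyfun_vord0: "p \<in> polyfun \<Longrightarrow> vord 0 p x"
  using vord_analytic[OF open_UNIV analytic_fun_polyfun] by blast

lemma polyfun_vord1: "p \<in> polyfun \<Longrightarrow> p x = 0 \<Longrightarrow> vord 1 p x"
proof -
  assume p: "p \<in> polyfun" "p x = 0"
  obtain K where K: "\<And>v. norm (dderiv v p x) \<le> K * norm v"
    using linear_bounded[OF has_derivative_linear[OF has_derivative_dderiv[OF open_UNIV analytic_fun_polyfun[OF p(1)]]]]
    by blast
  have "(p has_derivative (\<lambda>v. dderiv v p x)) (at x)"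
    using has_derivative_dderiv[OF open_UNIV analytic_fun_polyfun[OF p(1)]] by blast
  then obtain d where d: "0 < d" "\<And>y. norm (y - x) < d \<Longrightarrow> norm (p y - p x - dderiv (y - x) p x) \<le> 1 * norm (y - x)"
    unfolding has_derivative_at_alt by (metis zero_less_one)
  have "cmod (p y) \<le> (1 + K) * norm (y - x) ^ 1" if "dist y x < d" for y
  proof -
    have "cmod (p y) \<le> cmod (p y - p x - dderiv (y - x) p x) + cmod (dderiv (y - x) p x)"
      using p(2) norm_triangle_ineq[of "p y - p x - dderiv (y - x) p x" "dderiv (y - x) p x"] by simp
    also have "\<dots> \<le> 1 * norm (y - x) + K * norm (y - x)"
      using d(2)[of y] K[of "y - x"] that by (simp add: dist_norm)
    finally show ?thesis by (simp add: distrib_right)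
  qed
  then show ?thesis unfolding vord_def eventually_nhds_metric using d(1) by blast
qed

text \<open>If \<open>r x = 1\<close> and \<open>r\<close> vanishes on the given sets, then \<open>q = 1 - (1 - r ^ k) ^ k\<close> is as
  required.\<close>

lemma bump_polyfun:
  assumes "finite I" "\<And>i. i \<in> I \<Longrightarrow> \<exists>r\<in>polyfun. (\<forall>y\<in>Z i. r y = 0) \<and> r x \<noteq> 0"
  obtains q where "q \<in> polyfun" "vord (Suc k) (\<lambda>z. q z - 1) x"
    "\<And>i y. i \<in> I \<Longrightarrow> y \<in> Z i \<Longrightarrow> vord (Suc k) q y" "\<And>i y. i \<in> I \<Longrightarrow> y \<in> Z i \<Longrightarrow> q y = 0"
proof -
  obtain r where r: "r \<in> polyfun" "\<And>i y. i \<in> I \<Longrightarrow> y \<in> Z i \<Longrightarrow> r y = 0" "r x = 1"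
    using separating_polyfun[of I Z x, OF assms] by auto
  define s where "s z = 1 - r z ^ Suc k" for z
  define q where "q z = 1 - s z ^ Suc k" for z
  have s: "s \<in> polyfun" unfolding s_def[abs_def] by (intro polyfun_diff polyfun_const polyfun_power r)
  have q: "q \<in> polyfun" unfolding q_def[abs_def] by (intro polyfun_diff polyfun_const polyfun_power s)
  have "vord (1 * Suc k) (\<lambda>z. s z ^ Suc k) x"
    by (rule vord_power[OF polyfun_vord1[OF s]]) (simp add: s_def r)
  then have "vord (Suc k) (\<lambda>z. (-1) * s z ^ Suc k) x" by (intro vord_cmult) simp
  then have 1: "vord (Suc k) (\<lambda>z. q z - 1) x" by (simp add: q_def)
  \<comment> \<open>As \<open>1 - s z = r z ^ Suc k\<close>, the geometric sum displays
    \<open>q\<close> as a multiple of a power of \<open>r\<close>.\<close>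
  have geom: "q z = (\<Sum>j<Suc k. s z ^ j) * r z ^ Suc k" for z
    using one_diff_power_eq[of "s z" "Suc k"] by (simp add: q_def s_def mult.commute del: power_Suc sum.lessThan_Suc)
  have 2: "vord (Suc k) q y" if "i \<in> I" "y \<in> Z i" for i y
  proof -
    have "vord (0 + 1 * Suc k) (\<lambda>z. (\<Sum>j<Suc k. s z ^ j) * r z ^ Suc k) y"
      by (intro vord_mult vord_power polyfun_vord0 polyfun_vord1 polyfun_sum polyfun_power s r(1) r(2)[OF that])
    then show ?thesis by (simp add: geom[abs_def])
  qed
  from q 1 2 vord_Suc_zero[OF 2] show ?thesis by (rule that)
qed

section \<open>Commutativity of Dunkl operators\<close>

context dunkl_data
begin

text \<open>Up to sign and the factor \<open>bil \<alpha> \<xi>\<close>, the coefficient of the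
  reflection in the commutator of a Dunkl operator with multiplication by
  \<open>bil a\<close>.\<close>

definition lc :: "complex^'n \<Rightarrow> complex^'n \<Rightarrow> complex" where
  "lc a \<alpha> = c \<alpha> * (2 * bil a \<alpha> / bil \<alpha> \<alpha>)"

lemma refl_quotient_bil_mult:
  assumes dom: "refl_dom \<Omega>" and f: "analytic_fun f \<Omega>" and r: "\<alpha> \<in> R" and x: "x \<in> \<Omega>"
  shows "refl_quotient \<alpha> (\<lambda>z. bil a z * f z) x =
    bil a x * refl_quotient \<alpha> f x + 2 * bil a \<alpha> / bil \<alpha> \<alpha> * f (refl \<alpha> x)"
proof -
  have g: "analytic_fun (\<lambda>z. bil a z * f z) \<Omega>" by (intro analytic_fun_mult analytic_fun_bil f)
  show ?thesis
  proof (cases "bil \<alpha> x = 0")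
    case True
    then show ?thesis
      by (simp add: refl_quotient_eq[OF dom g r x] refl_quotient_eq[OF dom f r x] refl_fixed
          dderiv_mult[OF refl_dom_open[OF dom] analytic_fun_bil f x]) (simp add: algebra_simps add_divide_distrib)
  next
    case False
    have eq: "bil a (refl \<alpha> x) = bil a x - 2 * bil \<alpha> x / bil \<alpha> \<alpha> * bil a \<alpha>"
      by (simp add: refl_def bil_simps)
    show ?thesis using False bil_root[OF r]
      unfolding refl_quotient_eq[OF dom g r x] refl_quotient_eq[OF dom f r x]
      by (simp add: eq field_simps)
  qed
qed

text \<open>The relation of the rational Cherednik algebra between Dunkl operators and linear
  functions; its reflection terms are the defect in the product rule of the quotients.\<close>

lemma dunkl_bil_mult:
  assumes dom: "refl_dom \<Omega>" and f: "analytic_fun f \<Omega>" and x: "x \<in> \<Omega>"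
  shows "dk \<xi> (\<lambda>z. bil a z * f z) x =
    bil a x * dk \<xi> f x + bil a \<xi> * f x - (\<Sum>\<alpha>\<in>Rp. lc a \<alpha> * bil \<alpha> \<xi> * f (refl \<alpha> x))"
proof -
  have "(\<Sum>\<alpha>\<in>Rp. c \<alpha> * bil \<alpha> \<xi> * refl_quotient \<alpha> (\<lambda>z. bil a z * f z) x) =
    (\<Sum>\<alpha>\<in>Rp. bil a x * (c \<alpha> * bil \<alpha> \<xi> * refl_quotient \<alpha> f x) + lc a \<alpha> * bil \<alpha> \<xi> * f (refl \<alpha> x))"
    by (rule sum.cong) (simp_all add: refl_quotient_bil_mult[OF dom f Rp_R x] lc_def, simp add: algebra_simps)
  then show ?thesis
    unfolding dunkl_def dderiv_mult[OF refl_dom_open[OF dom] analytic_fun_bil f x]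
    by (simp add: sum.distrib sum_distrib_left algebra_simps)
qed

definition dk_comm :: "complex^'n \<Rightarrow> complex^'n \<Rightarrow> 'n operator" where
  "dk_comm \<xi> \<eta> f x = dk \<xi> (dk \<eta> f) x - dk \<eta> (dk \<xi> f) x"

text \<open>Everything after the first term is symmetric in \<open>\<xi>\<close> and
  \<open>\<eta>\<close>, so it cancels in the commutator. The symmetry becomes visible once
  equivariance has produced the direction \<open>refl \<alpha> \<xi>\<close> and this is
  expanded.\<close>

lemma dunkl_dunkl_bil_mult:
  assumes dom: "refl_dom \<Omega>" and f: "analytic_fun f \<Omega>" and x: "x \<in> \<Omega>"
  shows "dk \<xi> (dk \<eta> (\<lambda>z. bil a z * f z)) x =
    bil a x * dk \<xi> (dk \<eta> f) x + bil a \<xi> * dk \<eta> f x + bil a \<eta> * dk \<xi> f x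
    - (\<Sum>\<alpha>\<in>Rp. lc a \<alpha> * (bil \<alpha> \<xi> * dk \<eta> f (refl \<alpha> x) + bil \<alpha> \<eta> * dk \<xi> f (refl \<alpha> x)
        - 2 * bil \<alpha> \<xi> * bil \<alpha> \<eta> / bil \<alpha> \<alpha> * dk \<alpha> f (refl \<alpha> x)))"
proof -
  note an = dunkl_analytic[OF dom f]
  have r: "analytic_fun (\<lambda>z. f (refl \<alpha> z)) \<Omega>" if "\<alpha> \<in> Rp" for \<alpha>
    by (rule analytic_fun_refl[OF dom Rp_R[OF that] f])
  define g1 where "g1 z = bil a z * dk \<eta> f z" for z
  define g2 where "g2 z = bil a \<eta> * f z" for z
  define g3 where "g3 z = (\<Sum>\<alpha>\<in>Rp. lc a \<alpha> * bil \<alpha> \<eta> * f (refl \<alpha> z))" for z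
  have g1: "analytic_fun g1 \<Omega>" unfolding g1_def[abs_def] by (intro analytic_fun_mult analytic_fun_bil an)
  have g2: "analytic_fun g2 \<Omega>" unfolding g2_def[abs_def] by (intro analytic_fun_cmult f)
  have g3: "analytic_fun g3 \<Omega>" unfolding g3_def[abs_def] by (intro analytic_fun_sum analytic_fun_cmult r)
  have g12: "analytic_fun (\<lambda>z. g1 z + g2 z) \<Omega>" by (intro analytic_fun_add g1 g2)
  have "dk \<xi> (dk \<eta> (\<lambda>z. bil a z * f z)) x = dk \<xi> (\<lambda>z. (g1 z + g2 z) - g3 z) x"
    by (rule dunkl_cong[OF dom _ _ x])
      (auto intro!: dunkl_analytic[OF dom] analytic_fun_mult analytic_fun_bil f
        simp: dunkl_bil_mult[OF dom f] g1_def g2_def g3_def)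
  also have "\<dots> = dk \<xi> g1 x + dk \<xi> g2 x - dk \<xi> g3 x"
    by (simp add: dunkl_diff[OF dom g12 g3 x] dunkl_add[OF dom g1 g2 x])
  also have "dk \<xi> g1 x = bil a x * dk \<xi> (dk \<eta> f) x + bil a \<xi> * dk \<eta> f x
      - (\<Sum>\<alpha>\<in>Rp. lc a \<alpha> * bil \<alpha> \<xi> * dk \<eta> f (refl \<alpha> x))"
    unfolding g1_def[abs_def] by (rule dunkl_bil_mult[OF dom an x])
  also have "dk \<xi> g2 x = bil a \<eta> * dk \<xi> f x"
    unfolding g2_def[abs_def] by (rule dunkl_cmult[OF dom f x])
  also have "dk \<xi> g3 x = (\<Sum>\<alpha>\<in>Rp. lc a \<alpha> * bil \<alpha> \<eta> * dk (refl \<alpha> \<xi>) f (refl \<alpha> x))"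
    unfolding g3_def[abs_def]
    by (subst dunkl_sum[OF dom _ x], intro analytic_fun_cmult r, assumption)
      (rule sum.cong[OF HOL.refl], simp add: dunkl_cmult[OF dom r x] dunkl_refl[OF dom f Rp_R x])
  also have "\<dots> = (\<Sum>\<alpha>\<in>Rp. lc a \<alpha> * bil \<alpha> \<eta> *
      (dk \<xi> f (refl \<alpha> x) - 2 * bil \<alpha> \<xi> / bil \<alpha> \<alpha> * dk \<alpha> f (refl \<alpha> x)))"
    by (rule sum.cong[OF HOL.refl])
      (subst refl_def, simp add: dunkl_dir_diff_smult[OF dom f refl_dom_refl[OF dom Rp_R x]])
  finally show ?thesis
    by (simp add: algebra_simps sum.distrib sum_subtractf)
qed

lemma dk_comm_bil_mult:
  assumes dom: "refl_dom \<Omega>" and f: "analytic_fun f \<Omega>" and x: "x \<in> \<Omega>"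
  shows "dk_comm \<xi> \<eta> (\<lambda>z. bil a z * f z) x = bil a x * dk_comm \<xi> \<eta> f x"
  unfolding dk_comm_def dunkl_dunkl_bil_mult[OF assms] by (simp add: algebra_simps)

lemma dk_comm_add:
  assumes dom: "refl_dom \<Omega>" and f: "analytic_fun f \<Omega>" and g: "analytic_fun g \<Omega>" and x: "x \<in> \<Omega>"
  shows "dk_comm \<xi> \<eta> (\<lambda>z. f z + g z) x = dk_comm \<xi> \<eta> f x + dk_comm \<xi> \<eta> g x"
proof -
  have "dk \<xi> (dk \<eta> (\<lambda>z. f z + g z)) x = dk \<xi> (dk \<eta> f) x + dk \<xi> (dk \<eta> g) x" for \<xi> \<eta>
  proof -
    have "dk \<xi> (dk \<eta> (\<lambda>z. f z + g z)) x = dk \<xi> (\<lambda>z. dk \<eta> f z + dk \<eta> g z) x"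
      by (rule dunkl_cong[OF dom _ _ x]) (auto intro!: dunkl_analytic[OF dom] analytic_fun_add f g
          simp: dunkl_add[OF dom f g])
    also have "\<dots> = dk \<xi> (dk \<eta> f) x + dk \<xi> (dk \<eta> g) x"
      by (rule dunkl_add[OF dom dunkl_analytic[OF dom f] dunkl_analytic[OF dom g] x])
    finally show ?thesis .
  qed
  then show ?thesis by (simp add: dk_comm_def)
qed

lemma dk_comm_cmult:
  assumes dom: "refl_dom \<Omega>" and f: "analytic_fun f \<Omega>" and x: "x \<in> \<Omega>"
  shows "dk_comm \<xi> \<eta> (\<lambda>z. a * f z) x = a * dk_comm \<xi> \<eta> f x"
proof -
  have "dk \<xi> (dk \<eta> (\<lambda>z. a * f z)) x = a * dk \<xi> (dk \<eta> f) x" for \<xi> \<eta>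
  proof -
    have "dk \<xi> (dk \<eta> (\<lambda>z. a * f z)) x = dk \<xi> (\<lambda>z. a * dk \<eta> f z) x"
      by (rule dunkl_cong[OF dom _ _ x]) (auto intro!: dunkl_analytic[OF dom] analytic_fun_cmult f
          simp: dunkl_cmult[OF dom f])
    also have "\<dots> = a * dk \<xi> (dk \<eta> f) x"
      by (rule dunkl_cmult[OF dom dunkl_analytic[OF dom f] x])
    finally show ?thesis .
  qed
  then show ?thesis by (simp add: dk_comm_def right_diff_distrib)
qed

text \<open>The commutator of two Dunkl operators commutes with multiplication by linear functions
  (Etingof), hence with multiplication by polynomials; since it kills constants it kills all
  polynomials, and at a given point analytic functions may be replaced by polynomials.\<close>

lemma dk_comm_polyfun_mult:
  assumes p: "p \<in> polyfun" and dom: "refl_dom \<Omega>" and f: "analytic_fun f \<Omega>" and x: "x \<in> \<Omega>"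
  shows "dk_comm \<xi> \<eta> (\<lambda>z. p z * f z) x = p x * dk_comm \<xi> \<eta> f x"
  using p
proof (induction rule: polyfun_induct)
  case (const a)
  show ?case by (rule dk_comm_cmult[OF dom f x])
next
  case (add p q)
  have "dk_comm \<xi> \<eta> (\<lambda>z. p z * f z + q z * f z) x =
      dk_comm \<xi> \<eta> (\<lambda>z. p z * f z) x + dk_comm \<xi> \<eta> (\<lambda>z. q z * f z) x"
    by (rule dk_comm_add[OF dom _ _ x]) (intro analytic_fun_mult analytic_fun_polyfun add f)+
  then show ?case by (simp add: add distrib_right)
next
  case (coord p i)
  have "dk_comm \<xi> \<eta> (\<lambda>z. bil (axis i 1) z * (p z * f z)) x =
      bil (axis i 1) x * dk_comm \<xi> \<eta> (\<lambda>z. p z * f z) x"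
    by (rule dk_comm_bil_mult[OF dom _ x]) (intro analytic_fun_mult analytic_fun_polyfun coord f)
  then show ?case by (simp add: coord mult.assoc)
qed

lemma dk_comm_polyfun:
  assumes p: "p \<in> polyfun"
  shows "dk_comm \<xi> \<eta> p x = 0"
proof -
  have z: "dk \<eta> (\<lambda>x. 1) = (\<lambda>x. 0)" for \<eta> by (rule ext) simp
  have "dk_comm \<xi> \<eta> (\<lambda>z. p z * 1) x = p x * dk_comm \<xi> \<eta> (\<lambda>z. 1) x"
    by (rule dk_comm_polyfun_mult[OF p refl_dom_UNIV]) auto
  also have "dk_comm \<xi> \<eta> (\<lambda>z. 1) x = 0" unfolding dk_comm_def z by simp
  finally show ?thesis by simp
qed

lemma orb_bump:
  obtains q where "q \<in> polyfun" "vord (Suc k) (\<lambda>z. q z - 1) x"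
    "\<And>y. y \<in> orb x \<Longrightarrow> y \<noteq> x \<Longrightarrow> vord (Suc k) q y"
proof -
  have sep: "\<exists>r\<in>polyfun. (\<forall>z\<in>{y}. r z = 0) \<and> r x \<noteq> 0" if y: "y \<in> orb x - {x}" for y
  proof -
    have "x \<noteq> y" using y by auto
    then obtain i where i: "x $ i \<noteq> y $ i" unfolding vec_eq_iff by blast
    have "(\<lambda>z. z $ i - y $ i) \<in> polyfun" by (intro polyfun_diff polyfun_const polyfun_coord)
    with i show ?thesis by (intro bexI[of _ "\<lambda>z. z $ i - y $ i"]) auto
  qed
  show ?thesis
  proof (rule bump_polyfun[where I = "orb x - {x}" and Z = "\<lambda>y. {y}" and x = x and k = k])
    fix q assume q: "q \<in> polyfun" "vord (Suc k) (\<lambda>z. q z - 1) x"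
      "\<And>i y. i \<in> orb x - {x} \<Longrightarrow> y \<in> {i} \<Longrightarrow> vord (Suc k) q y"
    show thesis by (rule that[OF q(1,2)]) (use q(3) in auto)
  qed (use finite_orb sep in auto)
qed

lemma dunkl_commute:
  assumes dom: "refl_dom \<Omega>" and f: "analytic_fun f \<Omega>" and x: "x \<in> \<Omega>"
  shows "dk \<xi> (dk \<eta> f) x = dk \<eta> (dk \<xi> f) x"
proof -
  \<comment> \<open>Order 3, so that two Dunkl operators leave order 1 and hence the value 0 at
    \<open>x\<close>.\<close>
  obtain q where q: "q \<in> polyfun" "vord (Suc 2) (\<lambda>z. q z - 1) x"
    "\<And>y. y \<in> orb x \<Longrightarrow> y \<noteq> x \<Longrightarrow> vord (Suc 2) q y" using orb_bump by blast
  obtain T where T: "T \<in> polyfun" "vord (Suc 2) (\<lambda>z. f z - T z) x"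
    using Taylor_polyfun[OF refl_dom_open[OF dom] f x] by metis
  define g where "g z = q z * (f z - T z)" for z
  have ft: "analytic_fun (\<lambda>z. f z - T z) \<Omega>" by (intro analytic_fun_diff f analytic_fun_polyfun T)
  have g: "analytic_fun g \<Omega>"
    unfolding g_def[abs_def] by (intro analytic_fun_mult ft analytic_fun_polyfun q)
  have gv: "vord (Suc 2) g y" if y: "y \<in> orb x" for y
  proof (cases "y = x")
    case True
    have "vord (0 + Suc 2) g x"
      unfolding g_def[abs_def] by (intro vord_mult polyfun_vord0 q T)
    with True show ?thesis by simp
  next
    case False
    have "vord 0 (\<lambda>z. f z - T z) y"
      using vord_analytic[OF refl_dom_open[OF dom] ft] orb_sub[OF dom x] y by blast
    then have "vord (Suc 2 + 0) g y"
      unfolding g_def[abs_def] by (intro vord_mult q y False)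
    then show ?thesis by simp
  qed
  have zero: "dk \<xi> (dk \<eta> g) x = 0" for \<xi> \<eta>
  proof -
    have 1: "vord (Suc 1) (dk \<eta> g) y" if "y \<in> orb x" for y
      by (rule dunkl_vord[OF dom g orb_sub[OF dom x] orb_refl _ that]) (use gv in \<open>auto simp: numeral_2_eq_2\<close>)
    have "vord 1 (dk \<xi> (dk \<eta> g)) x"
      by (rule dunkl_vord[OF dom dunkl_analytic[OF dom g] orb_sub[OF dom x] orb_refl 1 orb_self])
    then show ?thesis using vord_Suc_zero[of 0] by simp
  qed
  have qx: "q x = 1" using vord_Suc_zero[OF q(2)] by simp
  \<comment> \<open>Inserting \<open>q\<close> costs nothing, since it passes through the commutator
    and \<open>q x = 1\<close>; then \<open>q * f\<close> splits into the flat function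
    \<open>g\<close> and a polynomial.\<close>
  have "dk_comm \<xi> \<eta> f x = dk_comm \<xi> \<eta> (\<lambda>z. q z * f z) x"
    using dk_comm_polyfun_mult[OF q(1) dom f x] qx by simp
  also have "(\<lambda>z. q z * f z) = (\<lambda>z. g z + q z * T z)"
    by (simp add: g_def algebra_simps)
  also have "dk_comm \<xi> \<eta> \<dots> x = dk_comm \<xi> \<eta> g x + dk_comm \<xi> \<eta> (\<lambda>z. q z * T z) x"
    by (rule dk_comm_add[OF dom g _ x]) (intro analytic_fun_polyfun polyfun_mult q T)
  also have "\<dots> = 0"
    using dk_comm_polyfun[OF polyfun_mult[OF q(1) T(1)]] by (simp add: dk_comm_def zero)
  finally show ?thesis by (simp add: dk_comm_def)
qed

end

section \<open>Polynomials in commuting operators\<close>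

lemma op_monom_Nil [simp]: "op_monom [] T m f = f"
  and op_monom_Cons: "op_monom (j # js) T m f = op_monom js T m ((T j ^^ m j) f)"
  by (simp_all add: op_monom_def)

lemma op_monom_zero: "op_monom ks T (\<lambda>i. 0) f = f"
  by (induction ks) (auto simp: op_monom_Cons)

lemma op_monom_delta:
  assumes "distinct ks"
  shows "op_monom ks T (\<lambda>j. if j = i then k else 0) f = (if i \<in> set ks then (T i ^^ k) f else f)"
  using assms
proof (induction ks arbitrary: f)
  case (Cons j ks)
  have "op_monom ks T (\<lambda>j. if j = i then k else 0) g = g" if "i \<notin> set ks" for g
    using Cons that by auto
  with Cons show ?case by (auto simp: op_monom_Cons)
qed simp

lemma op_poly_eq: "op_poly js T p f x = lin_ext p (\<lambda>m. op_monom js T (Poly_Mapping.lookup m) f x)"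
  by (simp add: op_poly_def lin_ext_def)

text \<open>The setting in which substitution of operators into polynomials is multiplicative. On
  \<open>A\<close> the operators commute as equalities of functions, so powers and composites can be
  rewritten inside other operators.\<close>

locale comm_ops =
  fixes T :: "'i::finite \<Rightarrow> 'n::finite operator" and A :: "(complex^'n \<Rightarrow> complex) set" and js :: "'i list"
  assumes T_closed: "f \<in> A \<Longrightarrow> T i f \<in> A"
    and A_zero: "(\<lambda>x. 0) \<in> A"
    and A_add: "f \<in> A \<Longrightarrow> g \<in> A \<Longrightarrow> (\<lambda>x. f x + g x) \<in> A"
    and A_cmult: "f \<in> A \<Longrightarrow> (\<lambda>x. a * f x) \<in> A"
    and T_add: "f \<in> A \<Longrightarrow> g \<in> A \<Longrightarrow> T i (\<lambda>x. f x + g x) = (\<lambda>x. T i f x + T i g x)"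
    and T_cmult: "f \<in> A \<Longrightarrow> T i (\<lambda>x. a * f x) = (\<lambda>x. a * T i f x)"
    and T_comm: "f \<in> A \<Longrightarrow> T i (T j f) = T j (T i f)"
    and js: "distinct js" "set js = UNIV"
begin

definition lin :: "'n operator \<Rightarrow> bool" where
  "lin L \<longleftrightarrow> (\<forall>f\<in>A. L f \<in> A) \<and> (\<forall>f\<in>A. \<forall>g\<in>A. L (\<lambda>x. f x + g x) = (\<lambda>x. L f x + L g x)) \<and>
    (\<forall>f\<in>A. \<forall>a. L (\<lambda>x. a * f x) = (\<lambda>x. a * L f x))"

lemma lin_T: "lin (T i)"
  using T_closed T_add T_cmult unfolding lin_def by blast

lemma lin_closed: "lin L \<Longrightarrow> f \<in> A \<Longrightarrow> L f \<in> A"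
  by (simp add: lin_def)

lemma lin_add: "lin L \<Longrightarrow> f \<in> A \<Longrightarrow> g \<in> A \<Longrightarrow> L (\<lambda>x. f x + g x) = (\<lambda>x. L f x + L g x)"
  and lin_cmult: "lin L \<Longrightarrow> f \<in> A \<Longrightarrow> L (\<lambda>x. a * f x) = (\<lambda>x. a * L f x)"
  by (simp_all add: lin_def)

lemma lin_comp: "lin L \<Longrightarrow> lin M \<Longrightarrow> lin (\<lambda>f. L (M f))"
  by (simp add: lin_def)

lemma lin_pow: "lin L \<Longrightarrow> lin (L ^^ k)"
proof (induction k)
  case (Suc k)
  then show ?case using lin_comp[of L "L ^^ k"] by (simp add: o_def)
qed (simp add: lin_def)

lemma A_sum: "(\<And>k. k \<in> K \<Longrightarrow> f k \<in> A) \<Longrightarrow> (\<lambda>x. \<Sum>k\<in>K. f k x) \<in> A"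
  by (induction K rule: infinite_finite_induct) (auto intro: A_zero A_add)

lemma lin_zero: "lin L \<Longrightarrow> L (\<lambda>x. 0) = (\<lambda>x. 0)"
  using lin_cmult[OF _ A_zero, of L 0] by simp

lemma lin_sum:
  assumes L: "lin L" and f: "\<And>k. k \<in> K \<Longrightarrow> f k \<in> A"
  shows "L (\<lambda>x. \<Sum>k\<in>K. a k * f k x) = (\<lambda>x. \<Sum>k\<in>K. a k * L (f k) x)"
  using f
proof (induction K rule: infinite_finite_induct)
  case (insert k K)
  have 1: "(\<lambda>x. a k * f k x) \<in> A" "(\<lambda>x. \<Sum>k\<in>K. a k * f k x) \<in> A"
    using insert.prems by (auto intro!: A_sum A_cmult)
  have "L (\<lambda>x. a k * f k x + (\<Sum>k\<in>K. a k * f k x)) =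
      (\<lambda>x. L (\<lambda>x. a k * f k x) x + L (\<lambda>x. \<Sum>k\<in>K. a k * f k x) x)"
    by (rule lin_add[OF L 1])
  moreover have "L (\<lambda>x. a k * f k x) = (\<lambda>x. a k * L (f k) x)"
    by (rule lin_cmult[OF L]) (use insert.prems in simp)
  ultimately show ?case using insert by simp
qed (simp_all add: lin_zero[OF L])

lemma lin_op_monom: "lin (op_monom ks T m)"
proof (induction ks)
  case (Cons k ks)
  show ?case using lin_comp[OF Cons lin_pow[OF lin_T]]
    by (simp add: op_monom_Cons[abs_def])
qed (simp add: lin_def op_monom_def)

lemma pow_commute:
  assumes L: "lin L" and M: "lin M" and comm: "\<And>f. f \<in> A \<Longrightarrow> L (M f) = M (L f)" and f: "f \<in> A"
  shows "(L ^^ k) (M f) = M ((L ^^ k) f)"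
proof (induction k)
  case (Suc k)
  have "(L ^^ k) f \<in> A" using lin_closed[OF lin_pow[OF L] f] .
  with Suc comm show ?case by simp
qed simp

lemma op_monom_commute_T: "f \<in> A \<Longrightarrow> op_monom ks T m (T i f) = T i (op_monom ks T m f)"
proof (induction ks arbitrary: f)
  case (Cons k ks)
  have "(T k ^^ m k) (T i f) = T i ((T k ^^ m k) f)"
    using pow_commute[where L = "T k" and M = "T i" and k = "m k", OF lin_T lin_T T_comm Cons.prems] .
  then show ?case
    by (simp only: op_monom_Cons Cons.IH[OF lin_closed[OF lin_pow[OF lin_T] Cons.prems]])
qed simp

lemma op_monom_add:
  "f \<in> A \<Longrightarrow> op_monom ks T (\<lambda>i. m i + m' i) f = op_monom ks T m (op_monom ks T m' f)"
proof (induction ks arbitrary: f)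
  case (Cons k ks)
  define g where "g = (T k ^^ m' k) f"
  have g: "g \<in> A" unfolding g_def by (rule lin_closed[OF lin_pow[OF lin_T] Cons.prems])
  have "op_monom (k # ks) T (\<lambda>i. m i + m' i) f = op_monom ks T m (op_monom ks T m' ((T k ^^ m k) g))"
    using Cons.IH[OF lin_closed[OF lin_pow[OF lin_T] g], of "m k" k]
    by (simp only: op_monom_Cons funpow_add g_def o_apply)
  also have "op_monom ks T m' ((T k ^^ m k) g) = (T k ^^ m k) (op_monom ks T m' g)"
    using pow_commute[where L = "T k" and M = "op_monom ks T m'" and k = "m k",
        OF lin_T lin_op_monom op_monom_commute_T[symmetric] g] by simp
  finally show ?case by (simp add: op_monom_Cons g_def)
qed simp

abbreviation \<Phi> :: "'i mpoly \<Rightarrow> 'n operator" where "\<Phi> \<equiv> op_poly js T"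

lemma op_poly_closed: "f \<in> A \<Longrightarrow> \<Phi> p f \<in> A"
proof -
  assume f: "f \<in> A"
  have "(\<lambda>x. \<Sum>m\<in>Poly_Mapping.keys p. Poly_Mapping.lookup p m * op_monom js T (Poly_Mapping.lookup m) f x) \<in> A"
    by (intro A_sum A_cmult lin_closed[OF lin_op_monom f])
  then show ?thesis by (simp add: op_poly_def[abs_def])
qed

lemma op_poly_sum: "\<Phi> (sum p K) f x = (\<Sum>k\<in>K. \<Phi> (p k) f x)"
  by (simp add: op_poly_eq lin_ext_sum)

lemma op_poly_mult: "f \<in> A \<Longrightarrow> \<Phi> (p * q) f = \<Phi> p (\<Phi> q f)"
proof
  fix x assume f: "f \<in> A"
  have "lin_ext q (\<lambda>m'. op_monom js T (Poly_Mapping.lookup (m + m')) f x) =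
      op_monom js T (Poly_Mapping.lookup m) (\<Phi> q f) x" for m
  proof -
    have "op_monom js T (Poly_Mapping.lookup m) (\<Phi> q f) =
        op_monom js T (Poly_Mapping.lookup m) (\<lambda>x. \<Sum>m'\<in>Poly_Mapping.keys q. Poly_Mapping.lookup q m' *
          op_monom js T (Poly_Mapping.lookup m') f x)"
      by (simp add: op_poly_def[abs_def])
    also have "\<dots> = (\<lambda>x. \<Sum>m'\<in>Poly_Mapping.keys q. Poly_Mapping.lookup q m' *
          op_monom js T (Poly_Mapping.lookup m) (op_monom js T (Poly_Mapping.lookup m') f) x)"
      by (rule lin_sum[OF lin_op_monom lin_closed[OF lin_op_monom f]])
    finally show ?thesis
      by (simp add: lin_ext_def plus_poly_mapping.rep_eq op_monom_add[OF f])
  qed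
  then show "\<Phi> (p * q) f x = \<Phi> p (\<Phi> q f) x"
    by (simp add: op_poly_eq lin_ext_mult)
qed

lemma op_poly_commute: "f \<in> A \<Longrightarrow> \<Phi> p (\<Phi> q f) = \<Phi> q (\<Phi> p f)"
  by (metis op_poly_mult mult.commute)

lemma op_poly_const: "\<Phi> (Poly_Mapping.single 0 a) f x = a * f x"
  by (simp add: op_poly_eq zero_poly_mapping.rep_eq op_monom_zero)

lemma op_poly_one: "\<Phi> 1 f = f"
  using op_poly_const[of 1 f] by (simp flip: single_one add: fun_eq_iff)

lemma op_poly_var: "\<Phi> (Poly_Mapping.single (Poly_Mapping.single i k) a) f x = a * (T i ^^ k) f x"
proof -
  have "Poly_Mapping.lookup (Poly_Mapping.single i k) = (\<lambda>j. if j = i then k else 0)"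
    by (auto simp: lookup_single when_def)
  then show ?thesis using op_monom_delta[OF js(1), where T = T and i = i and k = k and f = f] js(2) by (simp add: op_poly_eq)
qed

context
  fixes B :: "'i \<Rightarrow> 'i \<Rightarrow> complex"
begin

definition lin_op :: "'i \<Rightarrow> 'n operator" where
  "lin_op i f x = (\<Sum>j\<in>UNIV. B i j * T j f x)"

definition lin_form :: "'i \<Rightarrow> 'i mpoly" where
  "lin_form i = (\<Sum>j\<in>UNIV. Poly_Mapping.single (Poly_Mapping.single j 1) (B i j))"

definition subst_poly :: "'i mpoly \<Rightarrow> 'i mpoly" where
  "subst_poly p = (\<Sum>m\<in>Poly_Mapping.keys p. Poly_Mapping.single 0 (Poly_Mapping.lookup p m) *
      (\<Prod>i\<in>UNIV. lin_form i ^ Poly_Mapping.lookup m i))"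

lemma lin_op_eq: "lin_op i f = \<Phi> (lin_form i) f"
  by (auto simp: lin_op_def lin_form_def op_poly_sum op_poly_var)

lemma lin_op_pow: "f \<in> A \<Longrightarrow> (lin_op i ^^ k) f = \<Phi> (lin_form i ^ k) f"
proof (induction k)
  case (Suc k)
  then show ?case by (simp add: lin_op_eq op_poly_mult)
qed (simp add: op_poly_one)

lemma op_monom_lin_op:
  "f \<in> A \<Longrightarrow> distinct ks \<Longrightarrow> op_monom ks lin_op m f = \<Phi> (\<Prod>i\<in>set ks. lin_form i ^ m i) f"
proof (induction ks arbitrary: f)
  case (Cons k ks)
  then show ?case
    by (simp add: op_monom_Cons lin_op_pow op_poly_closed op_poly_mult op_poly_commute)
qed (simp add: op_poly_one)

text \<open>A linear change of the operators is moved into the polynomial, where it can be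
  recognised through values by \<open>peval_subst_poly\<close>.\<close>

lemma op_poly_lin_op:
  assumes f: "f \<in> A"
  shows "op_poly js lin_op p f x = \<Phi> (subst_poly p) f x"
proof -
  have "\<Phi> (Poly_Mapping.single 0 a * q) f x = a * \<Phi> q f x" for a q
    using op_poly_mult[OF f] op_poly_const by metis
  then show ?thesis
    unfolding op_poly_def[of js lin_op] subst_poly_def op_poly_sum
    by (simp add: op_monom_lin_op[OF f js(1)] js(2))
qed

lemma peval_subst_poly: "peval (subst_poly p) s = peval p (\<lambda>i. \<Sum>j\<in>UNIV. B i j * s j)"
proof -
  have "peval (lin_form i) s = (\<Sum>j\<in>UNIV. B i j * s j)" for i
    by (simp add: lin_form_def peval_sum)
  moreover have "peval p t = (\<Sum>m\<in>Poly_Mapping.keys p. Poly_Mapping.lookup p m *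
      (\<Prod>i\<in>UNIV. t i ^ Poly_Mapping.lookup m i))" for t
    by (simp add: peval_eq_poly_eval poly_eval_def)
  ultimately show ?thesis
    by (simp add: subst_poly_def peval_sum peval_mult peval_prod peval_power)
qed

end

end

section \<open>Polynomials in Dunkl operators\<close>

definition ixs :: "'n::finite list" where "ixs = (SOME is. distinct is \<and> set is = UNIV)"

lemma ixs: "distinct (ixs :: 'n list)" "set (ixs :: 'n::finite list) = UNIV"
proof -
  have "\<exists>is :: 'n list. distinct is \<and> set is = UNIV"
    using finite_distinct_list[OF finite_class.finite_UNIV] by auto
  from someI_ex[OF this] show "distinct (ixs :: 'n list)" "set (ixs :: 'n list) = UNIV"
    by (simp_all add: ixs_def)
qed

lemma poly_dunkl_eq: "poly_dunkl Rp c \<sigma> = op_poly ixs (\<lambda>i. dunkl Rp c (axis i 1)) \<sigma>"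
  by (simp add: poly_dunkl_def ixs_def)

context dunkl_data
begin

abbreviation pd :: "'n mpoly \<Rightarrow> 'n operator" where "pd \<equiv> poly_dunkl Rp c"

text \<open>Functions on \<open>\<Omega>\<close>, extended by zero, form a space on which the operators commute exactly.\<close>

definition rs :: "(complex^'n) set \<Rightarrow> (complex^'n \<Rightarrow> complex) \<Rightarrow> complex^'n \<Rightarrow> complex" where
  "rs \<Omega> f x = (if x \<in> \<Omega> then f x else 0)"

definition Tr :: "(complex^'n) set \<Rightarrow> 'n \<Rightarrow> 'n operator" where
  "Tr \<Omega> i f = rs \<Omega> (dk (axis i 1) f)"

definition AF :: "(complex^'n) set \<Rightarrow> (complex^'n \<Rightarrow> complex) set" where
  "AF \<Omega> = {f. analytic_fun f \<Omega> \<and> (\<forall>x. x \<notin> \<Omega> \<longrightarrow> f x = 0)}"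

lemma rs_AF: "analytic_fun f \<Omega> \<Longrightarrow> rs \<Omega> f \<in> AF \<Omega>"
  by (auto simp: AF_def rs_def intro: analytic_fun_cong)

lemma comm_ops_Tr:
  assumes dom: "refl_dom \<Omega>"
  shows "comm_ops (Tr \<Omega>) (AF \<Omega>) ixs"
proof
  fix f g :: "complex^'n \<Rightarrow> complex" and i j :: 'n and a :: complex
  assume f: "f \<in> AF \<Omega>"
  then have fa: "analytic_fun f \<Omega>" by (simp add: AF_def)
  show "Tr \<Omega> i f \<in> AF \<Omega>" unfolding Tr_def by (intro rs_AF dunkl_analytic dom fa)
  show "(\<lambda>x. a * f x) \<in> AF \<Omega>" using f by (auto simp: AF_def intro: analytic_fun_cmult)
  show "Tr \<Omega> i (\<lambda>x. a * f x) = (\<lambda>x. a * Tr \<Omega> i f x)"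
    by (rule ext) (simp add: Tr_def rs_def dunkl_cmult[OF dom fa])
  have "dk (axis i 1) (Tr \<Omega> j f) x = dk (axis i 1) (dk (axis j 1) f) x" if "x \<in> \<Omega>" for i j x
    by (rule dunkl_cong[OF dom _ _ that, symmetric])
      (auto simp: Tr_def rs_def intro: dunkl_analytic[OF dom fa])
  then show "Tr \<Omega> i (Tr \<Omega> j f) = Tr \<Omega> j (Tr \<Omega> i f)"
    by (intro ext) (simp add: Tr_def[of \<Omega> i "Tr \<Omega> j f"] Tr_def[of \<Omega> j "Tr \<Omega> i f"] rs_def dunkl_commute[OF dom fa])
  assume g: "g \<in> AF \<Omega>"
  then have ga: "analytic_fun g \<Omega>" by (simp add: AF_def)
  show "(\<lambda>x. f x + g x) \<in> AF \<Omega>" using f g by (auto simp: AF_def intro: analytic_fun_add)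
  show "Tr \<Omega> i (\<lambda>x. f x + g x) = (\<lambda>x. Tr \<Omega> i f x + Tr \<Omega> i g x)"
    by (rule ext) (simp add: Tr_def rs_def dunkl_add[OF dom fa ga])
qed (simp_all add: AF_def ixs)

lemma op_monom_Tr:
  assumes dom: "refl_dom \<Omega>" and g: "g \<in> AF \<Omega>" and eq: "\<And>x. x \<in> \<Omega> \<Longrightarrow> f x = g x"
  shows "\<forall>x\<in>\<Omega>. op_monom ks (\<lambda>i. dk (axis i 1)) m f x = op_monom ks (Tr \<Omega>) m g x"
proof -
  have step: "dk (axis i 1) f x = Tr \<Omega> i g x"
    if "g \<in> AF \<Omega>" "\<And>x. x \<in> \<Omega> \<Longrightarrow> f x = g x" "x \<in> \<Omega>" for f g x i
  proof -
    have "dk (axis i 1) g x = dk (axis i 1) f x"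
      by (rule dunkl_cong[OF dom]) (use that in \<open>auto simp: AF_def\<close>)
    then show ?thesis using that(3) by (simp add: Tr_def rs_def)
  qed
  have closed: "(Tr \<Omega> i ^^ k) g \<in> AF \<Omega>" if "g \<in> AF \<Omega>" for i k g
    using comm_ops.lin_closed[OF comm_ops_Tr[OF dom] comm_ops.lin_pow[OF comm_ops_Tr[OF dom] comm_ops.lin_T[OF comm_ops_Tr[OF dom]]] that] .
  have pow: "\<forall>x\<in>\<Omega>. (dk (axis i 1) ^^ k) f x = (Tr \<Omega> i ^^ k) g x"
    if "g \<in> AF \<Omega>" "\<And>x. x \<in> \<Omega> \<Longrightarrow> f x = g x" for f g i k
  proof (induction k)
    case (Suc k)
    have "dk (axis i 1) ((dk (axis i 1) ^^ k) f) x = Tr \<Omega> i ((Tr \<Omega> i ^^ k) g) x" if "x \<in> \<Omega>" for x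
      by (rule step[OF closed[OF \<open>g \<in> AF \<Omega>\<close>] _ that]) (use Suc in blast)
    then show ?case by simp
  qed (use that in auto)
  show ?thesis using g eq
  proof (induction ks arbitrary: f g)
    case (Cons k ks)
    show ?case unfolding op_monom_Cons
      by (rule Cons.IH[OF closed[OF Cons.prems(1)]]) (use pow[OF Cons.prems] in blast)
  qed simp
qed

lemma poly_dunkl_Tr:
  assumes dom: "refl_dom \<Omega>" and f: "analytic_fun f \<Omega>" and x: "x \<in> \<Omega>"
  shows "pd \<sigma> f x = op_poly ixs (Tr \<Omega>) \<sigma> (rs \<Omega> f) x"
proof -
  have "op_monom ixs (\<lambda>i. dk (axis i 1)) m f x = op_monom ixs (Tr \<Omega>) m (rs \<Omega> f) x" for m
    using op_monom_Tr[OF dom rs_AF[OF f], of f ixs m] x by (auto simp: rs_def)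
  then show ?thesis unfolding poly_dunkl_eq op_poly_def by simp
qed

lemma poly_dunkl_analytic:
  assumes dom: "refl_dom \<Omega>" and f: "analytic_fun f \<Omega>"
  shows "analytic_fun (pd \<sigma> f) \<Omega>"
proof -
  have "analytic_fun (op_poly ixs (Tr \<Omega>) \<sigma> (rs \<Omega> f)) \<Omega>"
    using comm_ops.op_poly_closed[OF comm_ops_Tr[OF dom] rs_AF[OF f]] by (simp add: AF_def)
  then show ?thesis by (rule analytic_fun_cong) (simp add: poly_dunkl_Tr[OF dom f])
qed

lemma poly_dunkl_add:
  assumes dom: "refl_dom \<Omega>" and f: "analytic_fun f \<Omega>" and g: "analytic_fun g \<Omega>" and x: "x \<in> \<Omega>"
  shows "pd \<sigma> (\<lambda>x. f x + g x) x = pd \<sigma> f x + pd \<sigma> g x"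
proof -
  interpret comm_ops "Tr \<Omega>" "AF \<Omega>" ixs by (rule comm_ops_Tr[OF dom])
  have "rs \<Omega> (\<lambda>x. f x + g x) = (\<lambda>x. rs \<Omega> f x + rs \<Omega> g x)" by (auto simp: rs_def)
  then show ?thesis
    using lin_add[OF lin_op_monom rs_AF[OF f] rs_AF[OF g], of ixs]
    by (simp add: poly_dunkl_Tr[OF dom _ x] f g analytic_fun_add op_poly_def distrib_left sum.distrib)
qed

lemma poly_dunkl_cmult:
  assumes dom: "refl_dom \<Omega>" and f: "analytic_fun f \<Omega>" and x: "x \<in> \<Omega>"
  shows "pd \<sigma> (\<lambda>x. a * f x) x = a * pd \<sigma> f x"
proof -
  interpret comm_ops "Tr \<Omega>" "AF \<Omega>" ixs by (rule comm_ops_Tr[OF dom])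
  have "rs \<Omega> (\<lambda>x. a * f x) = (\<lambda>x. a * rs \<Omega> f x)" by (auto simp: rs_def)
  then show ?thesis
    using lin_cmult[OF lin_op_monom rs_AF[OF f], of ixs]
    by (simp add: poly_dunkl_Tr[OF dom _ x] f analytic_fun_cmult op_poly_def sum_distrib_left mult.left_commute)
qed

lemma poly_dunkl_diff:
  assumes dom: "refl_dom \<Omega>" and f: "analytic_fun f \<Omega>" and g: "analytic_fun g \<Omega>" and x: "x \<in> \<Omega>"
  shows "pd \<sigma> (\<lambda>x. f x - g x) x = pd \<sigma> f x - pd \<sigma> g x"
  using poly_dunkl_add[OF dom f analytic_fun_cmult[OF g, of "-1"] x, of \<sigma>]
    poly_dunkl_cmult[OF dom g x, of \<sigma> "-1"] by simp

lemma poly_dunkl_sum: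
  assumes dom: "refl_dom \<Omega>" and f: "\<And>i. i \<in> I \<Longrightarrow> analytic_fun (f i) \<Omega>" and x: "x \<in> \<Omega>"
  shows "pd \<sigma> (\<lambda>x. \<Sum>i\<in>I. f i x) x = (\<Sum>i\<in>I. pd \<sigma> (f i) x)"
  using f
proof (induction I rule: infinite_finite_induct)
  case (insert i I)
  have "pd \<sigma> (\<lambda>x. f i x + (\<Sum>i\<in>I. f i x)) x = pd \<sigma> (f i) x + pd \<sigma> (\<lambda>x. \<Sum>i\<in>I. f i x) x"
    by (rule poly_dunkl_add[OF dom _ _ x]) (use insert in \<open>auto intro!: analytic_fun_sum\<close>)
  then show ?case using insert by simp
qed (use poly_dunkl_cmult[OF dom analytic_fun_const x, of \<sigma> 0] in simp_all)

lemma poly_dunkl_commute: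
  assumes dom: "refl_dom \<Omega>" and f: "analytic_fun f \<Omega>" and x: "x \<in> \<Omega>"
  shows "pd \<sigma> (pd \<tau> f) x = pd \<tau> (pd \<sigma> f) x"
proof -
  interpret comm_ops "Tr \<Omega>" "AF \<Omega>" ixs by (rule comm_ops_Tr[OF dom])
  have rs: "rs \<Omega> (pd \<sigma> f) = \<Phi> \<sigma> (rs \<Omega> f)" for \<sigma>
    using op_poly_closed[OF rs_AF[OF f]] by (auto simp: rs_def[of \<Omega> "pd \<sigma> f"] poly_dunkl_Tr[OF dom f] AF_def)
  show ?thesis
    by (simp add: poly_dunkl_Tr[OF dom poly_dunkl_analytic[OF dom f] x] rs op_poly_commute[OF rs_AF[OF f]])
qed

text \<open>Conjugation by a reflection replaces the coordinate Dunkl operators by linear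
  combinations of them with matrix \<open>B\<close>, which amounts to a substitution in
  \<open>\<sigma>\<close>.\<close>

lemma poly_dunkl_refl_invariant:
  assumes dom: "refl_dom \<Omega>" and f: "analytic_fun f \<Omega>" and b: "\<beta> \<in> R"
    and inv: "\<And>x. x \<in> \<Omega> \<Longrightarrow> f (refl \<beta> x) = f x" and s: "invariant_poly R \<sigma>" and x: "x \<in> \<Omega>"
  shows "pd \<sigma> f (refl \<beta> x) = pd \<sigma> f x"
proof -
  interpret comm_ops "Tr \<Omega>" "AF \<Omega>" ixs by (rule comm_ops_Tr[OF dom])
  define B where "B i j = refl \<beta> (axis i 1) $ j" for i j :: 'n
  define S where "S f = (\<lambda>z. f (refl \<beta> z))" for f :: "complex^'n \<Rightarrow> complex"
  have mem: "refl \<beta> z \<in> \<Omega> \<longleftrightarrow> z \<in> \<Omega>" for z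
    using refl_dom_refl[OF dom b] refl_refl[OF b] by metis
  have TS: "Tr \<Omega> i (S g) = S (lin_op B i g)" if g: "g \<in> AF \<Omega>" for i g
  proof
    fix z
    have ga: "analytic_fun g \<Omega>" using g by (simp add: AF_def)
    show "Tr \<Omega> i (S g) z = S (lin_op B i g) z"
    proof (cases "z \<in> \<Omega>")
      case True
      have "Tr \<Omega> i (S g) z = dk (refl \<beta> (axis i 1)) g (refl \<beta> z)"
        using True dunkl_refl[OF dom ga b True] by (simp add: Tr_def rs_def S_def)
      also have "\<dots> = dk (\<Sum>j\<in>UNIV. B i j *s axis j 1) g (refl \<beta> z)"
        unfolding B_def
        by (rule arg_cong[where f = "\<lambda>v. dk v g (refl \<beta> z)"]) (rule vec_eq_sum_axis)
      also have "\<dots> = (\<Sum>j\<in>UNIV. B i j * dk (axis j 1) g (refl \<beta> z))"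
        by (rule dunkl_dir_sum[OF dom ga refl_dom_refl[OF dom b True]])
      finally show ?thesis using True by (simp add: S_def lin_op_def Tr_def rs_def mem)
    qed (simp add: S_def lin_op_def Tr_def rs_def mem)
  qed
  have lin: "lin_op B i g \<in> AF \<Omega>" if "g \<in> AF \<Omega>" for i g
    using op_poly_closed[OF that] by (simp add: lin_op_eq)
  have linp: "(lin_op B i ^^ k) g \<in> AF \<Omega>" if "g \<in> AF \<Omega>" for i g k
    using that by (induction k) (auto intro: lin)
  have pow: "(Tr \<Omega> i ^^ k) (S g) = S ((lin_op B i ^^ k) g)" if "g \<in> AF \<Omega>" for i g k
    by (induction k) (simp_all add: TS linp[OF that])
  have mon: "op_monom ks (Tr \<Omega>) m (S g) = S (op_monom ks (lin_op B) m g)" if "g \<in> AF \<Omega>" for ks m g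
    using that by (induction ks arbitrary: g) (simp_all add: op_monom_Cons pow linp)
  \<comment> \<open>Invariance speaks of values; injectivity of evaluation makes it an identity of
    formal polynomials, into which operators may be substituted.\<close>
  have sub: "subst_poly B \<sigma> = \<sigma>"
  proof (rule poly_eval_inj)
    fix y :: "complex^'n"
    have eq: "(\<chi> i. \<Sum>j\<in>UNIV. B i j * y $ j) = refl \<beta> y"
    proof -
      have "(\<Sum>j\<in>UNIV. B i j * y $ j) = bil (refl \<beta> (axis i 1)) y" for i by (simp add: bil_def B_def)
      then show ?thesis by (simp add: vec_eq_iff bil_refl_swap[OF bil_root[OF b]])
    qed
    have "poly_eval (subst_poly B \<sigma>) y = poly_eval \<sigma> (\<chi> i. \<Sum>j\<in>UNIV. B i j * y $ j)"
      by (simp add: poly_eval_eq_peval peval_subst_poly)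
    also have "\<dots> = poly_eval \<sigma> (refl \<beta> y)" by (simp only: eq)
    also have "\<dots> = poly_eval \<sigma> y"
      using s refl_in_W[OF b] unfolding invariant_poly_def by blast
    finally show "poly_eval (subst_poly B \<sigma>) y = poly_eval \<sigma> y" .
  qed
  define F where "F = rs \<Omega> f"
  have F: "F \<in> AF \<Omega>" unfolding F_def by (rule rs_AF[OF f])
  have SF: "S F = F" using inv by (auto simp: S_def F_def rs_def mem)
  have "\<Phi> \<sigma> (S F) x = op_poly ixs (lin_op B) \<sigma> F (refl \<beta> x)"
    unfolding op_poly_def mon[OF F] by (simp add: S_def)
  also have "\<dots> = \<Phi> \<sigma> F (refl \<beta> x)"
    using op_poly_lin_op[OF F, of B \<sigma>] sub by simp
  finally show ?thesis
    using poly_dunkl_Tr[OF dom f x] poly_dunkl_Tr[OF dom f refl_dom_refl[OF dom b x]]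
    by (simp add: SF[unfolded F_def] F_def)
qed

lemma poly_dunkl_invariant:
  assumes dom: "refl_dom \<Omega>" and f: "analytic_fun f \<Omega>"
    and inv: "\<And>w x. w \<in> W \<Longrightarrow> x \<in> \<Omega> \<Longrightarrow> f (w x) = f x" and s: "invariant_poly R \<sigma>" and x: "x \<in> \<Omega>" and w: "w \<in> W"
  shows "pd \<sigma> f (w x) = pd \<sigma> f x"
  using w
proof (induction rule: refl_group.induct)
  case (refl \<beta> w)
  have "pd \<sigma> f (refl \<beta> (w x)) = pd \<sigma> f (w x)"
    by (rule poly_dunkl_refl_invariant[OF dom f refl(1) inv[OF refl_in_W[OF refl(1)]] s W_dom[OF refl(2) dom x]])
  with refl show ?case by simp
qed simp

lemma poly_dunkl_cherednik: "pd \<sigma> \<in> cherednik_algebra R Rp c"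
proof -
  have const: "(\<lambda>f x. a * f x) \<in> cherednik_algebra R Rp c" for a
    using cherednik_algebra.mult[of "Poly_Mapping.single 0 a" R Rp c] by (simp add: poly_eval_eq_peval)
  have one: "(\<lambda>f. f) \<in> cherednik_algebra R Rp c" using const[of 1] by simp
  have pow: "(\<lambda>f. (dk \<xi> ^^ k) f) \<in> cherednik_algebra R Rp c" for \<xi> k
  proof (induction k)
    case (Suc k)
    show ?case using cherednik_algebra.comp[OF cherednik_algebra.dunkl Suc] by simp
  qed (simp add: one)
  have mon: "(\<lambda>f. op_monom ks (\<lambda>i. dk (axis i 1)) m f) \<in> cherednik_algebra R Rp c" for ks m
  proof (induction ks)
    case (Cons k ks)
    show ?case using cherednik_algebra.comp[OF Cons pow] by (simp add: op_monom_Cons)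
  qed (simp add: one)
  have "(\<lambda>f x. \<Sum>m\<in>M. a m * op_monom ixs (\<lambda>i. dk (axis i 1)) (Poly_Mapping.lookup m) f x)
      \<in> cherednik_algebra R Rp c" if "finite M" for M and a :: "_ \<Rightarrow> complex"
    using that
  proof (induction M rule: finite_induct)
    case empty
    show ?case using const[of 0] by simp
  next
    case (insert m M)
    show ?case using cherednik_algebra.add[OF cherednik_algebra.comp[OF const[of "a m"] mon] insert.IH] insert.hyps
      by simp
  qed
  then show ?thesis unfolding poly_dunkl_eq op_poly_def[abs_def] by simp
qed

lemma op_monom_vord:
  assumes dom: "refl_dom \<Omega>" and X: "X \<subseteq> \<Omega>" "\<And>\<alpha> x. \<alpha> \<in> R \<Longrightarrow> x \<in> X \<Longrightarrow> refl \<alpha> x \<in> X"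
    and f: "analytic_fun f \<Omega>" and v: "\<And>x. x \<in> X \<Longrightarrow> vord (k + sum_list (map m ks)) f x"
  shows "analytic_fun (op_monom ks (\<lambda>i. dk (axis i 1)) m f) \<Omega> \<and>
    (\<forall>x\<in>X. vord k (op_monom ks (\<lambda>i. dk (axis i 1)) m f) x)"
proof -
  have pow: "analytic_fun ((dk \<xi> ^^ j) f) \<Omega> \<and> (\<forall>x\<in>X. vord k ((dk \<xi> ^^ j) f) x)"
    if "analytic_fun f \<Omega>" "\<And>x. x \<in> X \<Longrightarrow> vord (k + j) f x" for f j k \<xi>
    using that
  proof (induction j arbitrary: k)
    case (Suc j)
    have 1: "analytic_fun ((dk \<xi> ^^ j) f) \<Omega>" "\<And>x. x \<in> X \<Longrightarrow> vord (Suc k) ((dk \<xi> ^^ j) f) x"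
      using Suc.IH[of "Suc k"] Suc.prems by auto
    show ?case using dunkl_vord[OF dom 1(1) X 1(2)] dunkl_analytic[OF dom 1(1)] by simp
  qed simp
  show ?thesis using f v
  proof (induction ks arbitrary: f)
    case (Cons i ks)
    have "analytic_fun ((dk (axis i 1) ^^ m i) f) \<Omega> \<and>
        (\<forall>x\<in>X. vord (k + sum_list (map m ks)) ((dk (axis i 1) ^^ m i) f) x)"
      by (rule pow[OF Cons.prems(1)]) (use Cons.prems(2) in \<open>simp add: add_ac\<close>)
    then show ?case unfolding op_monom_Cons by (intro Cons.IH) auto
  qed simp
qed

lemma poly_dunkl_vord:
  assumes dom: "refl_dom \<Omega>" and x: "x \<in> \<Omega>" and f: "analytic_fun f \<Omega>"
    and deg: "\<And>m. m \<in> Poly_Mapping.keys \<sigma> \<Longrightarrow> sum_list (map (Poly_Mapping.lookup m) ixs) \<le> d"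
    and v: "\<And>y. y \<in> orb x \<Longrightarrow> vord (k + d) f y" and y: "y \<in> orb x"
  shows "vord k (pd \<sigma> f) y"
proof -
  have "vord k (op_monom ixs (\<lambda>i. dk (axis i 1)) (Poly_Mapping.lookup m) f) y"
    if "m \<in> Poly_Mapping.keys \<sigma>" for m
    using op_monom_vord[OF dom orb_sub[OF dom x] orb_refl f, where m = "Poly_Mapping.lookup m" and ks = ixs and k = k]
      vord_mono[OF v] deg[OF that] y by auto
  then have "vord k (\<lambda>y. \<Sum>m\<in>Poly_Mapping.keys \<sigma>. Poly_Mapping.lookup \<sigma> m *
      op_monom ixs (\<lambda>i. dk (axis i 1)) (Poly_Mapping.lookup m) f y) y"
    by (intro vord_sum vord_cmult)
  then show ?thesis unfolding poly_dunkl_eq op_poly_def[abs_def] .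
qed

end

section \<open>Leading terms\<close>

lemma dderiv_power:
  assumes "open S" "analytic_fun f S" "x \<in> S"
  shows "dderiv \<xi> (\<lambda>z. f z ^ Suc m) x = of_nat (Suc m) * f x ^ m * dderiv \<xi> f x"
proof (induction m)
  case (Suc m)
  have "dderiv \<xi> (\<lambda>z. f z * f z ^ Suc m) x = f x * dderiv \<xi> (\<lambda>z. f z ^ Suc m) x + dderiv \<xi> f x * f x ^ Suc m"
    by (rule dderiv_mult[OF assms(1,2) analytic_fun_power[OF assms(2)] assms(3)])
  with Suc show ?case by (simp add: algebra_simps)
qed simp

context dunkl_data
begin

text \<open>If \<open>\<eta>\<close> is orthogonal to the roots vanishing at \<open>x\<close>, the reflections fixing \<open>x\<close> do not
  contribute to the leading term at \<open>x\<close> of a Dunkl operator.\<close>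

definition lead :: "(complex^'n) set \<Rightarrow> complex^'n \<Rightarrow> complex^'n \<Rightarrow> nat \<Rightarrow> complex \<Rightarrow> (complex^'n \<Rightarrow> complex) \<Rightarrow> bool" where
  "lead \<Omega> x \<eta> m C g \<longleftrightarrow> analytic_fun g \<Omega> \<and> (\<forall>y\<in>orb x. vord m g y) \<and>
     vord (Suc m) (\<lambda>z. g z - C * (bil \<eta> z - bil \<eta> x) ^ m) x"

text \<open>The derivative produces the new leading term. A quotient whose mirror misses
  \<open>x\<close> loses no order; one whose mirror contains \<open>x\<close> annihilates the
  leading power, because its reflection preserves \<open>bil \<eta>\<close>, and acts on the
  remainder only.\<close>

lemma lead_dunkl:
  assumes dom: "refl_dom \<Omega>" and x: "x \<in> \<Omega>" and \<eta>: "\<And>\<alpha>. \<alpha> \<in> R \<Longrightarrow> bil \<alpha> x = 0 \<Longrightarrow> bil \<alpha> \<eta> = 0"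
    and g: "lead \<Omega> x \<eta> (Suc m) C g"
  shows "lead \<Omega> x \<eta> m (C * of_nat (Suc m) * bil \<eta> \<xi>) (dk \<xi> g)"
proof -
  define b where "b z = bil \<eta> z - bil \<eta> x" for z
  have b: "analytic_fun b S" for S unfolding b_def[abs_def] by (intro analytic_fun_diff analytic_fun_bil analytic_fun_const)
  have bp: "analytic_fun (\<lambda>z. C * b z ^ j) S" for j S by (intro analytic_fun_cmult analytic_fun_power b)
  have db: "dderiv \<xi> b z = bil \<eta> \<xi>" for \<xi> z
    unfolding b_def[abs_def] by (subst dderiv_diff[OF open_UNIV]) (auto simp: analytic_fun_bil)
  have dbp: "dderiv \<xi> (\<lambda>z. C * b z ^ Suc m) z = C * of_nat (Suc m) * bil \<eta> \<xi> * b z ^ m" for \<xi> z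
    using dderiv_cmult[OF open_UNIV analytic_fun_power[OF b], of z \<xi> C "Suc m"]
      dderiv_power[OF open_UNIV b, of z \<xi> m] by (simp add: db)
  have S: "open \<Omega>" by (rule refl_dom_open[OF dom])
  have ga: "analytic_fun g \<Omega>" and gv: "\<And>y. y \<in> orb x \<Longrightarrow> vord (Suc m) g y"
    and lt: "vord (Suc (Suc m)) (\<lambda>z. g z - C * b z ^ Suc m) x"
    using g by (auto simp: lead_def b_def)
  define h where "h z = g z - C * b z ^ Suc m" for z
  have ha: "analytic_fun h \<Omega>" unfolding h_def[abs_def] by (intro analytic_fun_diff ga bp)
  have hv: "vord (Suc (Suc m)) h x" using lt by (simp add: h_def[abs_def])
  have D: "vord (Suc m) (\<lambda>z. dderiv \<xi> g z - C * of_nat (Suc m) * bil \<eta> \<xi> * b z ^ m) x"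
  proof (rule vord_cong[OF vord_dderiv[OF S ha x hv, of \<xi>] S x])
    fix z assume "z \<in> \<Omega>"
    then show "dderiv \<xi> h z = dderiv \<xi> g z - C * of_nat (Suc m) * bil \<eta> \<xi> * b z ^ m"
      unfolding h_def[abs_def] by (simp only: dderiv_diff[OF S ga bp] dbp)
  qed
  have Q: "vord (Suc m) (refl_quotient \<alpha> g) x" if "\<alpha> \<in> Rp" for \<alpha>
  proof (cases "bil \<alpha> x = 0")
    case False
    show ?thesis
      by (rule refl_quotient_vord[OF Rp_R[OF that] False gv gv]) (rule orb_self, rule orb_refl[OF Rp_R[OF that] orb_self])
  next
    case True
    have a: "\<alpha> \<in> R" by (rule Rp_R[OF that])
    have orth: "bil \<eta> \<alpha> = 0" using \<eta>[OF a True] by (simp add: bil_commute)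
    have zero: "refl_quotient \<alpha> (\<lambda>z. C * b z ^ Suc m) z = 0" for z
    proof -
      have "b (refl \<alpha> z) = b z" by (simp add: b_def refl_def bil_simps orth)
      then show ?thesis
        unfolding refl_quotient_eq[OF refl_dom_UNIV bp a UNIV_I] dbp by (simp add: orth)
    qed
    show ?thesis
    proof (rule vord_cong[OF refl_quotient_vord_mirror[OF S ha a x True hv] S x])
      fix z assume z: "z \<in> \<Omega>"
      have "refl_quotient \<alpha> (\<lambda>z. h z + C * b z ^ Suc m) z =
          refl_quotient \<alpha> h z + refl_quotient \<alpha> (\<lambda>z. C * b z ^ Suc m) z"
        by (rule refl_quotient_add[OF dom ha bp a z])
      moreover have "(\<lambda>z. h z + C * b z ^ Suc m) = g" by (simp add: h_def fun_eq_iff)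
      ultimately show "refl_quotient \<alpha> h z = refl_quotient \<alpha> g z" by (simp only: zero) simp
    qed
  qed
  have "vord (Suc m) (\<lambda>z. \<Sum>\<alpha>\<in>Rp. c \<alpha> * bil \<alpha> \<xi> * refl_quotient \<alpha> g z) x"
    by (intro vord_sum vord_cmult Q)
  from vord_diff[OF D this] have "vord (Suc m) (\<lambda>z. (dderiv \<xi> g z - C * of_nat (Suc m) * bil \<eta> \<xi> * b z ^ m) -
      (\<Sum>\<alpha>\<in>Rp. c \<alpha> * bil \<alpha> \<xi> * refl_quotient \<alpha> g z)) x" .
  then have "vord (Suc m) (\<lambda>z. dk \<xi> g z - C * of_nat (Suc m) * bil \<eta> \<xi> * b z ^ m) x"
    by (simp add: dunkl_def algebra_simps)
  moreover have "vord m (dk \<xi> g) y" if "y \<in> orb x" for y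
    by (rule dunkl_vord[OF dom ga orb_sub[OF dom x] orb_refl gv that])
  ultimately show ?thesis
    unfolding lead_def b_def using dunkl_analytic[OF dom ga] by blast
qed

lemma lead_sum:
  assumes "\<And>i. i \<in> I \<Longrightarrow> lead \<Omega> x \<eta> m (C i) (g i)"
  shows "lead \<Omega> x \<eta> m (\<Sum>i\<in>I. a i * C i) (\<lambda>z. \<Sum>i\<in>I. a i * g i z)"
proof -
  have "vord (Suc m) (\<lambda>z. \<Sum>i\<in>I. a i * (g i z - C i * (bil \<eta> z - bil \<eta> x) ^ m)) x"
    using assms by (intro vord_sum vord_cmult) (auto simp: lead_def)
  moreover have "(\<lambda>z. \<Sum>i\<in>I. a i * (g i z - C i * (bil \<eta> z - bil \<eta> x) ^ m)) =
      (\<lambda>z. (\<Sum>i\<in>I. a i * g i z) - (\<Sum>i\<in>I. a i * C i) * (bil \<eta> z - bil \<eta> x) ^ m)"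
    by (simp add: right_diff_distrib sum_subtractf sum_distrib_right mult.assoc)
  ultimately show ?thesis
    using assms unfolding lead_def by (auto intro!: analytic_fun_sum analytic_fun_cmult vord_sum vord_cmult)
qed

text \<open>Each application multiplies by the current exponent and by \<open>\<eta> $ i\<close>;
  the exponents accumulate to the quotient of factorials.\<close>

lemma lead_op_monom:
  assumes dom: "refl_dom \<Omega>" and x: "x \<in> \<Omega>" and \<eta>: "\<And>\<alpha>. \<alpha> \<in> R \<Longrightarrow> bil \<alpha> x = 0 \<Longrightarrow> bil \<alpha> \<eta> = 0"
    and g: "lead \<Omega> x \<eta> (k + sum_list (map m ks)) C g"
  shows "lead \<Omega> x \<eta> k (C * fact (k + sum_list (map m ks)) / fact k * (\<Prod>i\<leftarrow>ks. (\<eta> $ i) ^ m i))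
    (op_monom ks (\<lambda>i. dk (axis i 1)) m g)"
proof -
  have pow: "lead \<Omega> x \<eta> k (C * fact (k + j) / fact k * (\<eta> $ i) ^ j) ((dk (axis i 1) ^^ j) g)"
    if "lead \<Omega> x \<eta> (k + j) C g" for i j k C g
    using that
  proof (induction j arbitrary: k)
    case (Suc j)
    have "lead \<Omega> x \<eta> (Suc k) (C * fact (Suc k + j) / fact (Suc k) * (\<eta> $ i) ^ j) ((dk (axis i 1) ^^ j) g)"
      using Suc.IH[of "Suc k"] Suc.prems by simp
    from lead_dunkl[OF dom x \<eta> this, of "axis i 1"]
    have "lead \<Omega> x \<eta> k (C * fact (Suc k + j) / fact (Suc k) * (\<eta> $ i) ^ j * of_nat (Suc k) * bil \<eta> (axis i 1))
        ((dk (axis i 1) ^^ Suc j) g)" by simp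
    moreover have "C * fact (Suc k + j) / fact (Suc k) * (\<eta> $ i) ^ j * of_nat (Suc k) * bil \<eta> (axis i 1) =
        C * fact (k + Suc j) / fact k * (\<eta> $ i) ^ Suc j"
    proof -
      have "fact (Suc k) = of_nat (Suc k) * (fact k :: complex)" by (simp only: fact_Suc)
      then show ?thesis by (simp del: fact_Suc of_nat_Suc)
    qed
    ultimately show ?case by simp
  qed (simp add: lead_def)
  show ?thesis using g
  proof (induction ks arbitrary: C g)
    case (Cons i ks)
    define l where "l = k + sum_list (map m ks)"
    have "lead \<Omega> x \<eta> l (C * fact (l + m i) / fact l * (\<eta> $ i) ^ m i) ((dk (axis i 1) ^^ m i) g)"
      by (rule pow) (use Cons.prems in \<open>simp add: l_def add_ac\<close>)
    then have L: "lead \<Omega> x \<eta> k ((C * fact (l + m i) / fact l * (\<eta> $ i) ^ m i) * fact l / fact k * (\<Prod>i\<leftarrow>ks. (\<eta> $ i) ^ m i))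
      (op_monom (i # ks) (\<lambda>i. dk (axis i 1)) m g)"
      unfolding op_monom_Cons l_def by (rule Cons.IH)
    have eq: "(C * fact (l + m i) / fact l * (\<eta> $ i) ^ m i) * fact l / fact k * (\<Prod>i\<leftarrow>ks. (\<eta> $ i) ^ m i) =
      C * fact (k + sum_list (map m (i # ks))) / fact k * (\<Prod>i\<leftarrow>i # ks. (\<eta> $ i) ^ m i)"
      by (simp add: l_def add_ac)
    show ?case using L unfolding eq .
  qed simp
qed

lemma lead_poly_dunkl:
  assumes dom: "refl_dom \<Omega>" and x: "x \<in> \<Omega>" and \<eta>: "\<And>\<alpha>. \<alpha> \<in> R \<Longrightarrow> bil \<alpha> x = 0 \<Longrightarrow> bil \<alpha> \<eta> = 0"
    and hom: "\<And>m. m \<in> Poly_Mapping.keys \<sigma> \<Longrightarrow> sum_list (map (Poly_Mapping.lookup m) ixs) = d"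
    and g: "lead \<Omega> x \<eta> (k + d) C g"
  shows "lead \<Omega> x \<eta> k (C * fact (k + d) / fact k * poly_eval \<sigma> \<eta>) (pd \<sigma> g)"
proof -
  define Q where "Q m = (\<Prod>i\<leftarrow>ixs. (\<eta> $ i) ^ Poly_Mapping.lookup m i)" for m
  have Q: "Q m = (\<Prod>i\<in>UNIV. (\<eta> $ i) ^ Poly_Mapping.lookup m i)" for m
    unfolding Q_def using prod.distinct_set_conv_list[OF ixs(1), of "\<lambda>i. (\<eta> $ i) ^ Poly_Mapping.lookup m i"]
    by (simp add: ixs(2))
  have "lead \<Omega> x \<eta> k (\<Sum>m\<in>Poly_Mapping.keys \<sigma>. Poly_Mapping.lookup \<sigma> m * (C * fact (k + d) / fact k * Q m))
    (\<lambda>z. \<Sum>m\<in>Poly_Mapping.keys \<sigma>. Poly_Mapping.lookup \<sigma> m *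
      op_monom ixs (\<lambda>i. dk (axis i 1)) (Poly_Mapping.lookup m) g z)"
  proof (rule lead_sum)
    fix m assume "m \<in> Poly_Mapping.keys \<sigma>"
    from hom[OF this] show "lead \<Omega> x \<eta> k (C * fact (k + d) / fact k * Q m)
        (op_monom ixs (\<lambda>i. dk (axis i 1)) (Poly_Mapping.lookup m) g)"
      using lead_op_monom[OF dom x \<eta>, of k "Poly_Mapping.lookup m" ixs C g] g by (simp add: Q_def)
  qed
  moreover have "(\<Sum>m\<in>Poly_Mapping.keys \<sigma>. Poly_Mapping.lookup \<sigma> m * (C * fact (k + d) / fact k * Q m)) =
      C * fact (k + d) / fact k * poly_eval \<sigma> \<eta>"
    by (simp add: poly_eval_def Q sum_distrib_left mult_ac)
  ultimately show ?thesis unfolding poly_dunkl_eq op_poly_def[abs_def] by simp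
qed

lemma lead_value: "lead \<Omega> x \<eta> k C g \<Longrightarrow> g x = (if k = 0 then C else 0)"
proof -
  assume l: "lead \<Omega> x \<eta> k C g"
  then have "g x - C * (bil \<eta> x - bil \<eta> x) ^ k = 0" unfolding lead_def using vord_Suc_zero by blast
  then show ?thesis by simp
qed

end

section \<open>The stratum and invariant extensions\<close>

lemma infdist_image_isometry:
  assumes "\<And>x y. dist (w x) (w y) = dist x y"
  shows "infdist (w z) (w ` A) = infdist z A"
  by (simp add: infdist_def image_image assms)

locale stratum = dunkl_data R Rp c
  for R Rp :: "(complex^'n) set" and c :: "complex^'n \<Rightarrow> complex" +
  fixes \<Gamma> P U :: "(complex^'n) set" and n :: nat and e :: "nat \<Rightarrow> complex^'n"
  assumes \<Gamma>: "\<Gamma> \<subseteq> R"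
    and P_def: "P = {x. \<forall>\<beta>\<in>\<Gamma>. bil \<beta> x = 0}"
    and coords: "orthonormal_coords P n e"
    and openin_U: "openin (top_of_set P) U"
    and U_nonempty: "U \<noteq> {}"
    and small: "\<And>w. w \<in> refl_group R \<Longrightarrow> w ` U \<inter> U = {} \<or> (\<forall>u\<in>U. w u = u)"
    and ideal: "cherednik_invariant R Rp c (vanishing_ideal (orbit_union R P))"
begin

lemma P_add: "x \<in> P \<Longrightarrow> y \<in> P \<Longrightarrow> x + y \<in> P"
  and P_smult: "x \<in> P \<Longrightarrow> a *s x \<in> P"
  and P_zero: "0 \<in> P"
  by (auto simp: P_def bil_simps)

lemma P_diff: "x \<in> P \<Longrightarrow> y \<in> P \<Longrightarrow> x - y \<in> P"
  by (auto simp: P_def bil_simps)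

lemma P_sum: "(\<And>i. i \<in> I \<Longrightarrow> f i \<in> P) \<Longrightarrow> sum f I \<in> P"
  by (auto simp: P_def bil_sum_right)

lemma e_orth: "i < n \<Longrightarrow> j < n \<Longrightarrow> bil (e i) (e j) = (if i = j then 1 else 0)"
  using coords by (simp add: orthonormal_coords_def)

lemma P_range: "P = range (\<lambda>y :: nat \<Rightarrow> complex. \<Sum>i<n. y i *s e i)"
  using coords unfolding orthonormal_coords_def by blast

lemma e_P: "i < n \<Longrightarrow> e i \<in> P"
proof -
  assume i: "i < n"
  have "(\<Sum>j<n. (if j = i then 1 else 0) *s e j) = e i"
    using i by (simp add: if_distrib[of "\<lambda>t. t *s _"] cong: if_cong)
  then show ?thesis unfolding P_range by (intro image_eqI[where x = "\<lambda>j. if j = i then 1 else 0"]) simp_all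
qed

definition proj :: "complex^'n \<Rightarrow> complex^'n" where
  "proj z = (\<Sum>i<n. bil (e i) z *s e i)"

lemma proj_P: "proj z \<in> P"
  unfolding proj_def by (intro P_sum P_smult e_P) simp

lemma proj_add: "proj (x + y) = proj x + proj y"
  by (simp add: proj_def bil_simps vec.scale_left_distrib sum.distrib)

lemma proj_smult: "proj (a *s x) = a *s proj x"
  by (simp add: proj_def bil_simps vec.scale_sum_right)

lemma proj_linear: "linear proj"
  by (rule linearI) (auto simp: proj_add scaleR_eq_smult proj_smult)

lemma bil_e_proj: "i < n \<Longrightarrow> bil (e i) (proj z) = bil (e i) z"
  by (simp add: proj_def bil_simps e_orth if_distrib[of "\<lambda>t. _ * t"] cong: if_cong)

lemma proj_id: "p \<in> P \<Longrightarrow> proj p = p"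
proof -
  assume "p \<in> P"
  then obtain y where y: "p = (\<Sum>i<n. y i *s e i)" unfolding P_range by blast
  have "bil (e i) p = y i" if "i < n" for i
    using that by (simp add: y bil_simps e_orth if_distrib[of "\<lambda>t. _ * t"] cong: if_cong)
  then show ?thesis by (simp add: proj_def y)
qed

lemma bil_proj_swap: "bil (proj x) y = bil x (proj y)"
  by (simp add: proj_def bil_simps bil_commute[of x] mult.commute)

lemma bil_proj: "q \<in> P \<Longrightarrow> bil (proj x) q = bil x q"
  by (simp add: bil_proj_swap proj_id)

lemma orth_proj_eq: "orth_proj P v = proj v"
  unfolding orth_proj_def
proof (rule the_equality)
  show "proj v \<in> P \<and> (\<forall>q\<in>P. bil (v - proj v) q = 0)"
    by (simp add: proj_P bil_diff_left bil_proj)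
next
  fix p assume p: "p \<in> P \<and> (\<forall>q\<in>P. bil (v - p) q = 0)"
  have "bil (e i) p = bil (e i) v" if "i < n" for i
    using p e_P[OF that] by (auto simp: bil_diff_left bil_commute[of "e i"])
  then have "proj p = proj v" by (simp add: proj_def)
  then show "p = proj v" using p proj_id by metis
qed

lemma U_P: "U \<subseteq> P"
  using openin_U openin_imp_subset by blast

lemma U_open: obtains O' where "open O'" "U = P \<inter> O'"
  using openin_U unfolding openin_open by blast

lemma U_line:
  assumes y: "y \<in> U" and p: "p \<in> P"
  shows "\<exists>t. t \<noteq> 0 \<and> y + t *s p \<in> U"
proof -
  obtain O' where O': "open O'" "U = P \<inter> O'" by (rule U_open)
  have "open ((\<lambda>t. y + t *s p) -` O')"
    by (rule open_vimage[OF O'(1)]) (intro continuous_intros)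
  moreover have "0 \<in> (\<lambda>t. y + t *s p) -` O'" using y O' by simp
  ultimately obtain r where r: "0 < r" "ball 0 r \<subseteq> (\<lambda>t. y + t *s p) -` O'" using openE by blast
  have "of_real (r / 2) \<in> ball (0::complex) r" using r by simp
  then have "y + of_real (r / 2) *s p \<in> O'" using r by blast
  moreover have "y + of_real (r / 2) *s p \<in> P" using y p U_P by (intro P_add P_smult) auto
  ultimately show ?thesis using r O' by (intro exI[of _ "of_real (r / 2)"]) auto
qed

text \<open>If a root vanishes at one point of \<open>U\<close>, its reflection fixes that point, so
  by smallness all of \<open>U\<close>. Then the root vanishes on a relatively open part of
  \<open>P\<close>, hence on \<open>P\<close>.\<close>

lemma U_generic:
  assumes y: "y \<in> U" and a: "\<alpha> \<in> R" and z: "bil \<alpha> y = 0" and p: "p \<in> P"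
  shows "bil \<alpha> p = 0"
proof -
  have "refl \<alpha> y = y" using z by (rule refl_fixed)
  then have "y \<in> refl \<alpha> ` U \<inter> U" using y by (metis IntI imageI)
  then have fx: "refl \<alpha> u = u" if "u \<in> U" for u using small[OF refl_in_W[OF a]] that by blast
  have U0: "bil \<alpha> u = 0" if "u \<in> U" for u
    using bil_refl_self[OF bil_root[OF a], of u] fx[OF that] by simp
  obtain t where t: "t \<noteq> 0" "y + t *s p \<in> U" using U_line[OF y p] by blast
  show ?thesis using U0[OF t(2)] z t(1) by (simp add: bil_simps)
qed

section \<open>A tube around the neighbourhood and its retraction\<close>

text \<open>By smallness the remaining group elements fix \<open>U\<close> pointwise, and therefore
  \<open>P\<close>.\<close>

definition bad :: "(complex^'n \<Rightarrow> complex^'n) set" where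
  "bad = {w \<in> W. w ` U \<inter> U = {}}"

lemma not_bad_fixes:
  assumes w: "w \<in> W" "w \<notin> bad" and p: "p \<in> P"
  shows "w p = p"
proof -
  have fx: "w u = u" if "u \<in> U" for u using small[OF w(1)] w that by (auto simp: bad_def)
  obtain y where y: "y \<in> U" using U_nonempty by blast
  obtain t where t: "t \<noteq> 0" "y + t *s p \<in> U" using U_line[OF y p] by blast
  have "w y + t *s w p = y + t *s p"
    using fx[OF t(2)] by (simp add: W_add[OF w(1)] W_smult[OF w(1)])
  then have "t *s w p = t *s p" using fx[OF y] by simp
  then show ?thesis using t(1) by (simp add: vec_eq_iff)
qed

lemma proj_not_bad:
  assumes w: "w \<in> W" "w \<notin> bad"
  shows "proj (w z) = proj z"
proof -
  have "bil (e i) (w z) = bil (e i) z" if "i < n" for i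
    using W_bil[OF w(1), of "e i" z] not_bad_fixes[OF w e_P[OF that]] by simp
  then show ?thesis by (simp add: proj_def)
qed

lemma mem_image_P:
  assumes w: "w \<in> W"
  shows "x \<in> w ` P \<longleftrightarrow> (\<forall>\<beta>\<in>\<Gamma>. bil (w \<beta>) x = 0)"
proof -
  obtain w' where w': "w' \<in> W" "\<And>x. w (w' x) = x" "\<And>x. w' (w x) = x"
    by (rule W_inverse[OF w]) blast
  have "x \<in> w ` P \<longleftrightarrow> w' x \<in> P" using w' by (metis imageE imageI)
  also have "\<dots> \<longleftrightarrow> (\<forall>\<beta>\<in>\<Gamma>. bil (w \<beta>) x = 0)"
    using W_bil[OF w, of _ "w' x"] w'(2) by (simp add: P_def)
  finally show ?thesis .
qed

text \<open>Genericity puts \<open>P\<close> inside its translate. Equality follows by finiteness: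
  \<open>w\<close> maps the roots vanishing on \<open>P\<close> injectively into themselves, hence
  permutes them.\<close>

lemma U_mirror_image:
  assumes y: "y \<in> U" and w: "w \<in> W" and yw: "y \<in> w ` P"
  shows "w ` P = P"
proof -
  obtain w' where w': "w' \<in> W" "\<And>x. w (w' x) = x" "\<And>x. w' (w x) = x"
    by (rule W_inverse[OF w]) blast
  note wP = mem_image_P[OF w]
  define RP where "RP = {\<alpha>\<in>R. \<forall>p\<in>P. bil \<alpha> p = 0}"
  have fin: "finite RP" using finite_R by (simp add: RP_def)
  have sub1: "P \<subseteq> w ` P"
  proof
    fix p assume p: "p \<in> P"
    have "bil (w \<beta>) p = 0" if b: "\<beta> \<in> \<Gamma>" for \<beta>
      using U_generic[OF y W_root[OF w] _ p, of \<beta>] b \<Gamma> yw wP by blast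
    then show "p \<in> w ` P" using wP by blast
  qed
  have w'P: "w' p \<in> P" if "p \<in> P" for p
    using sub1 that w'(3) by force
  have "w ` RP \<subseteq> RP"
  proof
    fix \<gamma> assume "\<gamma> \<in> w ` RP"
    then obtain \<alpha> where g: "\<alpha> \<in> RP" "\<gamma> = w \<alpha>" by blast
    have "bil \<gamma> p = 0" if p: "p \<in> P" for p
      using W_bil[OF w, of \<alpha> "w' p"] g w'(2) w'P[OF p] by (simp add: RP_def)
    then show "\<gamma> \<in> RP" using g W_root[OF w] by (auto simp: RP_def)
  qed
  moreover have "inj_on w RP" using w'(3) by (metis inj_onI)
  ultimately have wRP: "w ` RP = RP" using endo_inj_surj[OF fin] by blast
  have "w p \<in> P" if p: "p \<in> P" for p
    unfolding P_def
  proof (intro CollectI ballI)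
    fix \<beta> assume "\<beta> \<in> \<Gamma>"
    then have "\<beta> \<in> RP" using \<Gamma> by (auto simp: RP_def P_def)
    then obtain \<alpha> where a: "\<alpha> \<in> RP" "\<beta> = w \<alpha>" using wRP by blast
    show "bil \<beta> (w p) = 0" using a p W_bil[OF w] by (simp add: RP_def)
  qed
  with sub1 show ?thesis by blast
qed

lemma closed_P: "closed P"
proof -
  have "P = (\<Inter>\<beta>\<in>\<Gamma>. {x. bil \<beta> x = 0})" by (auto simp: P_def)
  moreover have "closed {x. bil \<beta> x = 0}" for \<beta> :: "complex^'n"
    by (intro closed_Collect_eq continuous_intros)
  ultimately show ?thesis by auto
qed

lemma W_image_open:
  assumes w: "w \<in> W" and S: "open S"
  shows "open (w ` S)"
proof -
  obtain w' where w': "w' \<in> W" "\<And>x. w (w' x) = x" "\<And>x. w' (w x) = x"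
    by (rule W_inverse[OF w]) blast
  have "w ` S = w' -` S" using w' by (auto simp: image_iff) metis
  moreover have "open (w' -` S)"
    by (rule open_vimage[OF S linear_continuous_on[OF linear_conv_bounded_linear[THEN iffD1, OF W_linear[OF w'(1)]]]])
  ultimately show ?thesis by simp
qed

lemma W_image_closed:
  assumes w: "w \<in> W" and S: "closed S"
  shows "closed (w ` S)"
proof -
  obtain w' where w': "w' \<in> W" "\<And>x. w (w' x) = x" "\<And>x. w' (w x) = x"
    by (rule W_inverse[OF w]) blast
  have "w ` S = w' -` S" using w' by (auto simp: image_iff) metis
  moreover have "closed (w' -` S)"
    by (rule closed_vimage[OF S linear_continuous_on[OF linear_conv_bounded_linear[THEN iffD1, OF W_linear[OF w'(1)]]]])
  ultimately show ?thesis by simp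
qed

text \<open>If \<open>y\<close> were a limit of points of the translate of \<open>U\<close>, the
  translate of \<open>P\<close> would be \<open>P\<close> itself; such points would lie in
  \<open>P\<close> near \<open>y\<close>, that is in \<open>U\<close>, contrary to
  disjointness.\<close>

lemma bad_far:
  assumes y: "y \<in> U" and w: "w \<in> bad"
  shows "0 < infdist y (w ` U)"
proof -
  have wW: "w \<in> W" and disj: "w ` U \<inter> U = {}" using w by (auto simp: bad_def)
  have "y \<notin> closure (w ` U)"
  proof
    assume cl: "y \<in> closure (w ` U)"
    have "closure (w ` U) \<subseteq> w ` P"
      by (intro closure_minimal W_image_closed[OF wW closed_P] image_mono U_P)
    then have wP: "w ` P = P" using U_mirror_image[OF y wW] cl by blast
    obtain O' where O': "open O'" "U = P \<inter> O'" by (rule U_open)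
    then have "O' \<inter> w ` U \<noteq> {}" using cl y open_Int_closure_eq_empty[OF O'(1)] by blast
    then show False using O' wP disj U_P by blast
  qed
  then show ?thesis
    using in_closure_iff_infdist_zero[of "w ` U" y] U_nonempty infdist_nonneg[of y "w ` U"] by auto
qed

text \<open>A tube over \<open>U\<close>, cut down in the manner of a Voronoi cell so that elements
  of \<open>bad\<close> move it off itself.\<close>

definition V :: "(complex^'n) set" where
  "V = {z. proj z \<in> U \<and> (\<forall>w\<in>bad. infdist z U < infdist z (w ` U))}"

lemma U_V: "U \<subseteq> V"
  using bad_far proj_id U_P by (auto simp: V_def)

lemma open_V: "open V"
proof -
  obtain O' where O': "open O'" "U = P \<inter> O'" by (rule U_open)
  have "V = proj -` O' \<inter> (\<Inter>w\<in>bad. {z. infdist z U < infdist z (w ` U)})"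
  proof -
    have "proj z \<in> U \<longleftrightarrow> proj z \<in> O'" for z using O'(2) proj_P by blast
    then show ?thesis unfolding V_def by blast
  qed
  moreover have "open (proj -` O')"
    by (rule open_vimage[OF O'(1) linear_continuous_on[OF linear_conv_bounded_linear[THEN iffD1, OF proj_linear]]])
  moreover have "open {z. infdist z U < infdist z (w ` U)}" for w
    by (intro open_Collect_less continuous_on_infdist continuous_on_id)
  moreover have "finite bad" using finite_W by (simp add: bad_def)
  ultimately show ?thesis by (auto intro!: open_Int open_INT)
qed

text \<open>The distance condition for \<open>w\<close> at \<open>w z\<close> and the one for the
  inverse of \<open>w\<close> at \<open>z\<close>, transported by isometry, would form a strict
  cycle.\<close>

lemma V_not_bad:
  assumes z: "z \<in> V" and w: "w \<in> W" and wz: "w z \<in> V"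
  shows "w \<notin> bad"
proof
  assume b: "w \<in> bad"
  obtain w' where w': "w' \<in> W" "\<And>x. w (w' x) = x" "\<And>x. w' (w x) = x"
    by (rule W_inverse[OF w]) blast
  have "w' ` U \<inter> U = {}"
  proof (rule ccontr)
    assume "w' ` U \<inter> U \<noteq> {}"
    then obtain u where "u \<in> U" "w' u \<in> U" by blast
    then have "u \<in> w ` U \<inter> U" using w'(2) by (metis IntI imageI)
    then show False using b unfolding bad_def by blast
  qed
  then have b': "w' \<in> bad" using w' by (simp add: bad_def)
  have "infdist (w z) U < infdist (w z) (w ` U)" using wz b by (simp add: V_def)
  also have "\<dots> = infdist z U" by (rule infdist_image_isometry[OF W_dist[OF w]])
  also have "\<dots> < infdist z (w' ` U)" using z b' by (simp add: V_def)
  also have "\<dots> = infdist (w z) (w ` w' ` U)" by (rule infdist_image_isometry[OF W_dist[OF w], symmetric])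
  also have "w ` w' ` U = U" using w'(2) by (simp add: image_image)
  finally show False by simp
qed

definition Om :: "(complex^'n) set" where "Om = orbit_union R V"

lemma orbit_union_dom:
  assumes "open S"
  shows "refl_dom (orbit_union R S)"
  unfolding refl_dom_def
proof (intro conjI ballI)
  show "open (orbit_union R S)" unfolding orbit_union_def by (intro open_UN ballI W_image_open assms)
  fix \<alpha> x assume a: "\<alpha> \<in> R" and "x \<in> orbit_union R S"
  then obtain w s where w: "w \<in> W" "s \<in> S" "x = w s" by (auto simp: orbit_union_def)
  have "refl \<alpha> \<circ> w \<in> W" by (rule refl_group.refl[OF a w(1)])
  then show "refl \<alpha> x \<in> orbit_union R S"
    unfolding orbit_union_def using w by (intro UN_I[of "refl \<alpha> \<circ> w"]) auto
qed

lemma sub_orbit_union: "S \<subseteq> orbit_union R S"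
  unfolding orbit_union_def by (auto intro!: bexI[of _ id] refl_group.id)

lemma dom_Om: "refl_dom Om"
  unfolding Om_def by (rule orbit_union_dom[OF open_V])

lemma V_Om: "V \<subseteq> Om"
  unfolding Om_def by (rule sub_orbit_union)

lemma U_Om: "U \<subseteq> Om"
  using U_V V_Om by blast

text \<open>Composition with this map extends a function on \<open>U\<close> invariantly and, near
  \<open>U\<close>, constantly in the normal directions.\<close>

definition ret :: "complex^'n \<Rightarrow> complex^'n" where
  "ret z = proj (SOME v. v \<in> V \<and> (\<exists>w\<in>W. z = w v))"

text \<open>Two representatives in \<open>V\<close> of one point differ by a group element outside
  \<open>bad\<close>; it fixes \<open>P\<close> pointwise and so preserves
  \<open>proj\<close>.\<close>

lemma ret_eq:
  assumes v: "v \<in> V" and w: "w \<in> W"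
  shows "ret (w v) = proj v"
proof -
  define v' where "v' = (SOME v'. v' \<in> V \<and> (\<exists>u\<in>W. w v = u v'))"
  have "v' \<in> V \<and> (\<exists>u\<in>W. w v = u v')"
    unfolding v'_def by (rule someI[of _ v]) (use v w in blast)
  then obtain u where u: "v' \<in> V" "u \<in> W" "w v = u v'" by blast
  obtain u' where u': "u' \<in> W" "\<And>x. u (u' x) = x" "\<And>x. u' (u x) = x"
    by (rule W_inverse[OF u(2)]) blast
  have eq: "u' (w v) = v'" using u(3) u'(3) by metis
  have c: "u' \<circ> w \<in> W" by (rule W_comp[OF u'(1) w])
  have "u' \<circ> w \<notin> bad" by (rule V_not_bad[OF v c]) (simp add: eq u(1))
  from proj_not_bad[OF c this, of v] show ?thesis by (simp add: eq ret_def v'_def[symmetric])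
qed

lemma ret_V: "v \<in> V \<Longrightarrow> ret v = proj v"
  using ret_eq[OF _ refl_group.id] by simp

lemma ret_U: "u \<in> U \<Longrightarrow> ret u = u"
  using ret_V U_V proj_id U_P by (metis subsetD)

lemma ret_inv:
  assumes x: "x \<in> Om" and w: "w \<in> W"
  shows "ret (w x) = ret x"
proof -
  obtain u v where u: "u \<in> W" "v \<in> V" "x = u v" using x by (auto simp: Om_def orbit_union_def)
  show ?thesis using ret_eq[OF u(2) W_comp[OF w u(1)]] ret_eq[OF u(2,1)] u(3) by simp
qed

lemma analytic_proj:
  assumes f: "analytic_fun f U" and S: "\<And>x. x \<in> S \<Longrightarrow> proj x \<in> U"
  shows "analytic_fun (\<lambda>x. f (proj x)) S"
  by (rule analytic_fun_compose_linear[OF f proj_linear proj_smult S])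

text \<open>On each translate of \<open>V\<close> the retraction is \<open>proj\<close> after the
  inverse group element, hence linear there.\<close>

lemma analytic_ret:
  assumes f: "analytic_fun f U"
  shows "analytic_fun (\<lambda>x. f (ret x)) Om"
proof (rule analytic_fun_local)
  fix x assume "x \<in> Om"
  then obtain u v where u: "u \<in> W" "v \<in> V" "x = u v" by (auto simp: Om_def orbit_union_def)
  obtain u' where u': "u' \<in> W" "\<And>x. u (u' x) = x" "\<And>x. u' (u x) = x"
    by (rule W_inverse[OF u(1)]) blast
  have uV: "u' y \<in> V" "ret y = proj (u' y)" if y: "y \<in> u ` V" for y
  proof -
    obtain t where t: "t \<in> V" "y = u t" using y by blast
    show "u' y \<in> V" using t u' by simp
    show "ret y = proj (u' y)" using ret_eq[OF t(1) u(1)] t u' by simp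
  qed
  have "analytic_fun (\<lambda>y. f (proj y)) V"
    by (rule analytic_proj[OF f]) (simp add: V_def)
  then have "analytic_fun (\<lambda>y. f (proj (u' y))) (u ` V)"
    by (rule analytic_fun_compose_linear[OF _ W_linear[OF u'(1)] W_smult[OF u'(1)] uV(1)])
  then have "analytic_fun (\<lambda>y. f (ret y)) (u ` V)"
    by (rule analytic_fun_cong) (simp add: uV(2))
  then show "\<exists>T. open T \<and> x \<in> T \<and> analytic_fun (\<lambda>x. f (ret x)) (Om \<inter> T)"
    using W_image_open[OF u(1) open_V] u by (intro exI[of _ "u ` V"]) (auto intro: analytic_fun_subset)
qed

lemma invariant_extension_ret:
  assumes f: "analytic_fun f U"
  shows "invariant_extension R U f (\<lambda>x. f (ret x))"
  unfolding invariant_extension_def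
  by (intro exI[of _ V]) (use open_V U_V analytic_ret[OF f] ret_inv ret_U in \<open>auto simp: Om_def\<close>)

end

section \<open>Independence of the extension\<close>

context root_sys
begin

lemma polyfun_W:
  assumes F: "F \<in> polyfun" and w: "w \<in> W"
  shows "(\<lambda>z. F (w z)) \<in> polyfun"
proof (rule polyfun_compose[OF F])
  fix i
  obtain w' where w': "w' \<in> W" "\<And>x. w (w' x) = x" "\<And>x. w' (w x) = x"
    by (rule W_inverse[OF w]) blast
  have "w z $ i = bil (w' (axis i 1)) z" for z
    using W_bil[OF w'(1), of "axis i 1" "w z"] w'(3)[of z] by simp
  then have "(\<lambda>z. w z $ i) = (\<lambda>z. bil (w' (axis i 1)) z)" by (rule ext)
  then show "(\<lambda>z. w z $ i) \<in> polyfun" by (simp only: polyfun_bil)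
qed

lemma vord_orbit:
  assumes dom: "refl_dom \<Omega>" and x: "x \<in> \<Omega>" and inv: "\<And>w z. w \<in> W \<Longrightarrow> z \<in> \<Omega> \<Longrightarrow> g (w z) = g z"
    and v: "vord k g x" and y: "y \<in> orb x"
  shows "vord k g y"
proof -
  obtain u where u: "u \<in> W" "y = u x" using y by (auto simp: orb_def)
  obtain u' where u': "u' \<in> W" "\<And>x. u (u' x) = x" "\<And>x. u' (u x) = x"
    by (rule W_inverse[OF u(1)]) blast
  have "vord k (\<lambda>z. g (u' z)) y"
    using vord_linear_compose[of k g 0 u' y] W_linear[OF u'(1)] v u u' by simp
  then show ?thesis
    by (rule vord_cong[OF _ refl_dom_open[OF dom]]) (use inv[OF u'(1)] W_dom[OF u(1) dom x] u in auto)
qed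

definition avg :: "(complex^'n \<Rightarrow> complex) \<Rightarrow> complex^'n \<Rightarrow> complex" where
  "avg F z = (\<Sum>w\<in>W. F (w z))"

lemma polyfun_avg: "F \<in> polyfun \<Longrightarrow> avg F \<in> polyfun"
  unfolding avg_def[abs_def] by (rule polyfun_sum) (rule polyfun_W)

lemma avg_W:
  assumes u: "u \<in> W"
  shows "avg F (u z) = avg F z"
proof -
  obtain u' where u': "u' \<in> W" "\<And>x. u (u' x) = x" "\<And>x. u' (u x) = x"
    by (rule W_inverse[OF u]) blast
  have "bij_betw (\<lambda>w. w \<circ> u) W W"
    by (rule bij_betw_byWitness[of _ "\<lambda>w. w \<circ> u'"]) (use u u' W_comp in \<open>auto simp: fun_eq_iff\<close>)
  from sum.reindex_bij_betw[OF this, of "\<lambda>w. F (w z)"] show ?thesis by (simp add: avg_def)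
qed

end

context stratum
begin

text \<open>On the components of the stratum that miss \<open>x\<close> flatness is not enough:
  exact vanishing is asked for, because the averaged polynomial must lie in the ideal.\<close>

lemma stratum_bump:
  obtains q where "q \<in> polyfun" "vord (Suc k) (\<lambda>z. q z - 1) x"
    "\<And>y. y \<in> orb x \<Longrightarrow> y \<noteq> x \<Longrightarrow> vord (Suc k) q y"
    "\<And>w y. w \<in> W \<Longrightarrow> x \<notin> w ` P \<Longrightarrow> y \<in> w ` P \<Longrightarrow> q y = 0"
proof -
  define I where "I = (\<lambda>y. {y}) ` (orb x - {x}) \<union> (\<lambda>w. w ` P) ` {w \<in> W. x \<notin> w ` P}"
  have fin: "finite I" unfolding I_def using finite_orb finite_W by simp
  have sep: "\<exists>r\<in>polyfun. (\<forall>z\<in>i. r z = 0) \<and> r x \<noteq> 0" if i: "i \<in> I" for i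
  proof -
    consider y where "y \<noteq> x" "i = {y}" | w where "w \<in> W" "x \<notin> w ` P" "i = w ` P"
      using i unfolding I_def by blast
    then show ?thesis
    proof cases
      case 1
      obtain j where j: "y $ j \<noteq> x $ j" using 1(1) unfolding vec_eq_iff by blast
      have "(\<lambda>z. z $ j - y $ j) \<in> polyfun" by (intro polyfun_diff polyfun_const polyfun_coord)
      with j 1(2) show ?thesis by (intro bexI[of _ "\<lambda>z. z $ j - y $ j"]) auto
    next
      case 2
      obtain \<beta> where b: "\<beta> \<in> \<Gamma>" "bil (w \<beta>) x \<noteq> 0" using 2(2) mem_image_P[OF 2(1)] by blast
      show ?thesis
        by (rule bexI[of _ "\<lambda>z. bil (w \<beta>) z"]) (use b 2 mem_image_P[OF 2(1)] in \<open>auto simp: polyfun_bil\<close>)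
    qed
  qed
  show ?thesis
  proof (rule bump_polyfun[where I = I and Z = "\<lambda>i. i" and x = x and k = k, OF fin sep])
    fix q assume q: "q \<in> polyfun" "vord (Suc k) (\<lambda>z. q z - 1) x"
      "\<And>i y. i \<in> I \<Longrightarrow> y \<in> i \<Longrightarrow> vord (Suc k) q y" "\<And>i y. i \<in> I \<Longrightarrow> y \<in> i \<Longrightarrow> q y = 0"
    show thesis
    proof (rule that[OF q(1,2)])
      fix y assume "y \<in> orb x" "y \<noteq> x"
      then show "vord (Suc k) q y" by (intro q(3)[of "{y}"]) (auto simp: I_def)
    next
      fix w y assume "w \<in> W" "x \<notin> w ` P" "y \<in> w ` P"
      then show "q y = 0" by (intro q(4)[of "w ` P"]) (auto simp: I_def)
    qed
  qed
qed

definition stab :: "complex^'n \<Rightarrow> (complex^'n \<Rightarrow> complex^'n) set" where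
  "stab x = {w \<in> W. w x = x}"

lemma card_stab: "of_nat (card (stab x)) \<noteq> (0 :: complex)"
proof -
  have "id \<in> stab x" by (simp add: stab_def refl_group.id)
  moreover have "finite (stab x)" using finite_W by (simp add: stab_def)
  ultimately show ?thesis by (auto simp: card_eq_0_iff)
qed

text \<open>At \<open>x\<close> only the summands from the stabiliser survive to the given order,
  and each of them reproduces \<open>h\<close>; hence the division by
  \<open>card (stab x)\<close>.\<close>

lemma avg_jet:
  assumes dom: "refl_dom \<Omega>" and x: "x \<in> \<Omega>" and h: "analytic_fun h \<Omega>"
    and hinv: "\<And>w z. w \<in> W \<Longrightarrow> z \<in> \<Omega> \<Longrightarrow> h (w z) = h z"
    and q: "q \<in> polyfun" "vord (Suc k) (\<lambda>z. q z - 1) x" "\<And>y. y \<in> orb x \<Longrightarrow> y \<noteq> x \<Longrightarrow> vord (Suc k) q y"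
    and F: "F \<in> polyfun" "vord (Suc k) (\<lambda>z. h z - F z) x" and y: "y \<in> orb x"
  shows "vord (Suc k) (\<lambda>z. h z - avg (\<lambda>z. q z * F z) z / of_nat (card (stab x))) y"
proof -
  define p where "p z = avg (\<lambda>z. q z * F z) z / of_nat (card (stab x))" for z
  have S: "open \<Omega>" by (rule refl_dom_open[OF dom])
  have at_x: "vord (Suc k) (\<lambda>z. (if w \<in> stab x then h z else 0) - q (w z) * F (w z)) x" if w: "w \<in> W" for w
  proof (cases "w \<in> stab x")
    case True
    then have wx: "w x = x" by (simp add: stab_def)
    have "vord (0 + Suc k) (\<lambda>z. F z * (q z - 1)) x" by (intro vord_mult polyfun_vord0 F q)
    then have "vord (Suc k) (\<lambda>z. F z * (q z - 1)) x" by simp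
    from vord_diff[OF F(2) this] have "vord (Suc k) (\<lambda>z. h z - q z * F z) x"
      by (simp add: algebra_simps)
    then have "vord (Suc k) (\<lambda>z. h (w z) - q (w z) * F (w z)) x"
      using vord_linear_compose[of "Suc k" "\<lambda>z. h z - q z * F z" 0 w x] W_linear[OF w] wx by simp
    then show ?thesis
      by (rule vord_cong[OF _ S x]) (simp add: True hinv[OF w])
  next
    case False
    then have "w x \<noteq> x" using w by (simp add: stab_def)
    moreover have "w x \<in> orb x" using w by (auto simp: orb_def)
    ultimately have "vord (Suc k + 0) (\<lambda>z. q z * F z) (w x)"
      by (intro vord_mult q(3) polyfun_vord0 F)
    then have "vord (Suc k) (\<lambda>z. q (w z) * F (w z)) x"
      using vord_linear_compose[of "Suc k" "\<lambda>z. q z * F z" 0 w x] W_linear[OF w] by simp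
    from vord_cmult[OF this, of "-1"] show ?thesis using False by simp
  qed
  have "vord (Suc k) (\<lambda>z. 1 / of_nat (card (stab x)) *
      (\<Sum>w\<in>W. (if w \<in> stab x then h z else 0) - q (w z) * F (w z))) x"
    by (intro vord_cmult vord_sum at_x)
  moreover have "(\<Sum>w\<in>W. (if w \<in> stab x then h z else 0) - q (w z) * F (w z)) =
      of_nat (card (stab x)) * h z - avg (\<lambda>z. q z * F z) z" for z
  proof -
    have "(\<Sum>w\<in>W. if w \<in> stab x then h z else 0) = (\<Sum>w\<in>W \<inter> stab x. h z)"
      using sum.inter_restrict[OF finite_W, of "\<lambda>w. h z" "stab x"] by simp
    also have "W \<inter> stab x = stab x" by (auto simp: stab_def)
    finally show ?thesis by (simp add: sum_subtractf avg_def)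
  qed
  ultimately have px: "vord (Suc k) (\<lambda>z. h z - p z) x"
    using card_stab[of x] by (simp add: p_def diff_divide_distrib)
  have "vord (Suc k) (\<lambda>z. h z - p z) y"
    by (rule vord_orbit[OF dom x _ px y]) (simp add: hinv p_def avg_W)
  then show ?thesis by (simp add: p_def)
qed

lemma poly_deg_bound: "\<exists>d. \<forall>m\<in>Poly_Mapping.keys (\<sigma> :: 'n mpoly). sum_list (map (Poly_Mapping.lookup m) ixs) \<le> d"
  by (rule exI[of _ "\<Sum>m\<in>Poly_Mapping.keys \<sigma>. sum_list (map (Poly_Mapping.lookup m) ixs)"])
    (auto intro: member_le_sum)

lemma poly_dunkl_vanish:
  assumes dom: "refl_dom \<Omega>" and U: "U \<subseteq> \<Omega>" and h: "analytic_fun h \<Omega>"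
    and hinv: "\<And>w z. w \<in> W \<Longrightarrow> z \<in> \<Omega> \<Longrightarrow> h (w z) = h z"
    and h0: "\<And>u. u \<in> U \<Longrightarrow> h u = 0" and x: "x \<in> U"
  shows "pd \<sigma> h x = 0"
proof -
  have x\<Omega>: "x \<in> \<Omega>" using x U by blast
  obtain d where d: "\<And>m. m \<in> Poly_Mapping.keys \<sigma> \<Longrightarrow> sum_list (map (Poly_Mapping.lookup m) ixs) \<le> d"
    using poly_deg_bound[of \<sigma>] by blast
  obtain O' where O': "open O'" "U = P \<inter> O'" by (rule U_open)
  define S where "S = \<Omega> \<inter> O'"
  have S: "open S" "x \<in> S" using O' x x\<Omega> refl_dom_open[OF dom] by (auto simp: S_def)
  obtain T where T: "T \<in> polyfun" "vord (Suc d) (\<lambda>z. h z - T z) x"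
    and T0: "\<And>z. (\<And>t. x + t *s (z - x) \<in> S \<Longrightarrow> h (x + t *s (z - x)) = 0) \<Longrightarrow> T z = 0"
    by (rule Taylor_polyfun[OF S(1) analytic_fun_subset[OF h] S(2), where k = "Suc d"]) (auto simp: S_def)
  \<comment> \<open>Lines from \<open>x\<close> to points of \<open>P\<close> stay in
    \<open>P\<close>, and \<open>h\<close> vanishes on the part of \<open>P\<close> inside
    \<open>S\<close>.\<close>
  have TP: "T z = 0" if z: "z \<in> P" for z
  proof (rule T0)
    fix t assume "x + t *s (z - x) \<in> S"
    moreover have "x + t *s (z - x) \<in> P" using z x U_P by (intro P_add P_smult P_diff) auto
    ultimately show "h (x + t *s (z - x)) = 0" using O' by (intro h0) (auto simp: S_def)
  qed
  obtain q where q: "q \<in> polyfun" "vord (Suc d) (\<lambda>z. q z - 1) x"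
    "\<And>y. y \<in> orb x \<Longrightarrow> y \<noteq> x \<Longrightarrow> vord (Suc d) q y"
    "\<And>w y. w \<in> W \<Longrightarrow> x \<notin> w ` P \<Longrightarrow> y \<in> w ` P \<Longrightarrow> q y = 0"
    by (rule stratum_bump[where k = d and x = x]) blast
  \<comment> \<open>It has the jet of \<open>h\<close> on the orbit of \<open>x\<close> by
    \<open>avg_jet\<close>, and \<open>TP\<close> together with the zeros of \<open>q\<close> puts
    it into the ideal.\<close>
  define p where "p z = avg (\<lambda>z. q z * T z) z / of_nat (card (stab x))" for z
  have p: "p \<in> polyfun"
    using polyfun_mult[OF polyfun_const[of "1 / of_nat (card (stab x))"] polyfun_avg[OF polyfun_mult[OF q(1) T(1)]]]
    by (simp add: p_def[abs_def])
  have "p y = 0" if y: "y \<in> orbit_union R P" for y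
  proof -
    obtain u z where u: "u \<in> W" "z \<in> P" "y = u z" using y by (auto simp: orbit_union_def)
    \<comment> \<open>If the component through \<open>w y\<close> contains \<open>x\<close>, it
      equals \<open>P\<close> and \<open>T\<close> vanishes on it; otherwise \<open>q\<close>
      does.\<close>
    have "q (w y) * T (w y) = 0" if w: "w \<in> W" for w
    proof (cases "x \<in> (w \<circ> u) ` P")
      case True
      then have "(w \<circ> u) ` P = P" by (rule U_mirror_image[OF x W_comp[OF w u(1)]])
      then have "w y \<in> P" using u by auto
      then show ?thesis by (simp add: TP)
    next
      case False
      then show ?thesis using q(4)[OF W_comp[OF w u(1)] False, of "w y"] u by auto
    qed
    then show ?thesis by (simp add: p_def avg_def sum.neutral)
  qed
  then have "p \<in> vanishing_ideal (orbit_union R P)"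
    using p by (simp add: vanishing_ideal_def polyfun_def)
  then have "pd \<sigma> p \<in> vanishing_ideal (orbit_union R P)"
    using ideal poly_dunkl_cherednik unfolding cherednik_invariant_def by blast
  moreover have "x \<in> orbit_union R P" using x U_P sub_orbit_union by blast
  ultimately have px: "pd \<sigma> p x = 0" by (simp add: vanishing_ideal_def)
  have hp: "analytic_fun (\<lambda>z. h z - p z) \<Omega>" by (intro analytic_fun_diff h analytic_fun_polyfun p)
  have "vord (Suc d) (\<lambda>z. h z - p z) y" if "y \<in> orb x" for y
    unfolding p_def by (rule avg_jet[OF dom x\<Omega> h _ q(1,2) _ T that]) (auto intro: hinv q(3))
  then have "vord (1 + d) (\<lambda>z. h z - p z) y" if "y \<in> orb x" for y using that by simp
  from poly_dunkl_vord[where \<sigma> = \<sigma>, OF dom x\<Omega> hp d this orb_self]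
  have "pd \<sigma> (\<lambda>z. h z - p z) x = 0" using vord_Suc_zero[of 0] by simp
  then show ?thesis
    using poly_dunkl_diff[OF dom h analytic_fun_polyfun[OF p] x\<Omega>, of \<sigma>] px by simp
qed

text \<open>The extension chosen by \<open>SOME\<close> has a domain of its own. On the orbit of the
  common neighbourhood \<open>V \<inter> V1\<close> it can be compared with \<open>G\<close>; the
  difference is invariant and vanishes on \<open>U\<close>.\<close>

lemma restr_poly_dunkl:
  assumes f: "analytic_fun f U" and G: "analytic_fun G Om"
    and Ginv: "\<And>w z. w \<in> W \<Longrightarrow> z \<in> Om \<Longrightarrow> G (w z) = G z"
    and eq: "\<And>u. u \<in> U \<Longrightarrow> G u = f u" and x: "x \<in> U"
  shows "restr_op R U (pd \<sigma>) f x = pd \<sigma> G x"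
proof -
  define g where "g = (SOME g. invariant_extension R U f g)"
  have "invariant_extension R U f g"
    unfolding g_def by (rule someI[of "invariant_extension R U f"]) (rule invariant_extension_ret[OF f])
  then obtain V1 where V1: "open V1" "U \<subseteq> V1" "analytic_fun g (orbit_union R V1)"
    "\<And>w x. w \<in> W \<Longrightarrow> x \<in> orbit_union R V1 \<Longrightarrow> g (w x) = g x" "\<And>u. u \<in> U \<Longrightarrow> g u = f u"
    unfolding invariant_extension_def by blast
  define \<Omega> where "\<Omega> = orbit_union R (V \<inter> V1)"
  have sub: "\<Omega> \<subseteq> Om" "\<Omega> \<subseteq> orbit_union R V1" by (auto simp: \<Omega>_def Om_def orbit_union_def)
  have dom: "refl_dom \<Omega>" unfolding \<Omega>_def by (intro orbit_union_dom open_Int open_V V1)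
  have U: "U \<subseteq> \<Omega>" using sub_orbit_union[of "V \<inter> V1"] U_V V1 by (auto simp: \<Omega>_def)
  have an: "analytic_fun g \<Omega>" "analytic_fun G \<Omega>"
    using analytic_fun_subset[OF V1(3) sub(2)] analytic_fun_subset[OF G sub(1)] .
  have "pd \<sigma> (\<lambda>z. g z - G z) x = 0"
    by (rule poly_dunkl_vanish[OF dom U analytic_fun_diff[OF an] _ _ x])
      (use sub V1 Ginv eq in \<open>auto simp: subset_iff\<close>)
  then show ?thesis
    using poly_dunkl_diff[OF dom an, of x \<sigma>] x U by (auto simp: restr_op_def g_def)
qed

end

section \<open>The restricted Laplacian\<close>

definition sq_poly :: "'n::finite mpoly" where
  "sq_poly = (\<Sum>i\<in>UNIV. Poly_Mapping.single (Poly_Mapping.single i 2) 1)"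

lemma poly_eval_sq_poly: "poly_eval sq_poly x = bil x x"
  by (simp add: sq_poly_def poly_eval_eq_peval peval_sum bil_def power2_eq_square)

lemma dunkl_laplacian_eq: "dunkl_laplacian Rp c = poly_dunkl Rp (c :: complex^'n \<Rightarrow> complex) sq_poly"
proof (intro ext)
  fix f :: "complex^'n \<Rightarrow> complex" and x
  have "Poly_Mapping.lookup (Poly_Mapping.single i (2::nat)) = (\<lambda>j. if j = i then 2 else 0)" for i :: 'n
    by (auto simp: lookup_single when_def)
  then show "dunkl_laplacian Rp c f x = poly_dunkl Rp c sq_poly f x"
    by (simp add: poly_dunkl_eq op_poly_eq sq_poly_def lin_ext_sum dunkl_laplacian_def
        op_monom_delta[OF ixs(1)] ixs(2) numeral_2_eq_2)
qed

lemma sum_coord_orthonormal: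
  assumes "\<And>i j. i < n \<Longrightarrow> j < n \<Longrightarrow> bil (e i) (e j) = (if i = j then 1 else 0)"
  shows "(\<Sum>k\<in>UNIV. \<Sum>i<n. \<Sum>j<n. e i $ k * (e j $ k * D i j)) = (\<Sum>i<(n::nat). D i i)"
proof -
  have "(\<Sum>k\<in>UNIV. \<Sum>i<n. \<Sum>j<n. e i $ k * (e j $ k * D i j)) = (\<Sum>i<n. \<Sum>k\<in>UNIV. \<Sum>j<n. e i $ k * (e j $ k * D i j))"
    by (rule sum.swap)
  also have "\<dots> = (\<Sum>i<n. \<Sum>j<n. \<Sum>k\<in>UNIV. e i $ k * (e j $ k * D i j))"
    by (intro sum.cong HOL.refl sum.swap)
  also have "\<dots> = (\<Sum>i<n. \<Sum>j<n. bil (e i) (e j) * D i j)"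
    by (simp add: bil_def sum_distrib_right mult.assoc)
  also have "\<dots> = (\<Sum>i<n. \<Sum>j<n. if i = j then D i j else 0)"
    by (intro sum.cong HOL.refl) (simp add: assms)
  finally show ?thesis by (simp add: sum.delta)
qed

context dunkl_data
begin

lemma invariant_dderiv_refl:
  assumes dom: "refl_dom \<Omega>" and g: "analytic_fun g \<Omega>" and inv: "\<And>z. z \<in> \<Omega> \<Longrightarrow> g (refl \<alpha> z) = g z"
    and a: "\<alpha> \<in> R" and z: "z \<in> \<Omega>"
  shows "dderiv \<alpha> g (refl \<alpha> z) = - dderiv \<alpha> g z"
proof -
  have "dderiv \<alpha> g z = dderiv \<alpha> (\<lambda>z. g (refl \<alpha> z)) z"
    by (rule dderiv_cong_open[OF refl_dom_open[OF dom] z]) (simp add: inv)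
  also have "\<dots> = dderiv (refl \<alpha> \<alpha>) g (refl \<alpha> z)"
    using dderiv_linear_compose[of "refl \<alpha>" \<alpha> g 0 z] by (simp add: refl_add refl_smult)
  also have "\<dots> = dderiv ((-1) *s \<alpha>) g (refl \<alpha> z)"
    by (simp add: refl_self[OF bil_root[OF a]] vec.scale_minus_left)
  also have "\<dots> = - dderiv \<alpha> g (refl \<alpha> z)"
    using dderiv_smult_dir[OF refl_dom_open[OF dom] g refl_dom_refl[OF dom a z], of "-1" \<alpha>] by simp
  finally show ?thesis by simp
qed

text \<open>Off a mirror the numerator of the quotient vanishes; on a mirror the normal derivative
  of an invariant function is odd, hence zero.\<close>

lemma dunkl_invariant:
  assumes dom: "refl_dom \<Omega>" and g: "analytic_fun g \<Omega>"
    and inv: "\<And>w z. w \<in> W \<Longrightarrow> z \<in> \<Omega> \<Longrightarrow> g (w z) = g z" and z: "z \<in> \<Omega>"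
  shows "dk \<xi> g z = dderiv \<xi> g z"
proof -
  have "refl_quotient \<alpha> g z = 0" if "\<alpha> \<in> Rp" for \<alpha>
  proof -
    have a: "\<alpha> \<in> R" by (rule Rp_R[OF that])
    note inv' = inv[OF refl_in_W[OF a]]
    have "dderiv \<alpha> g z = 0" if "bil \<alpha> z = 0"
      using invariant_dderiv_refl[OF dom g inv' a z] refl_fixed[OF that] by simp
    then show ?thesis by (simp add: refl_quotient_eq[OF dom g a z] inv'[OF z])
  qed
  then show ?thesis by (simp add: dunkl_def)
qed

end

context stratum
begin

lemma dderiv_proj: "dderiv \<xi> (\<lambda>z. f (proj z)) x = dderiv (proj \<xi>) f (proj x)"
  using dderiv_linear_compose[of proj \<xi> f 0 x] by (simp add: proj_add proj_smult)

lemma dderiv_on_P: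
  assumes "p \<in> P" "v \<in> P" "\<And>q. q \<in> P \<Longrightarrow> f q = g q"
  shows "dderiv v f p = dderiv v g p"
  unfolding dderiv_def using assms by (intro arg_cong2[where f = deriv] ext assms(3) P_add P_smult HOL.refl)

lemma dderiv_zero_dir [simp]: "dderiv 0 f x = 0"
  by (simp add: dderiv_def)

text \<open>By genericity the roots with nonzero projection are nonzero everywhere on
  \<open>U\<close>, so the denominators of the potential make sense.\<close>

lemma proj_eq_0_iff:
  assumes x: "x \<in> U" and a: "\<alpha> \<in> R"
  shows "proj \<alpha> = 0 \<longleftrightarrow> bil \<alpha> x = 0"
proof
  assume "proj \<alpha> = 0"
  then show "bil \<alpha> x = 0" using bil_proj[of x \<alpha>] x U_P by auto
next
  assume "bil \<alpha> x = 0"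
  then have "bil (e i) \<alpha> = 0" if "i < n" for i
    using U_generic[OF x a _ e_P[OF that]] by (simp add: bil_commute[of "e i"])
  then show "proj \<alpha> = 0" by (simp add: proj_def)
qed

text \<open>On an invariant function the inner Dunkl operator is a plain derivative, so only the
  outer one contributes quotients.\<close>

lemma laplacian_ret:
  assumes f: "analytic_fun f U" and x: "x \<in> U"
  shows "dunkl_laplacian Rp c (\<lambda>z. f (ret z)) x =
    (\<Sum>i<n. dderiv (e i) (dderiv (e i) f) x) -
    (\<Sum>\<alpha>\<in>{\<alpha>\<in>Rp. proj \<alpha> \<noteq> 0}. 2 * c \<alpha> / bil (proj \<alpha>) x * dderiv (proj \<alpha>) f x)"
proof -
  define g where "g z = f (ret z)" for z
  define F where "F z = f (proj z)" for z
  have g: "analytic_fun g Om" unfolding g_def[abs_def] by (rule analytic_ret[OF f])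
  have F: "analytic_fun F V" unfolding F_def[abs_def] by (rule analytic_proj[OF f]) (simp add: V_def)
  have ginv: "g (w z) = g z" if "w \<in> W" "z \<in> Om" for w z using that by (simp add: g_def ret_inv)
  have gF: "g z = F z" if "z \<in> V" for z using that by (simp add: g_def F_def ret_V)
  have xV: "x \<in> V" and xO: "x \<in> Om" and xP: "x \<in> P" and px: "proj x = x"
    using x U_V U_Om U_P proj_id by auto
  have dg: "dderiv \<xi> g z = dderiv (proj \<xi>) f (proj z)" if "z \<in> V" for \<xi> z
    using dderiv_cong_open[OF open_V that gF, where \<xi> = \<xi>] by (simp add: F_def[abs_def] dderiv_proj)
  have ddg: "dderiv \<eta> (dderiv \<xi> g) x = dderiv (proj \<eta>) (dderiv (proj \<xi>) f) x" for \<xi> \<eta>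
    using dderiv_cong_open[OF open_V xV dg[of _ \<xi>], where \<xi> = \<eta>] dderiv_proj[of \<eta> "dderiv (proj \<xi>) f" x] by (simp add: px)
  \<comment> \<open>\<open>F\<close> agrees with \<open>f\<close> on \<open>P\<close>, so
    derivatives along \<open>P\<close> coincide; unlike \<open>f\<close> it is analytic on an open
    set, where the rules for \<open>dderiv\<close> apply.\<close>
  have dfF: "dderiv v f q = dderiv v F q" if "v \<in> P" "q \<in> P" for v q
    by (rule dderiv_on_P[OF that(2,1)]) (simp add: F_def proj_id)
  have ddfF: "dderiv v (dderiv u f) x = dderiv v (dderiv u F) x" if "v \<in> P" "u \<in> P" for u v
    by (rule dderiv_on_P[OF xP that(1)]) (simp add: dfF that)
  have second: "dderiv (axis k 1) (dderiv (axis k 1) g) x =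
      (\<Sum>i<n. \<Sum>j<n. e i $ k * (e j $ k * dderiv (e i) (dderiv (e j) F) x))" for k
  proof -
    define v where "v = (\<Sum>j<n. e j $ k *s e j)"
    have v: "proj (axis k 1) = v" by (simp add: proj_def v_def)
    have "v \<in> P" unfolding v_def by (intro P_sum P_smult e_P) simp
    then have "dderiv (axis k 1) (dderiv (axis k 1) g) x = dderiv v (dderiv v F) x"
      by (simp add: ddg v ddfF)
    also have "\<dots> = dderiv v (\<lambda>z. \<Sum>j<n. e j $ k * dderiv (e j) F z) x"
      by (rule dderiv_cong_open[OF open_V xV]) (simp add: v_def dderiv_sum_dir[OF open_V F])
    also have "\<dots> = (\<Sum>j<n. dderiv v (\<lambda>z. e j $ k * dderiv (e j) F z) x)"
      by (rule dderiv_sum[OF open_V _ xV]) (intro analytic_fun_cmult analytic_fun_dderiv open_V F)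
    also have "\<dots> = (\<Sum>j<n. e j $ k * dderiv v (dderiv (e j) F) x)"
      by (rule sum.cong[OF HOL.refl], rule dderiv_cmult[OF open_V analytic_fun_dderiv[OF open_V F] xV])
    also have "\<dots> = (\<Sum>j<n. e j $ k * (\<Sum>i<n. e i $ k * dderiv (e i) (dderiv (e j) F) x))"
      unfolding v_def by (simp add: dderiv_sum_dir[OF open_V analytic_fun_dderiv[OF open_V F] xV])
    also have "\<dots> = (\<Sum>j<n. \<Sum>i<n. e i $ k * (e j $ k * dderiv (e i) (dderiv (e j) F) x))"
      by (simp add: sum_distrib_left mult.left_commute)
    also have "\<dots> = (\<Sum>i<n. \<Sum>j<n. e i $ k * (e j $ k * dderiv (e i) (dderiv (e j) F) x))"
      by (rule sum.swap)
    finally show ?thesis .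
  qed
  \<comment> \<open>For a function constant in the normal directions the ambient Laplacian contracts
    to that of the stratum, by orthonormality of \<open>e\<close>.\<close>
  have "(\<Sum>k\<in>UNIV. dderiv (axis k 1) (dderiv (axis k 1) g) x) =
      (\<Sum>i<n. dderiv (e i) (dderiv (e i) F) x)"
    unfolding second by (rule sum_coord_orthonormal) (rule e_orth)
  also have "\<dots> = (\<Sum>i<n. dderiv (e i) (dderiv (e i) f) x)"
    by (rule sum.cong) (simp_all add: ddfF e_P)
  finally have A: "(\<Sum>k\<in>UNIV. dderiv (axis k 1) (dderiv (axis k 1) g) x) =
      (\<Sum>i<n. dderiv (e i) (dderiv (e i) f) x)" .
  have dgO: "analytic_fun (dderiv \<xi> g) Om" for \<xi>
    by (rule analytic_fun_dderiv[OF refl_dom_open[OF dom_Om] g])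
  have B: "(\<Sum>k\<in>UNIV. \<alpha> $ k * refl_quotient \<alpha> (dderiv (axis k 1) g) x) =
      (if proj \<alpha> \<noteq> 0 then 2 / bil (proj \<alpha>) x * dderiv (proj \<alpha>) f x else 0)" if "\<alpha> \<in> Rp" for \<alpha>
  proof -
    have a: "\<alpha> \<in> R" by (rule Rp_R[OF that])
    have sum: "(\<Sum>k\<in>UNIV. \<alpha> $ k * dderiv (axis k 1) g z) = dderiv \<alpha> g z" if "z \<in> Om" for z
      by (rule dderiv_eq_sum[OF refl_dom_open[OF dom_Om] g that, symmetric])
    show ?thesis
    proof (cases "proj \<alpha> = 0")
      case True
      \<comment> \<open>On its mirror the quotient is a derivative in a root direction; this
        direction projects to 0, where nothing varies.\<close>
      then have "refl_quotient \<alpha> (dderiv (axis k 1) g) x = 0" for k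
        using proj_eq_0_iff[OF x a] by (simp add: refl_quotient_eq[OF dom_Om dgO a xO] ddg)
      then show ?thesis using True by simp
    next
      case False
      then have nz: "bil \<alpha> x \<noteq> 0" using proj_eq_0_iff[OF x a] by simp
      have "(\<Sum>k\<in>UNIV. \<alpha> $ k * refl_quotient \<alpha> (dderiv (axis k 1) g) x) =
          ((\<Sum>k\<in>UNIV. \<alpha> $ k * dderiv (axis k 1) g x) -
            (\<Sum>k\<in>UNIV. \<alpha> $ k * dderiv (axis k 1) g (refl \<alpha> x))) / bil \<alpha> x"
        by (simp add: refl_quotient_eq[OF dom_Om dgO a xO] nz sum_subtractf[symmetric]
            sum_divide_distrib right_diff_distrib)
      also have "\<dots> = (dderiv \<alpha> g x - dderiv \<alpha> g (refl \<alpha> x)) / bil \<alpha> x"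
        by (simp add: sum xO refl_dom_refl[OF dom_Om a xO])
      \<comment> \<open>The derivative of an invariant function along a root is odd under the
        reflection: the origin of the factor 2.\<close>
      also have "\<dots> = 2 * dderiv \<alpha> g x / bil \<alpha> x"
        using invariant_dderiv_refl[OF dom_Om g ginv[OF refl_in_W[OF a]] a xO] by simp
      finally show ?thesis using False by (simp add: dg[OF xV] px bil_proj[OF xP])
    qed
  qed
  have di: "dk \<xi> g z = dderiv \<xi> g z" if "z \<in> Om" for \<xi> z
    by (rule dunkl_invariant[OF dom_Om g _ that]) (rule ginv)
  have "dunkl_laplacian Rp c g x = (\<Sum>k\<in>UNIV. dk (axis k 1) (dderiv (axis k 1) g) x)"
    unfolding dunkl_laplacian_def
    by (rule sum.cong[OF HOL.refl], rule dunkl_cong[OF dom_Om dunkl_analytic[OF dom_Om g] _ xO])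
      (rule di)
  also have "\<dots> = (\<Sum>k\<in>UNIV. dderiv (axis k 1) (dderiv (axis k 1) g) x) -
      (\<Sum>k\<in>UNIV. \<Sum>\<alpha>\<in>Rp. c \<alpha> * (\<alpha> $ k * refl_quotient \<alpha> (dderiv (axis k 1) g) x))"
    by (simp add: dunkl_def sum_subtractf mult.assoc)
  also have "(\<Sum>k\<in>UNIV. \<Sum>\<alpha>\<in>Rp. c \<alpha> * (\<alpha> $ k * refl_quotient \<alpha> (dderiv (axis k 1) g) x)) =
      (\<Sum>\<alpha>\<in>Rp. c \<alpha> * (\<Sum>k\<in>UNIV. \<alpha> $ k * refl_quotient \<alpha> (dderiv (axis k 1) g) x))"
    by (subst sum.swap) (simp add: sum_distrib_left)
  also have "\<dots> = (\<Sum>\<alpha>\<in>Rp. if proj \<alpha> \<noteq> 0 then 2 * c \<alpha> / bil (proj \<alpha>) x * dderiv (proj \<alpha>) f x else 0)"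
    by (rule sum.cong) (simp_all add: B)
  also have "\<dots> = (\<Sum>\<alpha>\<in>{\<alpha>\<in>Rp. proj \<alpha> \<noteq> 0}. 2 * c \<alpha> / bil (proj \<alpha>) x * dderiv (proj \<alpha>) f x)"
    by (simp only: sum.inter_filter[OF finite_Rp])
  finally show ?thesis unfolding A unfolding g_def .
qed

lemma invariant_sq_poly: "invariant_poly R sq_poly"
  by (simp add: invariant_poly_def poly_eval_sq_poly W_bil)

lemma restr_laplacian:
  assumes f: "analytic_fun f U" and x: "x \<in> U"
  shows "restr_op R U (dunkl_laplacian Rp c) f x =
    (\<Sum>i<n. dderiv (e i) (dderiv (e i) f) x) -
    (\<Sum>\<alpha>\<in>{\<alpha>\<in>Rp. orth_proj P \<alpha> \<noteq> 0}. 2 * c \<alpha> / bil (orth_proj P \<alpha>) x * dderiv (orth_proj P \<alpha>) f x)"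
  unfolding orth_proj_eq laplacian_ret[OF f x, symmetric] dunkl_laplacian_eq
  by (rule restr_poly_dunkl[OF f analytic_ret[OF f] _ _ x]) (simp_all add: ret_inv ret_U)

end

section \<open>Restrictions are differential operators\<close>

lemma op_monom_dderiv:
  assumes S: "open S" and F: "analytic_fun F S"
  shows "analytic_fun (op_monom ks (\<lambda>i. dderiv (e i)) m F) S"
    and "x \<in> S \<Longrightarrow> vord (k + sum_list (map m ks)) F x \<Longrightarrow> vord k (op_monom ks (\<lambda>i. dderiv (e i)) m F) x"
proof -
  have pow: "vord k ((dderiv \<xi> ^^ j) F) x" if "analytic_fun F S" "x \<in> S" "vord (k + j) F x" for F j k \<xi> x
    using that
  proof (induction j arbitrary: k)
    case (Suc j)
    have "vord (Suc k) ((dderiv \<xi> ^^ j) F) x" using Suc.IH[of "Suc k"] Suc.prems by simp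
    then show ?case
      using vord_dderiv[OF S analytic_fun_iter[OF S Suc.prems(1)] Suc.prems(2)] by simp
  qed simp
  show "analytic_fun (op_monom ks (\<lambda>i. dderiv (e i)) m F) S"
    using F
  proof (induction ks arbitrary: F)
    case (Cons i ks)
    show ?case unfolding op_monom_Cons by (rule Cons.IH[OF analytic_fun_iter[OF S Cons.prems]])
  qed simp
  show "vord k (op_monom ks (\<lambda>i. dderiv (e i)) m F) x"
    if "x \<in> S" "vord (k + sum_list (map m ks)) F x"
    using F that
  proof (induction ks arbitrary: F)
    case (Cons i ks)
    have "vord (k + sum_list (map m ks)) ((dderiv (e i) ^^ m i) F) x"
      by (rule pow[OF Cons.prems(1,2)]) (use Cons.prems(3) in \<open>simp add: add_ac\<close>)
    then show ?case unfolding op_monom_Cons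
      by (rule Cons.IH[OF analytic_fun_iter[OF S Cons.prems(1)] Cons.prems(2)])
  qed simp
qed

lemma op_monom_dderiv_cong:
  assumes S: "open S" and x: "x \<in> S" and eq: "\<And>y. y \<in> S \<Longrightarrow> F y = G y"
  shows "op_monom ks (\<lambda>i. dderiv (e i)) m F x = op_monom ks (\<lambda>i. dderiv (e i)) m G x"
  using eq
proof (induction ks arbitrary: F G)
  case (Cons i ks)
  show ?case unfolding op_monom_Cons
    by (rule Cons.IH) (rule dderiv_iter_cong[OF S _ Cons.prems])
qed (use x in simp)

lemma op_monom_dderiv_sum:
  assumes S: "open S" and F: "\<And>i. i \<in> I \<Longrightarrow> analytic_fun (F i) S" and x: "x \<in> S"
  shows "op_monom ks (\<lambda>i. dderiv (e i)) m (\<lambda>y. \<Sum>i\<in>I. a i * F i y) x =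
    (\<Sum>i\<in>I. a i * op_monom ks (\<lambda>i. dderiv (e i)) m (F i) x)"
  using F
proof (induction ks arbitrary: F)
  case (Cons j ks)
  have "op_monom (j # ks) (\<lambda>i. dderiv (e i)) m (\<lambda>y. \<Sum>i\<in>I. a i * F i y) x =
      op_monom ks (\<lambda>i. dderiv (e i)) m (\<lambda>y. \<Sum>i\<in>I. a i * (dderiv (e j) ^^ m j) (F i) y) x"
    unfolding op_monom_Cons by (rule op_monom_dderiv_cong[OF S x]) (rule dderiv_iter_sum[OF S Cons.prems])
  also have "\<dots> = (\<Sum>i\<in>I. a i * op_monom ks (\<lambda>i. dderiv (e i)) m ((dderiv (e j) ^^ m j) (F i)) x)"
    by (rule Cons.IH) (rule analytic_fun_iter[OF S Cons.prems])
  finally show ?case by (simp add: op_monom_Cons)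
qed simp

section \<open>Centred monomials on the stratum and their derivatives\<close>

definition falling :: "nat \<Rightarrow> nat \<Rightarrow> nat" where "falling a k = (\<Prod>l<k. a - l)"

lemma falling_Suc: "falling a (Suc k) = falling a k * (a - k)"
  by (simp add: falling_def)

lemma falling_self: "falling a a = fact a"
  by (simp add: falling_def fact_prod_rev lessThan_atLeast0)

lemma falling_zero: "a < k \<Longrightarrow> falling a k = 0"
  unfolding falling_def by (rule prod_zero) auto

context stratum
begin

definition mon :: "(nat \<Rightarrow> nat) \<Rightarrow> complex^'n \<Rightarrow> complex^'n \<Rightarrow> complex" where
  "mon m x y = (\<Prod>i<n. (bil (e i) y - bil (e i) x) ^ m i)"

lemma analytic_mon: "analytic_fun (mon m x) S"
  unfolding mon_def[abs_def]
  by (intro analytic_fun_prod analytic_fun_power analytic_fun_diff analytic_fun_bil analytic_fun_const)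

lemma mon_proj: "mon m x (proj y) = mon m x y"
  by (simp add: mon_def bil_e_proj)

text \<open>For \<open>m i = 0\<close> the subtraction in the exponent truncates, but then the
  coefficient is zero.\<close>

lemma dderiv_mon:
  assumes i: "i < n"
  shows "dderiv (e i) (\<lambda>y. a * mon m x y) y = a * of_nat (m i) * mon (m(i := m i - 1)) x y"
proof -
  define K where "K = (\<Prod>j\<in>{..<n} - {i}. (bil (e j) y - bil (e j) x) ^ m j)"
  define s where "s = bil (e i) y - bil (e i) x"
  have split: "(\<Prod>j<n. h j) = h i * (\<Prod>j\<in>{..<n} - {i}. h j)" for h :: "nat \<Rightarrow> complex"
    using i by (intro prod.remove) auto
  have "mon m x (y + t *s e i) = (s + t) ^ m i * K" for t
  proof -
    have "(\<Prod>j\<in>{..<n} - {i}. (bil (e j) (y + t *s e i) - bil (e j) x) ^ m j) = K"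
      unfolding K_def by (rule prod.cong) (use i in \<open>auto simp: bil_simps e_orth\<close>)
    then show ?thesis unfolding mon_def split
      using i by (simp add: bil_simps e_orth s_def algebra_simps)
  qed
  then have "dderiv (e i) (\<lambda>y. a * mon m x y) y = deriv (\<lambda>t. a * ((s + t) ^ m i * K)) 0"
    by (simp add: dderiv_def)
  also have "\<dots> = a * of_nat (m i) * (s ^ (m i - 1) * K)"
    by (rule DERIV_imp_deriv) (auto intro!: derivative_eq_intros)
  also have "s ^ (m i - 1) * K = mon (m(i := m i - 1)) x y"
    unfolding mon_def split by (simp add: s_def K_def)
  finally show ?thesis .
qed

lemma dderiv_iter_mon:
  assumes i: "i < n"
  shows "(dderiv (e i) ^^ k) (\<lambda>y. a * mon m x y) =
    (\<lambda>y. a * of_nat (falling (m i) k) * mon (m(i := m i - k)) x y)"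
proof (induction k)
  case (Suc k)
  show ?case
  proof
    fix y
    have "(dderiv (e i) ^^ Suc k) (\<lambda>y. a * mon m x y) y =
        dderiv (e i) (\<lambda>y. a * of_nat (falling (m i) k) * mon (m(i := m i - k)) x y) y"
      by (simp only: Suc funpow.simps o_apply)
    also have "\<dots> = a * of_nat (falling (m i) k) * of_nat ((m(i := m i - k)) i) *
        mon ((m(i := m i - k))(i := (m(i := m i - k)) i - 1)) x y"
      by (rule dderiv_mon[OF i])
    finally show "(dderiv (e i) ^^ Suc k) (\<lambda>y. a * mon m x y) y =
        a * of_nat (falling (m i) (Suc k)) * mon (m(i := m i - Suc k)) x y"
      by (simp add: falling_Suc)
  qed
qed (simp add: falling_def)

lemma op_monom_mon:
  assumes "distinct ks" "set ks \<subseteq> {..<n}"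
  shows "op_monom ks (\<lambda>i. dderiv (e i)) \<mu> (\<lambda>y. a * mon m x y) =
    (\<lambda>y. a * of_nat (\<Prod>i\<in>set ks. falling (m i) (\<mu> i)) * mon (\<lambda>i. if i \<in> set ks then m i - \<mu> i else m i) x y)"
  using assms
proof (induction ks arbitrary: a m)
  case (Cons k ks)
  have k: "k < n" "k \<notin> set ks" and d: "distinct ks" "set ks \<subseteq> {..<n}" using Cons.prems by auto
  have 1: "(\<Prod>i\<in>set ks. falling ((m(k := m k - \<mu> k)) i) (\<mu> i)) = (\<Prod>i\<in>set ks. falling (m i) (\<mu> i))"
    using k by (intro prod.cong) auto
  have 2: "(\<lambda>i. if i \<in> set ks then (m(k := m k - \<mu> k)) i - \<mu> i else (m(k := m k - \<mu> k)) i) =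
      (\<lambda>i. if i \<in> set (k # ks) then m i - \<mu> i else m i)"
    using k by auto
  have IH: "op_monom ks (\<lambda>i. dderiv (e i)) \<mu> (\<lambda>y. a' * mon (m(k := m k - \<mu> k)) x y) =
    (\<lambda>y. a' * of_nat (\<Prod>i\<in>set ks. falling (m i) (\<mu> i)) *
      mon (\<lambda>i. if i \<in> set (k # ks) then m i - \<mu> i else m i) x y)" for a'
    using Cons.IH[OF d, of a' "m(k := m k - \<mu> k)"] unfolding 1 2 .
  show ?case
    unfolding op_monom_Cons dderiv_iter_mon[OF k(1)] IH using k by (simp add: mult.assoc)
qed simp

text \<open>Up to factorials, centred monomials and derivatives at the centre are dual bases; this
  determines the coefficients in \<open>diff_op_restr\<close>.\<close>

lemma op_monom_mon_center:
  assumes "\<And>i. n \<le> i \<Longrightarrow> m i = 0" "\<And>i. n \<le> i \<Longrightarrow> \<mu> i = 0"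
  shows "op_monom [0..<n] (\<lambda>i. dderiv (e i)) \<mu> (mon m x) x = (if m = \<mu> then \<Prod>i<n. fact (\<mu> i) else 0)"
proof -
  have eq: "op_monom [0..<n] (\<lambda>i. dderiv (e i)) \<mu> (mon m x) x =
      of_nat (\<Prod>i<n. falling (m i) (\<mu> i)) * mon (\<lambda>i. if i < n then m i - \<mu> i else m i) x x"
    using op_monom_mon[of "[0..<n]" \<mu> 1 m x] by (auto simp: lessThan_atLeast0)
  show ?thesis
  proof (cases "m = \<mu>")
    case True
    have "mon (\<lambda>i. if i < n then m i - \<mu> i else m i) x x = 1" using True by (simp add: mon_def)
    then show ?thesis using eq True by (simp add: falling_self)
  next
    case False
    then obtain i where i: "m i \<noteq> \<mu> i" by auto
    then have n: "i < n" using assms by (metis not_le_imp_less)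
    have "(\<Prod>i<n. falling (m i) (\<mu> i)) = 0 \<or> mon (\<lambda>i. if i < n then m i - \<mu> i else m i) x x = 0"
    proof (cases "m i < \<mu> i")
      case True
      then show ?thesis using n falling_zero[OF True] by (auto intro!: prod_zero)
    next
      case less: False
      have "mon (\<lambda>i. if i < n then m i - \<mu> i else m i) x x = 0"
        unfolding mon_def by (rule prod_zero) (use n less i in \<open>auto intro!: bexI[of _ i]\<close>)
      then show ?thesis by simp
    qed
    then show ?thesis using eq False by auto
  qed
qed

lemma vord_mon: "vord (\<Sum>i<n. m i) (mon m x) x"
proof -
  have "vord (\<Sum>i\<in>I. m i) (\<lambda>y. \<Prod>i\<in>I. (bil (e i) y - bil (e i) x) ^ m i) x" if "finite I" for I
    using that
  proof (induction I rule: finite_induct)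
    case (insert i I)
    have "vord (1 * m i) (\<lambda>y. (bil (e i) y - bil (e i) x) ^ m i) x" by (rule vord_power[OF vord_bil])
    then show ?case using insert by (auto intro!: vord_mult)
  qed (auto intro!: vord_continuous)
  then show ?thesis unfolding mon_def[abs_def] by blast
qed

definition coord_poly :: "nat mpoly \<Rightarrow> bool" where
  "coord_poly p \<longleftrightarrow> (\<forall>m\<in>Poly_Mapping.keys p. Poly_Mapping.keys m \<subseteq> {..<n})"

lemma coord_poly_add: "coord_poly p \<Longrightarrow> coord_poly q \<Longrightarrow> coord_poly (p + q)"
  unfolding coord_poly_def using Poly_Mapping.keys_add[of p q] by blast

lemma coord_poly_zero: "coord_poly 0"
  by (simp add: coord_poly_def)

lemma coord_poly_sum: "(\<And>i. i \<in> I \<Longrightarrow> coord_poly (p i)) \<Longrightarrow> coord_poly (sum p I)"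
  by (induction I rule: infinite_finite_induct) (auto intro: coord_poly_add coord_poly_zero)

lemma coord_poly_mult: "coord_poly p \<Longrightarrow> coord_poly q \<Longrightarrow> coord_poly (p * q)"
proof -
  assume p: "coord_poly p" and q: "coord_poly q"
  show ?thesis
    unfolding coord_poly_def
  proof
    fix m assume "m \<in> Poly_Mapping.keys (p * q)"
    then obtain a b where "m = a + b" "a \<in> Poly_Mapping.keys p" "b \<in> Poly_Mapping.keys q"
      using keys_mult[of p q] by blast
    then show "Poly_Mapping.keys m \<subseteq> {..<n}"
      using p q Poly_Mapping.keys_add[of a b] unfolding coord_poly_def by blast
  qed
qed

lemma polyfun_coords:
  assumes "T \<in> polyfun"
  shows "\<exists>Q. coord_poly Q \<and> (\<forall>z. T (proj z) = peval Q (\<lambda>i. bil (e i) z - bil (e i) x))"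
  using assms
proof (induction rule: polyfun_induct)
  case (const a)
  show ?case by (rule exI[of _ "Poly_Mapping.single 0 a"]) (simp add: coord_poly_def)
next
  case (add f g)
  then obtain Q1 Q2 where "coord_poly Q1" "\<forall>z. f (proj z) = peval Q1 (\<lambda>i. bil (e i) z - bil (e i) x)"
    "coord_poly Q2" "\<forall>z. g (proj z) = peval Q2 (\<lambda>i. bil (e i) z - bil (e i) x)" by blast
  then show ?case by (intro exI[of _ "Q1 + Q2"]) (simp add: peval_add coord_poly_add)
next
  case (coord f k)
  then obtain Q where Q: "coord_poly Q" "\<forall>z. f (proj z) = peval Q (\<lambda>i. bil (e i) z - bil (e i) x)" by blast
  define L :: "nat mpoly" where "L = (\<Sum>i<n. Poly_Mapping.single (Poly_Mapping.single i 1) (e i $ k) +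
      Poly_Mapping.single 0 (bil (e i) x * e i $ k))"
  have "coord_poly L" unfolding L_def
    by (intro coord_poly_sum coord_poly_add) (auto simp: coord_poly_def)
  moreover have "proj z $ k = peval L (\<lambda>i. bil (e i) z - bil (e i) x)" for z
    by (simp add: L_def peval_sum peval_add proj_def algebra_simps)
  ultimately show ?case using Q
    by (intro exI[of _ "L * Q"]) (simp add: peval_mult coord_poly_mult)
qed

lemma mono_eval_mon:
  assumes "Poly_Mapping.keys m \<subseteq> {..<n}"
  shows "mono_eval m (\<lambda>i. bil (e i) z - bil (e i) x) = mon (Poly_Mapping.lookup m) x z"
  unfolding mon_def by (rule mono_eval_superset) (use assms in auto)

text \<open>The coefficients of the restricted operators are values at \<open>x\<close> of operators applied to functions
  depending on \<open>x\<close>; they are analytic because this dependence is separable.\<close>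

inductive separable :: "(complex^'n \<Rightarrow> complex^'n \<Rightarrow> complex) \<Rightarrow> bool" where
  separable_prod: "analytic_fun u U \<Longrightarrow> analytic_fun v U \<Longrightarrow> separable (\<lambda>x y. u x * v y)"
| separable_add: "separable G \<Longrightarrow> separable H \<Longrightarrow> separable (\<lambda>x y. G x y + H x y)"

lemma separable_mult:
  assumes "separable G" "separable H"
  shows "separable (\<lambda>x y. G x y * H x y)"
  using assms(1)
proof (induction rule: separable.induct)
  case (separable_prod u v)
  note uv = separable_prod
  show ?case using assms(2)
  proof (induction rule: separable.induct)
    case (separable_prod u' v')
    have "separable (\<lambda>x y. (u x * u' x) * (v y * v' y))"
      by (intro separable.separable_prod analytic_fun_mult uv separable_prod)
    then show ?case by (simp add: mult_ac)
  next
    case (separable_add G H)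
    from separable.separable_add[OF separable_add.IH] show ?case by (simp add: distrib_left)
  qed
next
  case (separable_add G' H')
  from separable.separable_add[OF separable_add.IH] show ?case by (simp add: distrib_right)
qed

lemma separable_mon: "separable (mon m)"
proof -
  have lin: "separable (\<lambda>x y. bil (e i) y - bil (e i) x)" for i
  proof -
    have "separable (\<lambda>x y. 1 * bil (e i) y + (- 1 * bil (e i) x) * 1)"
      by (intro separable.intros analytic_fun_const analytic_fun_bil analytic_fun_mult)
    then show ?thesis by simp
  qed
  have one: "separable (\<lambda>x y. 1)"
    using separable_prod[of "\<lambda>_. 1" "\<lambda>_. 1"] by simp
  have pow: "separable (\<lambda>x y. (bil (e i) y - bil (e i) x) ^ k)" for i k
  proof (induction k)
    case (Suc k)
    from separable_mult[OF lin this] show ?case by simp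
  qed (simp add: one)
  have "separable (\<lambda>x y. \<Prod>i\<in>I. (bil (e i) y - bil (e i) x) ^ m i)" if "finite I" for I
    using that
  proof (induction I rule: finite_induct)
    case (insert i I)
    from separable_mult[OF pow insert.IH] show ?case using insert.hyps by simp
  qed (simp add: one)
  then show ?thesis unfolding mon_def[abs_def] by blast
qed

text \<open>While the parameter is frozen, the factor \<open>u x\<close> is a scalar and leaves
  \<open>pd \<sigma>\<close>; only afterwards do parameter and evaluation point coincide.\<close>

lemma separable_analytic:
  assumes "separable G"
  shows "(\<forall>x. analytic_fun (G x) U) \<and> analytic_fun (\<lambda>x. pd \<sigma> (\<lambda>z. G x (ret z)) x) U"
  using assms
proof (induction rule: separable.induct)
  case (separable_prod u v)
  have "analytic_fun (\<lambda>x. u x * pd \<sigma> (\<lambda>z. v (ret z)) x) U"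
    by (intro analytic_fun_mult separable_prod analytic_fun_subset[OF poly_dunkl_analytic[OF dom_Om analytic_ret] U_Om])
  then have "analytic_fun (\<lambda>x. pd \<sigma> (\<lambda>z. u x * v (ret z)) x) U"
    by (rule analytic_fun_cong)
      (use U_Om in \<open>auto simp: poly_dunkl_cmult[OF dom_Om analytic_ret[OF separable_prod(2)]]\<close>)
  then show ?case using separable_prod by (auto intro: analytic_fun_cmult)
next
  case (separable_add G H)
  have "analytic_fun (\<lambda>x. pd \<sigma> (\<lambda>z. G x (ret z)) x + pd \<sigma> (\<lambda>z. H x (ret z)) x) U"
    using separable_add.IH by (auto intro: analytic_fun_add)
  then have "analytic_fun (\<lambda>x. pd \<sigma> (\<lambda>z. G x (ret z) + H x (ret z)) x) U"
    by (rule analytic_fun_cong)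
      (use U_Om separable_add.IH in \<open>auto intro!: poly_dunkl_add[OF dom_Om, symmetric] analytic_ret\<close>)
  then show ?case using separable_add.IH by (auto intro: analytic_fun_add)
qed

theorem diff_op_restr: "diff_op n e U (restr_op R U (pd \<sigma>))"
proof -
  obtain d where d: "\<And>m. m \<in> Poly_Mapping.keys \<sigma> \<Longrightarrow> sum_list (map (Poly_Mapping.lookup m) ixs) \<le> d"
    using poly_deg_bound[of \<sigma>] by blast
  \<comment> \<open>Exponents of total degree at most \<open>d\<close>. Zeros beyond
    \<open>n\<close> make them unique for a given monomial, and the bound on single entries exhibits
    finiteness.\<close>
  define M where "M = {m :: nat \<Rightarrow> nat. (\<forall>i. (i \<in> {..<n} \<longrightarrow> m i \<in> {..d}) \<and> (i \<notin> {..<n} \<longrightarrow> m i = 0)) \<and> (\<Sum>i<n. m i) \<le> d}"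
  have finM: "finite M"
    unfolding M_def by (rule finite_subset[OF _ finite_set_of_finite_funs[of "{..<n}" "{..d}" 0]]) auto
  have M: "m \<in> M" if "\<And>i. n \<le> i \<Longrightarrow> m i = 0" "(\<Sum>i<n. m i) \<le> d" for m
  proof -
    have "m i \<le> d" if i: "i < n" for i
      using member_le_sum[of i "{..<n}" m] i \<open>(\<Sum>i<n. m i) \<le> d\<close> by auto
    then show ?thesis using that by (auto simp: M_def)
  qed
  define A where "A f x = pd \<sigma> (\<lambda>z. f (ret z)) x" for f x
  \<comment> \<open>Forced by duality: test the expansion on \<open>mon m x\<close> at
    \<open>x\<close>.\<close>
  define a where "a m x = 1 / (\<Prod>i<n. fact (m i)) * A (mon m x) x" for m x
  define D where "D \<mu> = op_monom [0..<n] (\<lambda>i. dderiv (e i)) \<mu>" for \<mu>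
  have an: "analytic_fun (a m) U" for m
    unfolding a_def[abs_def] A_def using separable_analytic[OF separable_mon] by (intro analytic_fun_cmult) blast
  have zero: "A f x = 0" if f: "analytic_fun f U" and x: "x \<in> U" and v: "vord (Suc d) (\<lambda>z. f (proj z)) x" for f x
  proof -
    have xO: "x \<in> Om" using x U_Om by blast
    have "vord (Suc d) (\<lambda>z. f (ret z)) x"
      by (rule vord_cong[OF v open_V]) (use x U_V in \<open>auto simp: ret_V\<close>)
    from vord_orbit[OF dom_Om xO _ this] have "vord (1 + d) (\<lambda>z. f (ret z)) y" if "y \<in> orb x" for y
      using that by (simp add: ret_inv)
    from poly_dunkl_vord[where \<sigma> = \<sigma>, OF dom_Om xO analytic_ret[OF f] d this orb_self]
    show ?thesis unfolding A_def using vord_Suc_zero[of 0] by simp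
  qed
  have "restr_op R U (pd \<sigma>) f x = (\<Sum>m\<in>M. a m x * D m f x)" if f: "analytic_fun f U" and x: "x \<in> U" for f x
  proof -
    have xV: "x \<in> V" and xO: "x \<in> Om" and xP: "x \<in> P" and px: "proj x = x"
      using x U_V U_Om U_P proj_id by auto
    define F where "F z = f (proj z)" for z
    have F: "analytic_fun F V" unfolding F_def[abs_def] by (rule analytic_proj[OF f]) (simp add: V_def)
    obtain T where T: "T \<in> polyfun" "vord (Suc d) (\<lambda>z. F z - T z) x"
      by (rule Taylor_polyfun[OF open_V F xV, where k = "Suc d"]) blast
    obtain Q where Q: "coord_poly Q" "\<And>z. T (proj z) = peval Q (\<lambda>i. bil (e i) z - bil (e i) x)"
      using polyfun_coords[OF T(1)] by blast
    define K where "K = Poly_Mapping.keys Q"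
    define t where "t m = Poly_Mapping.lookup Q m" for m
    define b where "b m = mon (Poly_Mapping.lookup m) x" for m
    have supp: "Poly_Mapping.lookup m i = 0" if "m \<in> K" "n \<le> i" for m i
      using Q(1) that unfolding coord_poly_def K_def by (metis in_keys_iff lessThan_iff not_le subsetD)
    have TQ: "T (proj z) = (\<Sum>m\<in>K. t m * b m z)" for z
      unfolding Q(2) peval_def lin_ext_def K_def t_def b_def
      by (rule sum.cong) (use Q(1) in \<open>auto simp: coord_poly_def mono_eval_mon\<close>)
    \<comment> \<open>The remainder of \<open>f\<close> after its Taylor polynomial in the
      coordinates of \<open>P\<close>; composed with \<open>proj\<close> it has order
      \<open>Suc d\<close>, so the operator and all derivatives from \<open>M\<close> kill it at
      \<open>x\<close>.\<close>
    define r where "r z = f z - (\<Sum>m\<in>K. t m * b m z)" for z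
    have S: "analytic_fun (\<lambda>z. \<Sum>m\<in>K. t m * b m z) S" for S
      unfolding b_def by (intro analytic_fun_sum analytic_fun_cmult analytic_mon)
    have r: "analytic_fun r U" unfolding r_def[abs_def] by (intro analytic_fun_diff f S)
    have bproj: "b m (proj z) = b m z" for m z by (simp add: b_def mon_proj)
    have rp: "r (proj z) = F z - T (proj z)" for z
      by (simp add: r_def F_def TQ bproj)
    have "vord (Suc d) (\<lambda>z. F (proj z) - T (proj z)) x"
      using vord_linear_compose[of "Suc d" "\<lambda>z. F z - T z" 0 proj x] T(2) px proj_linear by simp
    moreover have "F (proj z) = F z" for z by (simp add: F_def proj_id[OF proj_P])
    ultimately have rv: "vord (Suc d) (\<lambda>z. r (proj z)) x" by (simp add: rp)
    have Ar: "A r x = 0" by (rule zero[OF r x rv])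
    have bU: "analytic_fun (b m) S" for m S unfolding b_def by (rule analytic_mon)
    have cb: "analytic_fun (\<lambda>z. t m * b m (ret z)) Om" for m
      by (intro analytic_fun_cmult analytic_ret bU)
    have "restr_op R U (pd \<sigma>) f x = A f x"
      unfolding A_def by (rule restr_poly_dunkl[OF f analytic_ret[OF f] _ _ x]) (simp_all add: ret_inv ret_U)
    also have "\<dots> = pd \<sigma> (\<lambda>z. r (ret z) + (\<Sum>m\<in>K. t m * b m (ret z))) x"
      by (simp add: A_def r_def)
    also have "\<dots> = A r x + (\<Sum>m\<in>K. t m * A (b m) x)"
      unfolding A_def
      by (simp add: poly_dunkl_add[OF dom_Om analytic_ret[OF r] analytic_fun_sum[OF cb] xO]
          poly_dunkl_sum[OF dom_Om cb xO] poly_dunkl_cmult[OF dom_Om analytic_ret[OF bU] xO])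
    finally have lhs: "restr_op R U (pd \<sigma>) f x = (\<Sum>m\<in>K. t m * A (b m) x)" by (simp add: Ar)
    have DfF: "D \<mu> f x = D \<mu> F x" for \<mu>
    proof -
      have iter: "(dderiv v ^^ k) h p = (dderiv v ^^ k) h' p"
        if "v \<in> P" "p \<in> P" "\<And>q. q \<in> P \<Longrightarrow> h q = h' q" for v k p h h'
        using that(2)
      proof (induction k arbitrary: p)
        case (Suc k)
        have "dderiv v ((dderiv v ^^ k) h) p = dderiv v ((dderiv v ^^ k) h') p"
          by (rule dderiv_on_P[OF Suc.prems that(1) Suc.IH])
        then show ?case by simp
      qed (use that(3) in simp)
      have mono: "op_monom ks (\<lambda>i. dderiv (e i)) \<mu> h p = op_monom ks (\<lambda>i. dderiv (e i)) \<mu> h' p"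
        if "set ks \<subseteq> {..<n}" "p \<in> P" "\<And>q. q \<in> P \<Longrightarrow> h q = h' q" for ks p h h'
        using that
      proof (induction ks arbitrary: h h')
        case (Cons k ks)
        show ?case unfolding op_monom_Cons
          by (rule Cons.IH) (use Cons.prems in \<open>auto intro!: iter e_P\<close>)
      qed simp
      show ?thesis unfolding D_def by (rule mono[OF _ xP]) (auto simp: F_def proj_id)
    qed
    have rpV: "analytic_fun (\<lambda>z. r (proj z)) V" by (rule analytic_proj[OF r]) (simp add: V_def)
    have Dr: "D \<mu> (\<lambda>z. r (proj z)) x = 0" if "\<mu> \<in> M" for \<mu>
    proof -
      have "vord (1 + sum_list (map \<mu> [0..<n])) (\<lambda>z. r (proj z)) x"
        by (rule vord_mono[OF rv]) (use that in \<open>simp add: M_def interv_sum_list_conv_sum_set_nat lessThan_atLeast0\<close>)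
      from op_monom_dderiv(2)[where e = e, OF open_V rpV xV this] show ?thesis
        unfolding D_def using vord_Suc_zero[of 0] by simp
    qed
    have DF: "D \<mu> F x = (\<Sum>m\<in>K. t m * D \<mu> (b m) x)" if "\<mu> \<in> M" for \<mu>
    proof -
      \<comment> \<open>\<open>None\<close> stands for the remainder, so that a single linear
        combination contains it along with the monomials.\<close>
      define J where "J = insert None (Some ` K)"
      define G where "G j = (case j of None \<Rightarrow> (\<lambda>z. r (proj z)) | Some m \<Rightarrow> b m)" for j
      define s where "s j = (case j of None \<Rightarrow> 1 | Some m \<Rightarrow> t m)" for j
      have finK: "finite K" by (simp add: K_def)
      have J: "(\<Sum>j\<in>J. s j * h j) = h None + (\<Sum>m\<in>K. t m * h (Some m))" for h
        using finK by (simp add: J_def s_def sum.reindex image_iff)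
      have "F z = (\<Sum>j\<in>J. s j * G j z)" for z
        by (simp add: J G_def rp TQ)
      then have "D \<mu> F x = (\<Sum>j\<in>J. s j * D \<mu> (G j) x)"
        using op_monom_dderiv_sum[OF open_V _ xV, of J G "[0..<n]" e \<mu> s] rpV bU
        by (auto simp: D_def G_def F_def[abs_def] fun_eq_iff split: option.splits)
      also have "\<dots> = (\<Sum>m\<in>K. t m * D \<mu> (b m) x)" using Dr[OF that] by (simp add: J G_def)
      finally show ?thesis .
    qed
    have key: "(\<Sum>\<mu>\<in>M. a \<mu> x * D \<mu> (b m) x) = A (b m) x" if m: "m \<in> K" for m
    proof -
      have D: "D \<mu> (b m) x = (if Poly_Mapping.lookup m = \<mu> then \<Prod>i<n. fact (\<mu> i) else 0)" if "\<mu> \<in> M" for \<mu>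
        unfolding D_def b_def by (rule op_monom_mon_center) (use supp[OF m] that in \<open>auto simp: M_def\<close>)
      show ?thesis
      proof (cases "(\<Sum>i<n. Poly_Mapping.lookup m i) \<le> d")
        case True
        then have mM: "Poly_Mapping.lookup m \<in> M" using M supp[OF m] by blast
        have "(\<Sum>\<mu>\<in>M. a \<mu> x * D \<mu> (b m) x) =
            (\<Sum>\<mu>\<in>M. if Poly_Mapping.lookup m = \<mu> then a \<mu> x * (\<Prod>i<n. fact (\<mu> i)) else 0)"
          by (rule sum.cong) (simp_all add: D)
        also have "\<dots> = a (Poly_Mapping.lookup m) x * (\<Prod>i<n. fact (Poly_Mapping.lookup m i))"
          using finM mM by (simp add: sum.delta')
        also have "\<dots> = A (b m) x" by (simp add: a_def b_def)
        finally show ?thesis .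
      next
        case False
        \<comment> \<open>A monomial of degree above \<open>d\<close> contributes zero on both
          sides.\<close>
        have "Poly_Mapping.lookup m \<notin> M" using False by (auto simp: M_def)
        then have "(\<Sum>\<mu>\<in>M. a \<mu> x * D \<mu> (b m) x) = 0"
          by (intro sum.neutral ballI) (auto simp: D)
        moreover have "A (b m) x = 0"
        proof (rule zero[OF bU x])
          have "vord (Suc d) (b m) x"
            unfolding b_def by (rule vord_mono[OF vord_mon]) (use False in simp)
          then show "vord (Suc d) (\<lambda>z. b m (proj z)) x" by (simp add: bproj)
        qed
        ultimately show ?thesis by simp
      qed
    qed
    have "(\<Sum>\<mu>\<in>M. a \<mu> x * D \<mu> f x) = (\<Sum>\<mu>\<in>M. \<Sum>m\<in>K. t m * (a \<mu> x * D \<mu> (b m) x))"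
      by (rule sum.cong) (simp_all add: DfF DF sum_distrib_left mult.left_commute)
    also have "\<dots> = (\<Sum>m\<in>K. t m * (\<Sum>\<mu>\<in>M. a \<mu> x * D \<mu> (b m) x))"
      by (subst sum.swap) (simp add: sum_distrib_left)
    also have "\<dots> = (\<Sum>m\<in>K. t m * A (b m) x)" by (rule sum.cong) (simp_all add: key)
    finally show ?thesis using lhs by simp
  qed
  then show ?thesis unfolding diff_op_def D_def using finM an by blast
qed

end

section \<open>Homogeneous components\<close>

text \<open>A sum over the list \<open>ixs\<close>, to match the degree conditions of
  \<open>poly_dunkl_vord\<close> and \<open>lead_poly_dunkl\<close>.\<close>

definition mdeg :: "('n::finite \<Rightarrow>\<^sub>0 nat) \<Rightarrow> nat" where
  "mdeg m = sum_list (map (Poly_Mapping.lookup m) ixs)"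

lemma mdeg_sum: "mdeg m = (\<Sum>i\<in>UNIV. Poly_Mapping.lookup m i)"
  unfolding mdeg_def using sum.distinct_set_conv_list[OF ixs(1), of "Poly_Mapping.lookup m"] by (simp add: ixs(2))

definition homogeneous :: "('n::finite) mpoly \<Rightarrow> nat \<Rightarrow> bool" where
  "homogeneous \<sigma> d \<longleftrightarrow> (\<forall>m\<in>Poly_Mapping.keys \<sigma>. mdeg m = d)"

text \<open>\<open>Q\<close> is left general: the same device extracts homogeneous components and
  the top weight part of a relation.\<close>

definition part :: "('k \<Rightarrow> bool) \<Rightarrow> ('k \<Rightarrow>\<^sub>0 complex) \<Rightarrow> 'k \<Rightarrow>\<^sub>0 complex" where
  "part Q p = (\<Sum>m\<in>{m\<in>Poly_Mapping.keys p. Q m}. Poly_Mapping.single m (Poly_Mapping.lookup p m))"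

lemma lookup_part: "Poly_Mapping.lookup (part Q p) m = (if Q m then Poly_Mapping.lookup p m else 0)"
  by (auto simp: part_def lookup_sum lookup_single when_def in_keys_iff)

lemma keys_part: "Poly_Mapping.keys (part Q p) = {m\<in>Poly_Mapping.keys p. Q m}"
  by (auto simp: in_keys_iff lookup_part split: if_splits)

lemma lin_ext_part: "lin_ext (part Q p) \<phi> = (\<Sum>m\<in>Poly_Mapping.keys p. if Q m then Poly_Mapping.lookup p m * \<phi> m else 0)"
  unfolding lin_ext_def keys_part by (simp add: lookup_part sum.inter_filter[OF finite_keys, symmetric])

lemma homogeneous_part: "homogeneous (part (\<lambda>m. mdeg m = j) \<sigma>) j"
  by (simp add: homogeneous_def keys_part)

lemma poly_eval_homogeneous:
  assumes "homogeneous \<sigma> d"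
  shows "poly_eval \<sigma> (t *s x) = t ^ d * poly_eval \<sigma> x"
  unfolding poly_eval_def sum_distrib_left
proof (rule sum.cong[OF HOL.refl])
  fix m assume "m \<in> Poly_Mapping.keys \<sigma>"
  then have d: "(\<Sum>i\<in>UNIV. Poly_Mapping.lookup m i) = d"
    using assms by (simp add: homogeneous_def mdeg_sum)
  have "(\<Prod>i\<in>UNIV. (t *s x) $ i ^ Poly_Mapping.lookup m i) =
      t ^ d * (\<Prod>i\<in>UNIV. x $ i ^ Poly_Mapping.lookup m i)"
    by (simp add: power_mult_distrib prod.distrib power_sum[symmetric] d)
  then show "Poly_Mapping.lookup \<sigma> m * (\<Prod>i\<in>UNIV. (t *s x) $ i ^ Poly_Mapping.lookup m i) =
      t ^ d * (Poly_Mapping.lookup \<sigma> m * (\<Prod>i\<in>UNIV. x $ i ^ Poly_Mapping.lookup m i))"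
    by simp
qed

lemma poly_eval_components:
  obtains D where "\<And>x. poly_eval \<sigma> x = (\<Sum>j\<le>D. poly_eval (part (\<lambda>m. mdeg m = j) \<sigma>) x)"
    "\<And>j x. D < j \<Longrightarrow> poly_eval (part (\<lambda>m. mdeg m = j) \<sigma>) x = 0"
proof -
  define D where "D = (\<Sum>m\<in>Poly_Mapping.keys \<sigma>. mdeg m)"
  have D: "mdeg m \<le> D" if "m \<in> Poly_Mapping.keys \<sigma>" for m
    unfolding D_def using that by (intro member_le_sum) auto
  have "poly_eval \<sigma> x = (\<Sum>j\<le>D. poly_eval (part (\<lambda>m. mdeg m = j) \<sigma>) x)" for x
  proof -
    have "(\<Sum>j\<le>D. poly_eval (part (\<lambda>m. mdeg m = j) \<sigma>) x) =
        (\<Sum>m\<in>Poly_Mapping.keys \<sigma>. \<Sum>j\<le>D. if mdeg m = j then Poly_Mapping.lookup \<sigma> m * mono_eval m (\<lambda>i. x $ i) else 0)"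
      unfolding poly_eval_eq_peval peval_def lin_ext_part by (rule sum.swap)
    also have "\<dots> = poly_eval \<sigma> x"
      unfolding poly_eval_eq_peval peval_def lin_ext_def
      by (rule sum.cong) (simp_all add: D)
    finally show ?thesis by simp
  qed
  moreover have "poly_eval (part (\<lambda>m. mdeg m = j) \<sigma>) x = 0" if "D < j" for j x
    unfolding poly_eval_eq_peval peval_def lin_ext_part
    by (rule sum.neutral) (use D that in \<open>fastforce simp: not_less\<close>)
  ultimately show ?thesis by (rule that)
qed

lemma homogeneous_sq_poly: "homogeneous (sq_poly :: 'n::finite mpoly) 2"
  unfolding homogeneous_def
proof
  fix m :: "'n::finite \<Rightarrow>\<^sub>0 nat" assume "m \<in> Poly_Mapping.keys sq_poly"
  then have "Poly_Mapping.lookup sq_poly m \<noteq> 0" by (simp add: in_keys_iff)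
  then have "\<exists>i. m = Poly_Mapping.single i 2"
    by (rule contrapos_np) (auto simp: sq_poly_def lookup_sum lookup_single when_def intro!: sum.neutral)
  then obtain i where "m = Poly_Mapping.single i 2" by blast
  then show "mdeg m = 2" by (simp add: mdeg_sum lookup_single when_def)
qed

text \<open>Scaling the argument by \<open>t\<close> turns invariance into a polynomial identity in
  \<open>t\<close>; compare coefficients.\<close>

lemma (in root_sys) invariant_poly_component:
  assumes "invariant_poly R \<sigma>"
  shows "invariant_poly R (part (\<lambda>m. mdeg m = j) \<sigma>)"
proof -
  obtain D where D: "\<And>x. poly_eval \<sigma> x = (\<Sum>j\<le>D. poly_eval (part (\<lambda>m. mdeg m = j) \<sigma>) x)"
    and D0: "\<And>j x. D < j \<Longrightarrow> poly_eval (part (\<lambda>m. mdeg m = j) \<sigma>) x = 0"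
    by (rule poly_eval_components[of \<sigma>]) blast
  define s where "s j = poly_eval (part (\<lambda>m. mdeg m = j) \<sigma>)" for j
  have s: "s j (t *s x) = t ^ j * s j x" for j t x
    unfolding s_def by (rule poly_eval_homogeneous[OF homogeneous_part])
  have "s j (w x) = s j x" if w: "w \<in> W" for w x
  proof (cases "j \<le> D")
    case True
    have "(\<Sum>j\<le>D. (s j (w x) - s j x) * t ^ j) = 0" for t
    proof -
      have "poly_eval \<sigma> (w (t *s x)) = poly_eval \<sigma> (t *s x)"
        using assms w unfolding invariant_poly_def by blast
      then have "(\<Sum>j\<le>D. s j (t *s w x)) = (\<Sum>j\<le>D. s j (t *s x))"
        by (simp add: D s_def W_smult[OF w])
      then show ?thesis by (simp add: s left_diff_distrib right_diff_distrib sum_subtractf mult.commute)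
    qed
    from zero_polynom_imp_zero_coeffs[OF this True] show ?thesis by simp
  next
    case False
    then have "s j y = 0" for y by (simp add: s_def D0)
    then show ?thesis by simp
  qed
  then show ?thesis by (simp add: invariant_poly_def s_def)
qed

section \<open>Algebraic independence\<close>

lemma peval_cong_coord:
  assumes "\<And>m. m \<in> Poly_Mapping.keys p \<Longrightarrow> Poly_Mapping.keys m \<subseteq> {..<n}" "\<And>i. i < n \<Longrightarrow> s i = t i"
  shows "peval p s = peval p (t :: nat \<Rightarrow> complex)"
proof -
  have "mono_eval m s = mono_eval m t" if "m \<in> Poly_Mapping.keys p" for m
    unfolding mono_eval_def
  proof (rule prod.cong[OF HOL.refl])
    fix i assume "i \<in> Poly_Mapping.keys m"
    then have "i < n" using assms(1)[OF that] by blast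
    then show "s i ^ Poly_Mapping.lookup m i = t i ^ Poly_Mapping.lookup m i" by (simp add: assms(2))
  qed
  then show ?thesis by (simp add: peval_def lin_ext_def)
qed

context stratum
begin

lemma dderiv_eq_grad:
  assumes F: "F \<in> polyfun" and v: "v \<in> P"
  shows "dderiv v F x = bil (\<Sum>i<n. dderiv (e i) F x *s e i) v"
proof -
  have "dderiv (\<Sum>i<n. bil (e i) v *s e i) F x = (\<Sum>i<n. bil (e i) v * dderiv (e i) F x)"
    by (rule dderiv_sum_dir[OF open_UNIV analytic_fun_polyfun[OF F] UNIV_I])
  then show ?thesis using proj_id[OF v] by (simp add: bil_simps proj_def mult.commute)
qed

text \<open>The differential along the stratum, represented by a vector of \<open>P\<close> through
  the bilinear form.\<close>

definition grad :: "complex^'n \<Rightarrow> 'n mpoly \<Rightarrow> complex^'n" where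
  "grad x \<sigma> = (\<Sum>i<n. dderiv (e i) (poly_eval \<sigma>) x *s e i)"

lemma grad_P: "grad x \<sigma> \<in> P"
  unfolding grad_def by (intro P_sum P_smult e_P) simp

lemma bil_grad: "v \<in> P \<Longrightarrow> bil (grad x \<sigma>) v = dderiv v (poly_eval \<sigma>) x"
  unfolding grad_def by (rule dderiv_eq_grad[symmetric]) (simp_all add: polyfun_def)

lemma P_eqI: "p \<in> P \<Longrightarrow> q \<in> P \<Longrightarrow> (\<And>i. i < n \<Longrightarrow> bil (e i) p = bil (e i) q) \<Longrightarrow> p = q"
  using proj_id[of p] proj_id[of q] by (simp add: proj_def)

text \<open>Invariant polynomials take arbitrary differentials along the stratum: average a polynomial
  which is linear to second order at \<open>x\<close> and vanishes to second order elsewhere on the orbit.\<close>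

lemma invariant_poly_with_grad:
  assumes x: "x \<in> U" and a: "a \<in> P"
  obtains \<sigma> where "invariant_poly R \<sigma>" "grad x \<sigma> = a"
proof -
  have xO: "x \<in> Om" using x U_Om by blast
  \<comment> \<open>An invariant function that equals \<open>bil a\<close> on \<open>V\<close> and
    so has the required differential; it only remains to make it a polynomial.\<close>
  define h where "h z = bil a (ret z)" for z
  have h: "analytic_fun h Om" unfolding h_def by (rule analytic_ret[OF analytic_fun_bil])
  have hinv: "h (w z) = h z" if "w \<in> W" "z \<in> Om" for w z using that by (simp add: h_def ret_inv)
  have hV: "h z = bil a z" if "z \<in> V" for z
    using that bil_proj_swap[of a z] proj_id[OF a] by (simp add: h_def ret_V)
  obtain q where q: "q \<in> polyfun" "vord (Suc 1) (\<lambda>z. q z - 1) x"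
    "\<And>y. y \<in> orb x \<Longrightarrow> y \<noteq> x \<Longrightarrow> vord (Suc 1) q y"
    by (rule orb_bump[where x = x and k = 1]) blast
  have hF: "vord (Suc 1) (\<lambda>z. h z - bil a z) x"
    by (rule vord_cong[OF vord_zero_fun open_V]) (use x U_V hV in auto)
  define p where "p z = avg (\<lambda>z. q z * bil a z) z / of_nat (card (stab x))" for z
  have pp: "p \<in> polyfun"
    using polyfun_mult[OF polyfun_const[of "1 / of_nat (card (stab x))"] polyfun_avg[OF polyfun_mult[OF q(1) polyfun_bil]]]
    by (simp add: p_def[abs_def])
  have hp: "vord (Suc 1) (\<lambda>z. h z - p z) x"
    unfolding p_def by (rule avg_jet[OF dom_Om xO h _ q(1,2) _ polyfun_bil hF orb_self]) (use hinv q(3) in auto)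
  have dp: "dderiv v p x = bil a v" for v
  proof -
    have an: "analytic_fun h V" "analytic_fun p V"
      using analytic_fun_subset[OF h V_Om] analytic_fun_polyfun[OF pp] .
    have "vord 1 (dderiv v (\<lambda>z. h z - p z)) x"
      by (rule vord_dderiv[OF open_V analytic_fun_diff[OF an]]) (use x U_V hp in auto)
    then have "dderiv v (\<lambda>z. h z - p z) x = 0" using vord_Suc_zero[of 0] by simp
    moreover have "dderiv v h x = dderiv v (bil a) x"
      by (rule dderiv_cong_open[OF open_V _ hV]) (use x U_V in auto)
    ultimately show ?thesis using dderiv_diff[OF open_V an, of x v] x U_V by auto
  qed
  obtain \<sigma> where s: "p = poly_eval \<sigma>" using pp unfolding polyfun_def by blast
  have inv: "invariant_poly R \<sigma>"
    unfolding invariant_poly_def s[symmetric] by (simp add: p_def avg_W)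
  have "grad x \<sigma> = a"
    by (rule P_eqI[OF grad_P a]) (simp add: bil_commute[of "e _"] bil_grad e_P s[symmetric] dp)
  with inv show ?thesis by (rule that)
qed

lemma grad_component_sum:
  assumes "\<And>x. poly_eval \<sigma> x = (\<Sum>j\<in>J. poly_eval (\<tau> j) x)"
  shows "grad x \<sigma> = (\<Sum>j\<in>J. grad x (\<tau> j))"
proof (rule P_eqI[OF grad_P P_sum[OF grad_P]])
  fix i assume i: "i < n"
  have "dderiv (e i) (poly_eval \<sigma>) x = dderiv (e i) (\<lambda>x. \<Sum>j\<in>J. poly_eval (\<tau> j) x) x"
    using assms by (metis ext)
  also have "\<dots> = (\<Sum>j\<in>J. dderiv (e i) (poly_eval (\<tau> j)) x)"
    by (rule dderiv_sum[OF open_UNIV]) (auto intro: analytic_fun_polyfun simp: polyfun_def)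
  finally show "bil (e i) (grad x \<sigma>) = bil (e i) (\<Sum>j\<in>J. grad x (\<tau> j))"
    by (simp add: bil_sum_right bil_commute[of "e i"] bil_grad[OF e_P[OF i]])
qed

lemma grad_sq_poly: "x \<in> P \<Longrightarrow> grad x sq_poly = 2 *s x"
proof (rule P_eqI[OF grad_P P_smult])
  fix i assume i: "i < n"
  have "((\<lambda>t. bil (x + t *s e i) (x + t *s e i)) has_field_derivative 2 * bil x (e i)) (at 0)"
    by (simp add: bil_simps bil_commute[of "e i" x]) (auto intro!: derivative_eq_intros)
  then have "dderiv (e i) (poly_eval sq_poly) x = 2 * bil x (e i)"
    unfolding dderiv_def by (simp add: poly_eval_sq_poly DERIV_imp_deriv)
  then show "bil (e i) (grad x sq_poly) = bil (e i) (2 *s x)"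
    by (simp add: bil_commute[of "e i"] bil_grad[OF e_P[OF i]] bil_simps)
qed

text \<open>A maximal independent set of differentials of homogeneous invariants, started from that
  of \<open>sq_poly\<close>, is a basis of \<open>P\<close>; comparison with \<open>e\<close> shows
  that it has \<open>n\<close> elements.\<close>

lemma independent_invariants:
  obtains x \<sigma> d where "x \<in> U" "\<sigma> 0 = sq_poly" "\<And>i. invariant_poly R (\<sigma> i)" "\<And>i. homogeneous (\<sigma> i) (d i)"
    "\<And>v. v \<in> P \<Longrightarrow> (\<And>i::nat. i < n \<Longrightarrow> bil (grad x (\<sigma> i)) v = 0) \<Longrightarrow> v = 0"
proof (cases "n = 0")
  case True
  obtain x where x: "x \<in> U" using U_nonempty by blast
  show ?thesis
  proof (rule that[of x "\<lambda>_. sq_poly" "\<lambda>_. 2"])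
    fix v assume "v \<in> P"
    moreover have "proj v = 0" unfolding proj_def by (simp add: True)
    ultimately show "v = 0" using proj_id by metis
  qed (simp_all add: x invariant_sq_poly homogeneous_sq_poly)
next
  case False
  then have n: "0 < n" by simp
  obtain y where y: "y \<in> U" using U_nonempty by blast
  \<comment> \<open>The differential of \<open>sq_poly\<close> is \<open>2 *s x\<close>, so
    \<open>x\<close> must be nonzero; for \<open>n > 0\<close> the set \<open>U\<close> has a second
    point.\<close>
  obtain t where t: "t \<noteq> 0" "y + t *s e 0 \<in> U" using U_line[OF y e_P[OF n]] by blast
  have e0: "e 0 \<noteq> 0" using e_orth[OF n n] by auto
  have "y \<noteq> 0 \<or> y + t *s e 0 \<noteq> 0" using t(1) e0 by auto
  then obtain x where x: "x \<in> U" "x \<noteq> 0" using y t(2) by blast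
  have xP: "x \<in> P" using x U_P by blast
  define GS where "GS = {grad x \<sigma> |\<sigma>. invariant_poly R \<sigma> \<and> (\<exists>d. homogeneous \<sigma> d)}"
  have x2: "2 *s x \<in> GS"
    unfolding GS_def
    by (rule CollectI, rule exI[of _ sq_poly])
      (use grad_sq_poly[OF xP] invariant_sq_poly homogeneous_sq_poly in auto)
  have "2 *s x \<noteq> 0" using x(2) by (simp add: vec_eq_iff)
  then have ind: "vec.independent {2 *s x}" by (simp add: vec.dependent_single)
  obtain B where B: "{2 *s x} \<subseteq> B" "B \<subseteq> GS" "vec.independent B" "GS \<subseteq> vec.span B"
    by (rule vec.maximal_independent_subset_extend[OF _ ind]) (use x2 in auto)
  have PB: "P \<subseteq> vec.span B"
  proof
    fix a assume a: "a \<in> P"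
    obtain \<sigma> where s: "invariant_poly R \<sigma>" "grad x \<sigma> = a" by (rule invariant_poly_with_grad[OF x(1) a])
    \<comment> \<open>Homogeneous components of an invariant are invariant, so their differentials
      already span.\<close>
    obtain D where D: "\<And>x. poly_eval \<sigma> x = (\<Sum>j\<le>D. poly_eval (part (\<lambda>m. mdeg m = j) \<sigma>) x)"
      by (rule poly_eval_components[of \<sigma>]) blast
    have "grad x \<sigma> = (\<Sum>j\<le>D. grad x (part (\<lambda>m. mdeg m = j) \<sigma>))"
      by (rule grad_component_sum[OF D])
    moreover have "grad x (part (\<lambda>m. mdeg m = j) \<sigma>) \<in> vec.span B" for j
      using B(4) invariant_poly_component[OF s(1)] homogeneous_part unfolding GS_def by blast
    ultimately show "a \<in> vec.span B" using s(2) by (auto intro: vec.span_sum)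
  qed
  have BP: "B \<subseteq> P" using B(2) grad_P unfolding GS_def by blast
  have subP: "vec.subspace P" unfolding vec.subspace_def using P_add P_smult P_zero by blast
  have spanB: "vec.span B = P" using PB vec.span_minimal[OF BP subP] by blast
  have inj: "inj_on e {..<n}"
  proof (rule inj_onI)
    fix i j assume ij: "i \<in> {..<n}" "j \<in> {..<n}" "e i = e j"
    then have "bil (e i) (e j) = 1" using e_orth[of i i] by simp
    then show "i = j" using e_orth[of i j] ij by (auto split: if_splits)
  qed
  have spanE: "vec.span (e ` {..<n}) = P"
  proof
    show "vec.span (e ` {..<n}) \<subseteq> P" by (rule vec.span_minimal[OF _ subP]) (auto intro: e_P)
    show "P \<subseteq> vec.span (e ` {..<n})"
    proof
      fix p assume "p \<in> P"
      then have "p = (\<Sum>i<n. bil (e i) p *s e i)" using proj_id by (simp add: proj_def)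
      also have "\<dots> \<in> vec.span (e ` {..<n})"
        by (intro vec.span_sum vec.span_scale vec.span_base) auto
      finally show "p \<in> vec.span (e ` {..<n})" .
    qed
  qed
  have indE: "vec.independent (e ` {..<n})"
  proof (rule vec.independent_if_scalars_zero)
    fix f y assume s: "(\<Sum>y\<in>e ` {..<n}. f y *s y) = 0" and "y \<in> e ` {..<n}"
    then obtain j where j: "j < n" "y = e j" by blast
    have "0 = bil (e j) (\<Sum>i<n. f (e i) *s e i)"
      using s by (simp add: sum.reindex[OF inj])
    also have "\<dots> = f (e j)"
      using j(1) by (simp add: bil_simps e_orth if_distrib[of "\<lambda>t. _ * t"] cong: if_cong)
    finally show "f y = 0" using j(2) by simp
  qed simp
  have "card B = vec.dim P" using vec.dim_eq_card[of B P] spanB B(3) vec.span_eq_iff[THEN iffD2, OF subP] by simp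
  also have "\<dots> = card (e ` {..<n})"
    using vec.dim_eq_card[of "e ` {..<n}" P] spanE indE vec.span_eq_iff[THEN iffD2, OF subP] by simp
  also have "\<dots> = n" using card_image[OF inj] by simp
  finally have cardB: "card B = n" .
  have finB: "finite B" using cardB n card_ge_0_finite by metis
  obtain h where h: "bij_betw h {0..<n} B" using ex_bij_betw_nat_finite[OF finB] cardB by blast
  obtain j where j: "j < n" "h j = 2 *s x" using h B(1) unfolding bij_betw_def by (metis atLeastLessThan_iff imageE insert_subset)
  \<comment> \<open>The transposition of 0 and \<open>j\<close>, which gives \<open>sq_poly\<close>
    the number 0.\<close>
  define g where "g i = (if i = 0 then j else if i = j then 0 else i)" for i
  define b where "b i = h (g i)" for i
  have gg: "g (g i) = i" and gn: "i < n \<Longrightarrow> g i < n" for i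
    using j(1) n by (auto simp: g_def)
  have "g ` {..<n} = {0..<n}"
  proof
    show "{0..<n} \<subseteq> g ` {..<n}"
    proof
      fix i assume "i \<in> {0..<n}"
      then show "i \<in> g ` {..<n}" using gn[of i] by (intro image_eqI[of _ _ "g i"]) (simp_all add: gg)
    qed
  qed (use gn in auto)
  then have "h ` g ` {..<n} = B" using h by (simp add: bij_betw_def)
  then have bB: "b ` {..<n} = B" by (simp add: b_def image_image)
  have "\<exists>\<sigma> d. invariant_poly R \<sigma> \<and> homogeneous \<sigma> d \<and> (i < n \<longrightarrow> grad x \<sigma> = b i) \<and> (i = 0 \<longrightarrow> \<sigma> = sq_poly)" for i
  proof (cases "i \<noteq> 0 \<and> i < n")
    case True
    then have "b i \<in> GS" using bB B(2) by blast
    then show ?thesis using True unfolding GS_def by auto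
  next
    case False
    then show ?thesis using grad_sq_poly[OF xP] j(2) invariant_sq_poly homogeneous_sq_poly
      by (intro exI[of _ sq_poly] exI[of _ 2]) (auto simp: b_def g_def)
  qed
  then obtain \<sigma> d where s: "\<And>i. invariant_poly R (\<sigma> i)" "\<And>i. homogeneous (\<sigma> i) (d i)"
    "\<And>i. i < n \<Longrightarrow> grad x (\<sigma> i) = b i" "\<sigma> 0 = sq_poly" by metis
  show ?thesis
  proof (rule that[of x \<sigma> d])
    fix v assume v: "v \<in> P" and z: "\<And>i. i < n \<Longrightarrow> bil (grad x (\<sigma> i)) v = 0"
    have "B \<subseteq> {p. bil p v = 0}" using z s(3) bB by force
    moreover have "vec.subspace {p. bil p v = 0}" unfolding vec.subspace_def by (auto simp: bil_simps)
    ultimately have "P \<subseteq> {p. bil p v = 0}" using vec.span_minimal spanB by blast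
    then show "v = 0" using e_P by (intro P_eqI[OF v P_zero]) auto
  qed (use x(1) s in simp_all)
qed

end

context stratum
begin

text \<open>Jacobian criterion: where the differentials are independent, the values of the
  invariants fill an open set, and a polynomial vanishing on it is zero.\<close>

lemma invariants_alg_independent:
  assumes \<sigma>: "\<And>v. v \<in> P \<Longrightarrow> (\<And>i::nat. i < n \<Longrightarrow> bil (grad x (\<sigma> i)) v = 0) \<Longrightarrow> v = 0"
    and xP: "x \<in> P" and p: "coord_poly p"
    and zero: "\<And>\<eta>. \<eta> \<in> P \<Longrightarrow> peval p (\<lambda>i. poly_eval (\<sigma> i) \<eta>) = 0"
  shows "p = 0"
proof -
  define s where "s i = poly_eval (\<sigma> i)" for i
  have s: "s i \<in> polyfun" for i by (simp add: s_def polyfun_def)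
  \<comment> \<open>The invariants along \<open>P\<close> and the identity in the normal directions:
    a map of the whole space to itself with invertible derivative at \<open>x\<close>, so that its
    image contains a ball.\<close>
  define \<Psi> where "\<Psi> z = (\<Sum>i<n. s i (proj z) *s e i) + (z - proj z)" for z
  define \<Psi>' where "\<Psi>' v = (\<Sum>i<n. dderiv (proj v) (s i) x *s e i) + (v - proj v)" for v
  have px: "proj x = x" by (rule proj_id[OF xP])
  have bproj: "bounded_linear proj" using proj_linear linear_conv_bounded_linear by blast
  have dproj: "(proj has_derivative proj) (at x)" by (rule bounded_linear_imp_has_derivative[OF bproj])
  have der: "(\<Psi> has_derivative \<Psi>') (at x)"
  proof -
    have "((\<lambda>z. s i (proj z) *s e i) has_derivative (\<lambda>v. dderiv (proj v) (s i) x *s e i)) (at x)" for i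
    proof -
      have "(s i has_derivative (\<lambda>v. dderiv v (s i) x)) (at (proj x))"
        unfolding px by (rule has_derivative_dderiv[OF open_UNIV analytic_fun_polyfun[OF s] UNIV_I])
      from has_derivative_compose[OF dproj this]
      have "((\<lambda>z. s i (proj z)) has_derivative (\<lambda>v. dderiv (proj v) (s i) x)) (at x)" .
      moreover have "bounded_linear (\<lambda>t. t *s e i)"
        using linear_smult_left linear_conv_bounded_linear by blast
      ultimately show ?thesis using bounded_linear.has_derivative by blast
    qed
    then show ?thesis unfolding \<Psi>_def[abs_def] \<Psi>'_def[abs_def]
      by (intro has_derivative_add has_derivative_sum has_derivative_diff has_derivative_ident dproj)
  qed
  have projS: "proj (\<Sum>i<n. a i *s e i) = (\<Sum>i<n. a i *s e i)" for a
    by (rule proj_id) (intro P_sum P_smult e_P, simp)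
  have bilS: "bil (e j) (\<Sum>i<n. a i *s e i) = a j" if "j < n" for a j
    using that by (simp add: bil_simps e_orth if_distrib[of "\<lambda>t. _ * t"] cong: if_cong)
  have pd0: "proj (v - proj v) = 0" for v
    using linear_diff[OF proj_linear, of v "proj v"] proj_id[OF proj_P] by simp
  have inj: "inj \<Psi>'"
  proof (rule linear_injective_0[THEN iffD2, rule_format])
    show lin: "linear \<Psi>'" by (rule has_derivative_linear[OF der])
    fix v assume v: "\<Psi>' v = 0"
    then have "proj (\<Psi>' v) = 0" using proj_smult[of 0 v] by simp
    then have S: "(\<Sum>i<n. dderiv (proj v) (s i) x *s e i) = 0"
      unfolding \<Psi>'_def proj_add projS pd0 by simp
    have "bil (grad x (\<sigma> i)) (proj v) = 0" if "i < n" for i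
      using bilS[OF that, of "\<lambda>i. dderiv (proj v) (s i) x"] S bil_grad[OF proj_P] by (simp add: s_def)
    then have "proj v = 0" by (rule \<sigma>[OF proj_P])
    then show "v = 0" using v S by (simp add: \<Psi>'_def)
  qed
  have lin: "linear \<Psi>'" by (rule has_derivative_linear[OF der])
  then have "surj \<Psi>'" using inj linear_injective_imp_surjective by blast
  then obtain g' where g': "linear g'" "\<Psi>' \<circ> g' = id" using linear_surjective_right_inverse[OF lin] by blast
  have "continuous_on UNIV \<Psi>"
  proof -
    have c: "continuous_on UNIV proj" using bproj by (rule linear_continuous_on)
    have "continuous_on UNIV (\<lambda>z. s i (proj z))" for i
      by (rule continuous_on_compose2[OF analytic_fun_continuous[OF analytic_fun_polyfun[OF s]] c, of UNIV]) simp
    then show ?thesis unfolding \<Psi>_def[abs_def] by (intro continuous_intros c)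
  qed
  then have "\<Psi> x \<in> interior (\<Psi> ` UNIV)"
    by (rule sussmann_open_mapping[OF open_UNIV _ UNIV_I der _ g'(2) subset_UNIV])
      (use g'(1) linear_conv_bounded_linear in auto)
  then obtain r where r: "0 < r" "ball (\<Psi> x) r \<subseteq> range \<Psi>" unfolding mem_interior by blast
  define H where "H u = peval p (\<lambda>i. bil (e i) u)" for u
  have Hr: "H u = 0" if u: "u \<in> range \<Psi>" for u
  proof -
    obtain z where z: "u = \<Psi> z" using u by blast
    have "bil (e i) u = s i (proj z)" if i: "i < n" for i
      using bilS[OF i] bil_e_proj[OF i, of z] by (simp add: z \<Psi>_def bil_add_right bil_diff_right)
    then have "H u = peval p (\<lambda>i. s i (proj z))"
      unfolding H_def using p unfolding coord_poly_def by (intro peval_cong_coord) auto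
    then show ?thesis using zero[OF proj_P] by (simp add: s_def)
  qed
  have Han: "analytic_fun H UNIV"
    unfolding H_def[abs_def] peval_def lin_ext_def mono_eval_def
    by (intro analytic_fun_sum analytic_fun_cmult analytic_fun_prod analytic_fun_power analytic_fun_bil)
  have H0: "H u = 0" for u
  proof -
    \<comment> \<open>The identity theorem is applied on the complex line from
      \<open>\<Psi> x\<close> through \<open>u\<close>.\<close>
    define \<gamma> where "\<gamma> t = \<Psi> x + t *s (u - \<Psi> x)" for t
    have cont: "continuous_on UNIV \<gamma>" unfolding \<gamma>_def[abs_def] by (intro continuous_intros)
    have op: "open (\<gamma> -` ball (\<Psi> x) r)" by (rule open_vimage[OF open_ball cont])
    have hol: "(\<lambda>t. H (\<gamma> t)) holomorphic_on UNIV"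
      unfolding holomorphic_on_def field_differentiable_def \<gamma>_def
      by (intro ballI exI, rule has_field_derivative_at_within,
          rule analytic_fun_slice(1)[OF open_UNIV Han UNIV_I])
    have "H (\<gamma> 1) = 0"
    proof (rule analytic_continuation_open[OF op open_UNIV _ connected_UNIV subset_UNIV hol holomorphic_on_const])
      have "0 \<in> \<gamma> -` ball (\<Psi> x) r" using r by (simp add: \<gamma>_def)
      then show "\<gamma> -` ball (\<Psi> x) r \<noteq> {}" by blast
    qed (use Hr r in auto)
    then show ?thesis by (simp add: \<gamma>_def)
  qed
  show ?thesis
  proof (rule peval_eq_zero)
    fix t
    have "peval p t = H (\<Sum>i<n. t i *s e i)"
      unfolding H_def using p bilS unfolding coord_poly_def by (intro peval_cong_coord) auto
    then show "peval p t = 0" by (simp add: H0)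
  qed
qed

section \<open>Quantum integrability\<close>

text \<open>A restricted operator is determined on \<open>U\<close> only. Composites are followed
  through extensions on the fixed set \<open>Om\<close>, where applying an invariant polynomial in
  Dunkl operators again gives an invariant extension.\<close>

definition inv_ext :: "(complex^'n \<Rightarrow> complex) \<Rightarrow> (complex^'n \<Rightarrow> complex) \<Rightarrow> bool" where
  "inv_ext f G \<longleftrightarrow> analytic_fun G Om \<and> (\<forall>w\<in>W. \<forall>z\<in>Om. G (w z) = G z) \<and> (\<forall>u\<in>U. f u = G u)"

lemma inv_ext_ret: "analytic_fun f U \<Longrightarrow> inv_ext f (\<lambda>z. f (ret z))"
  by (simp add: inv_ext_def analytic_ret ret_inv ret_U)

lemma inv_ext_restr:
  assumes f: "inv_ext f G" and s: "invariant_poly R \<sigma>"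
  shows "inv_ext (restr_op R U (pd \<sigma>) f) (pd \<sigma> G)"
proof -
  have G: "analytic_fun G Om" "\<And>w z. w \<in> W \<Longrightarrow> z \<in> Om \<Longrightarrow> G (w z) = G z" "\<And>u. u \<in> U \<Longrightarrow> G u = f u"
    using f by (auto simp: inv_ext_def)
  have fa: "analytic_fun f U" using analytic_fun_cong[OF analytic_fun_subset[OF G(1) U_Om] G(3)] .
  have "restr_op R U (pd \<sigma>) f u = pd \<sigma> G u" if "u \<in> U" for u
    by (rule restr_poly_dunkl[OF fa G(1) _ G(3) that]) (rule G(2))
  moreover have "pd \<sigma> G (w z) = pd \<sigma> G z" if "w \<in> W" "z \<in> Om" for w z
    by (rule poly_dunkl_invariant[OF dom_Om G(1) _ s that(2,1)]) (rule G(2))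
  ultimately show ?thesis by (simp add: inv_ext_def poly_dunkl_analytic[OF dom_Om G(1)])
qed

theorem ops_commute_restr:
  assumes "invariant_poly R \<sigma>" "invariant_poly R \<tau>"
  shows "ops_commute U (restr_op R U (pd \<sigma>)) (restr_op R U (pd \<tau>))"
  unfolding ops_commute_def
proof (intro allI impI ballI)
  fix f x assume f: "analytic_fun f U" and x: "x \<in> U"
  note G = inv_ext_ret[OF f]
  have "restr_op R U (pd \<sigma>) (restr_op R U (pd \<tau>) f) x = pd \<sigma> (pd \<tau> (\<lambda>z. f (ret z))) x"
    using inv_ext_restr[OF inv_ext_restr[OF G assms(2)] assms(1)] x by (simp add: inv_ext_def)
  also have "\<dots> = pd \<tau> (pd \<sigma> (\<lambda>z. f (ret z))) x"
    by (rule poly_dunkl_commute[OF dom_Om analytic_ret[OF f]]) (use x U_Om in blast)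
  also have "\<dots> = restr_op R U (pd \<tau>) (restr_op R U (pd \<sigma>) f) x"
    using inv_ext_restr[OF inv_ext_restr[OF G assms(1)] assms(2)] x by (simp add: inv_ext_def)
  finally show "restr_op R U (pd \<sigma>) (restr_op R U (pd \<tau>) f) x =
    restr_op R U (pd \<tau>) (restr_op R U (pd \<sigma>) f) x" .
qed

text \<open>The operator number \<open>i\<close> lowers the order by \<open>d i\<close> and
  multiplies the leading coefficient by its symbol; the factorials telescope as for
  \<open>lead_op_monom\<close>.\<close>

lemma op_monom_restr_lead:
  assumes x: "x \<in> U" and \<eta>: "\<eta> \<in> P"
    and s: "\<And>i. invariant_poly R (\<sigma> i)" "\<And>i. homogeneous (\<sigma> i) (d i)"
    and f: "inv_ext f G" and G: "lead Om x \<eta> (k + (\<Sum>i\<leftarrow>ks. m i * d i)) C G"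
  shows "\<exists>G'. inv_ext (op_monom ks (\<lambda>i. restr_op R U (pd (\<sigma> i))) m f) G' \<and>
    lead Om x \<eta> k (C * fact (k + (\<Sum>i\<leftarrow>ks. m i * d i)) / fact k * (\<Prod>i\<leftarrow>ks. poly_eval (\<sigma> i) \<eta> ^ m i)) G'"
proof -
  have xO: "x \<in> Om" using x U_Om by blast
  have orth: "bil \<alpha> \<eta> = 0" if "\<alpha> \<in> R" "bil \<alpha> x = 0" for \<alpha> by (rule U_generic[OF x that \<eta>])
  have pow: "\<exists>G'. inv_ext ((restr_op R U (pd (\<sigma> i)) ^^ j) f) G' \<and>
      lead Om x \<eta> k (C * fact (k + j * d i) / fact k * poly_eval (\<sigma> i) \<eta> ^ j) G'"
    if "inv_ext f G" "lead Om x \<eta> (k + j * d i) C G" for i j k C f G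
    using that(2)
  proof (induction j arbitrary: k)
    case (Suc j)
    have "lead Om x \<eta> ((k + d i) + j * d i) C G" using Suc.prems by (simp add: add_ac)
    from Suc.IH[OF this] obtain G' where G': "inv_ext ((restr_op R U (pd (\<sigma> i)) ^^ j) f) G'"
      "lead Om x \<eta> (k + d i) (C * fact (k + d i + j * d i) / fact (k + d i) * poly_eval (\<sigma> i) \<eta> ^ j) G'"
      by blast
    have hom: "\<And>m. m \<in> Poly_Mapping.keys (\<sigma> i) \<Longrightarrow> sum_list (map (Poly_Mapping.lookup m) ixs) = d i"
      using s(2)[of i] by (simp add: homogeneous_def mdeg_def)
    have L: "lead Om x \<eta> k ((C * fact (k + d i + j * d i) / fact (k + d i) * poly_eval (\<sigma> i) \<eta> ^ j) *
        fact (k + d i) / fact k * poly_eval (\<sigma> i) \<eta>) (pd (\<sigma> i) G')"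
      by (rule lead_poly_dunkl[OF dom_Om xO orth hom G'(2)])
    have eq: "(C * fact (k + d i + j * d i) / fact (k + d i) * poly_eval (\<sigma> i) \<eta> ^ j) *
        fact (k + d i) / fact k * poly_eval (\<sigma> i) \<eta> =
        C * fact (k + Suc j * d i) / fact k * poly_eval (\<sigma> i) \<eta> ^ Suc j"
      by (simp add: add_ac)
    have "inv_ext ((restr_op R U (pd (\<sigma> i)) ^^ Suc j) f) (pd (\<sigma> i) G')"
      using inv_ext_restr[OF G'(1) s(1)] by simp
    with L show ?case unfolding eq by blast
  qed (use that(1) in \<open>auto simp: lead_def\<close>)
  show ?thesis using f G
  proof (induction ks arbitrary: f G C)
    case (Cons i ks)
    define l where "l = k + (\<Sum>i\<leftarrow>ks. m i * d i)"
    have "lead Om x \<eta> (l + m i * d i) C G" using Cons.prems(2) by (simp add: l_def add_ac)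
    from pow[OF Cons.prems(1) this] obtain G1 where G1: "inv_ext ((restr_op R U (pd (\<sigma> i)) ^^ m i) f) G1"
      "lead Om x \<eta> l (C * fact (l + m i * d i) / fact l * poly_eval (\<sigma> i) \<eta> ^ m i) G1" by blast
    from Cons.IH[OF G1[unfolded l_def]] obtain G' where
      G': "inv_ext (op_monom (i # ks) (\<lambda>i. restr_op R U (pd (\<sigma> i))) m f) G'"
      "lead Om x \<eta> k ((C * fact (l + m i * d i) / fact l * poly_eval (\<sigma> i) \<eta> ^ m i) * fact l / fact k *
        (\<Prod>i\<leftarrow>ks. poly_eval (\<sigma> i) \<eta> ^ m i)) G'"
      unfolding op_monom_Cons l_def by blast
    have eq: "(C * fact (l + m i * d i) / fact l * poly_eval (\<sigma> i) \<eta> ^ m i) * fact l / fact k *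
        (\<Prod>i\<leftarrow>ks. poly_eval (\<sigma> i) \<eta> ^ m i) =
        C * fact (k + (\<Sum>i\<leftarrow>i # ks. m i * d i)) / fact k * (\<Prod>i\<leftarrow>i # ks. poly_eval (\<sigma> i) \<eta> ^ m i)"
      by (simp add: l_def add_ac)
    show ?case using G' unfolding eq by blast
  qed auto
qed

text \<open>A relation between the operators is tested on powers \<open>(\<eta>, y - x) ^ w\<close>, where \<open>w\<close> is the
  top weight of the relation; at \<open>x\<close> only the top weight part of the symbols survives.\<close>

theorem quantum_integrable_laplacian: "quantum_integrable n e U (restr_op R U (dunkl_laplacian Rp c))"
proof -
  obtain x \<sigma> d where x: "x \<in> U" and s0: "\<sigma> 0 = sq_poly" and inv: "\<And>i. invariant_poly R (\<sigma> i)"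
    and hom: "\<And>i. homogeneous (\<sigma> i) (d i)"
    and nondeg: "\<And>v. v \<in> P \<Longrightarrow> (\<And>i::nat. i < n \<Longrightarrow> bil (grad x (\<sigma> i)) v = 0) \<Longrightarrow> v = 0"
    using independent_invariants by blast
  have xP: "x \<in> P" and xV: "x \<in> V" and xO: "x \<in> Om" using x U_P U_V U_Om by auto
  define L where "L i = restr_op R U (pd (\<sigma> i))" for i
  have "ops_alg_independent n U L"
    unfolding ops_alg_independent_def
  proof (intro allI impI)
    fix p :: "nat mpoly"
    assume p: "\<forall>m\<in>Poly_Mapping.keys p. Poly_Mapping.keys m \<subseteq> {..<n}"
      and zero: "\<forall>f. analytic_fun f U \<longrightarrow> (\<forall>x\<in>U. op_poly [0..<n] L p f x = 0)"
    show "p = 0"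
    proof (rule ccontr)
      assume "p \<noteq> 0"
      then have ne: "Poly_Mapping.keys p \<noteq> {}" by simp
      \<comment> \<open>The degree in \<open>\<eta>\<close> of the symbol belonging to the monomial,
        since \<open>\<sigma> i\<close> is homogeneous of degree \<open>d i\<close>.\<close>
      define wt where "wt m = (\<Sum>i\<leftarrow>[0..<n]. Poly_Mapping.lookup m i * d i)" for m
      define w where "w = Max (wt ` Poly_Mapping.keys p)"
      have w: "wt m \<le> w" if "m \<in> Poly_Mapping.keys p" for m using that by (simp add: w_def)
      have "w \<in> wt ` Poly_Mapping.keys p" unfolding w_def using ne by (intro Max_in) auto
      then obtain m0 where m0: "m0 \<in> Poly_Mapping.keys p" "wt m0 = w" by blast
      define top where "top = part (\<lambda>m. wt m = w) p"
      have "top = 0"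
      proof (rule invariants_alg_independent[OF nondeg xP])
        show "coord_poly top" using p by (auto simp: top_def coord_poly_def keys_part)
        fix \<eta> assume \<eta>: "\<eta> \<in> P"
        define f where "f y = (bil \<eta> y - bil \<eta> x) ^ w" for y
        have f: "analytic_fun f U" unfolding f_def[abs_def]
          by (intro analytic_fun_power analytic_fun_diff analytic_fun_bil analytic_fun_const)
        define G where "G z = f (ret z)" for z
        have ext: "inv_ext f G" unfolding G_def[abs_def] by (rule inv_ext_ret[OF f])
        have GV: "G z = (bil \<eta> z - bil \<eta> x) ^ w" if "z \<in> V" for z
          using bil_proj_swap[of \<eta> z] proj_id[OF \<eta>] that by (simp add: G_def f_def ret_V)
        have "vord (1 * w) (\<lambda>z. (bil \<eta> z - bil \<eta> x) ^ w) x" by (rule vord_power[OF vord_bil])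
        then have "vord (1 * w) G x" by (rule vord_cong[OF _ open_V xV]) (simp add: GV)
        then have vG: "vord w G x" by simp
        have lead: "lead Om x \<eta> w 1 G"
          unfolding lead_def
        proof (intro conjI ballI)
          show "analytic_fun G Om" using ext by (simp add: inv_ext_def)
          show "vord w G y" if "y \<in> orb x" for y
            by (rule vord_orbit[OF dom_Om xO _ vG that]) (use ext in \<open>auto simp: inv_ext_def\<close>)
          show "vord (Suc w) (\<lambda>z. G z - 1 * (bil \<eta> z - bil \<eta> x) ^ w) x"
            by (rule vord_cong[OF vord_zero_fun open_V xV]) (simp add: GV)
        qed
        have val: "op_monom [0..<n] L (Poly_Mapping.lookup m) f x =
            (if wt m = w then fact w * mono_eval m (\<lambda>i. poly_eval (\<sigma> i) \<eta>) else 0)"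
          if m: "m \<in> Poly_Mapping.keys p" for m
        proof -
          define Q where "Q = (\<Prod>i\<leftarrow>[0..<n]. poly_eval (\<sigma> i) \<eta> ^ Poly_Mapping.lookup m i)"
          \<comment> \<open>The subtraction does not truncate, as \<open>w\<close> is the maximal
            weight.\<close>
          have wk: "(w - wt m) + (\<Sum>i\<leftarrow>[0..<n]. Poly_Mapping.lookup m i * d i) = w"
            using w[OF m] by (simp add: wt_def)
          have "lead Om x \<eta> ((w - wt m) + (\<Sum>i\<leftarrow>[0..<n]. Poly_Mapping.lookup m i * d i)) 1 G"
            unfolding wk by (rule lead)
          from op_monom_restr_lead[OF x \<eta> inv hom ext this]
          have "\<exists>G'. inv_ext (op_monom [0..<n] L (Poly_Mapping.lookup m) f) G' \<and>
              lead Om x \<eta> (w - wt m) (1 * fact w / fact (w - wt m) * Q) G'"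
            unfolding wk L_def[abs_def] Q_def .
          then obtain G' where G': "inv_ext (op_monom [0..<n] L (Poly_Mapping.lookup m) f) G'"
            "lead Om x \<eta> (w - wt m) (1 * fact w / fact (w - wt m) * Q) G'"
            by (elim exE conjE)
          have Q: "Q = mono_eval m (\<lambda>i. poly_eval (\<sigma> i) \<eta>)"
          proof -
            have "Q = (\<Prod>i<n. poly_eval (\<sigma> i) \<eta> ^ Poly_Mapping.lookup m i)"
              unfolding Q_def using prod.distinct_set_conv_list[of "[0..<n]" "\<lambda>i. poly_eval (\<sigma> i) \<eta> ^ Poly_Mapping.lookup m i"]
              by (simp add: lessThan_atLeast0)
            then show ?thesis using mono_eval_superset[of "{..<n}" m] p m by simp
          qed
          have "op_monom [0..<n] L (Poly_Mapping.lookup m) f x = G' x" using G'(1) x by (simp add: inv_ext_def)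
          \<comment> \<open>For smaller weight a positive power of the linear form is left, which is
            zero at \<open>x\<close>.\<close>
          then show ?thesis using lead_value[OF G'(2)] w[OF m] by (auto simp: Q)
        qed
        have "0 = op_poly [0..<n] L p f x" using zero f x by simp
        also have "\<dots> = (\<Sum>m\<in>Poly_Mapping.keys p. Poly_Mapping.lookup p m *
            (if wt m = w then fact w * mono_eval m (\<lambda>i. poly_eval (\<sigma> i) \<eta>) else 0))"
          unfolding op_poly_def by (rule sum.cong) (simp_all add: val)
        also have "\<dots> = fact w * peval top (\<lambda>i. poly_eval (\<sigma> i) \<eta>)"
          unfolding top_def peval_def lin_ext_part sum_distrib_left by (rule sum.cong) auto
        finally show "peval top (\<lambda>i. poly_eval (\<sigma> i) \<eta>) = 0" by simp
      qed
      then have "Poly_Mapping.lookup top m0 = 0" by simp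
      then show False using m0 by (simp add: top_def lookup_part in_keys_iff)
    qed
  qed
  moreover have "L 0 = restr_op R U (dunkl_laplacian Rp c)" by (simp add: L_def s0 dunkl_laplacian_eq)
  moreover have "\<forall>i<n. diff_op n e U (L i)" by (simp add: L_def diff_op_restr)
  moreover have "\<forall>i<n. \<forall>j<n. ops_commute U (L i) (L j)" by (simp add: L_def ops_commute_restr inv)
  ultimately show ?thesis unfolding quantum_integrable_def by blast
qed

end

section \<open>Passage from a simple system to the final statement\<close>

lemma simple_system_stratum:
  fixes R \<Delta> \<Gamma>\<^sub>0 P U :: "(complex^'n) set"
  assumes rs: "root_system R" and ss: "simple_system R \<Delta>" and c: "invariant_multiplicity R c"
    and G: "\<Gamma>\<^sub>0 \<subseteq> \<Delta>" and P: "P = {x. \<forall>\<beta>\<in>\<Gamma>\<^sub>0. bil \<beta> x = 0}"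
    and I: "cherednik_invariant R (positive_roots R \<Delta>) c (vanishing_ideal (orbit_union R P))"
    and co: "orthonormal_coords P n e" and U: "small_neighbourhood R P x\<^sub>0 U"
  shows "stratum R (positive_roots R \<Delta>) c \<Gamma>\<^sub>0 P U n e"
proof unfold_locales
  have D: "\<Delta> \<subseteq> R" "independent \<Delta>" using ss by (auto simp: simple_system_def)
  have finD: "finite \<Delta>" using D(1) rs finite_subset by (auto simp: root_system_def)
  fix \<alpha> assume "\<alpha> \<in> positive_roots R \<Delta>"
  then obtain k where k: "\<alpha> \<in> R" "\<forall>\<delta>\<in>\<Delta>. 0 \<le> k \<delta>" "\<alpha> = (\<Sum>\<delta>\<in>\<Delta>. k \<delta> *\<^sub>R \<delta>)"
    unfolding positive_roots_def by blast
  show "- \<alpha> \<notin> positive_roots R \<Delta>"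
  proof
    assume "- \<alpha> \<in> positive_roots R \<Delta>"
    then obtain k' where k': "\<forall>\<delta>\<in>\<Delta>. 0 \<le> k' \<delta>" "- \<alpha> = (\<Sum>\<delta>\<in>\<Delta>. k' \<delta> *\<^sub>R \<delta>)"
      unfolding positive_roots_def by blast
    \<comment> \<open>If a root and its negative were both positive, the two expansions would add up
      to zero; independence and nonnegativity then make every coefficient vanish.\<close>
    have "(\<Sum>\<delta>\<in>\<Delta>. (k \<delta> + k' \<delta>) *\<^sub>R \<delta>) = \<alpha> + - \<alpha>"
      unfolding k'(2) by (subst k(3)) (simp add: scaleR_left_distrib sum.distrib)
    then have z: "(\<Sum>\<delta>\<in>\<Delta>. (k \<delta> + k' \<delta>) *\<^sub>R \<delta>) = 0" by simp
    have "k \<delta> = 0" if "\<delta> \<in> \<Delta>" for \<delta>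
    proof -
      have "k \<delta> + k' \<delta> = 0" using independentD[OF D(2) finD order_refl z that] .
      then show ?thesis using k(2) k'(1) that by (simp add: add_nonneg_eq_0_iff)
    qed
    then have "\<alpha> = 0" using k(3) by simp
    then show False using k(1) rs by (simp add: root_system_def)
  qed
next
  show "U \<noteq> {}" using U by (auto simp: small_neighbourhood_def)
  show "openin (top_of_set P) U" using U by (simp add: small_neighbourhood_def)
  show "w ` U \<inter> U = {} \<or> (\<forall>u\<in>U. w u = u)" if "w \<in> refl_group R" for w
    using U that by (simp add: small_neighbourhood_def)
  show "\<alpha> \<in> positive_roots R \<Delta> \<or> - \<alpha> \<in> positive_roots R \<Delta>" if "\<alpha> \<in> R" for \<alpha>
    using ss that by (simp add: simple_system_def)
  show "\<Gamma>\<^sub>0 \<subseteq> R" using G ss by (auto simp: simple_system_def)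
qed (use assms in \<open>auto simp: positive_roots_def\<close>)

theorem theorem5:
  fixes R \<Delta> \<Gamma>\<^sub>0 P U :: "(complex^'n) set"
    and c :: "complex^'n \<Rightarrow> complex"
    and x\<^sub>0 :: "complex^'n"
    and n :: nat
    and e :: "nat \<Rightarrow> complex^'n"
  assumes "root_system R"
    and "simple_system R \<Delta>"
    and "invariant_multiplicity R c"
    and "\<Gamma>\<^sub>0 \<subseteq> \<Delta>"
    and "P = {x. \<forall>\<beta>\<in>\<Gamma>\<^sub>0. bil \<beta> x = 0}"
    and "cherednik_invariant R (positive_roots R \<Delta>) c (vanishing_ideal (orbit_union R P))"
    and "orthonormal_coords P n e"
    and "generic_point R P x\<^sub>0"
    and "small_neighbourhood R P x\<^sub>0 U"
  shows "(\<forall>f. analytic_fun f U \<longrightarrow> (\<forall>x\<in>U.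
            restr_op R U (dunkl_laplacian (positive_roots R \<Delta>) c) f x =
              (\<Sum>i<n. dderiv (e i) (dderiv (e i) f) x) -
              (\<Sum>\<alpha>\<in>{\<alpha> \<in> positive_roots R \<Delta>. orth_proj P \<alpha> \<noteq> 0}.
                 2 * c \<alpha> / bil (orth_proj P \<alpha>) x * dderiv (orth_proj P \<alpha>) f x)))
       \<and> (\<forall>\<sigma> \<tau>. invariant_poly R \<sigma> \<and> invariant_poly R \<tau> \<longrightarrow>
            diff_op n e U (restr_op R U (poly_dunkl (positive_roots R \<Delta>) c \<sigma>)) \<and>
            diff_op n e U (restr_op R U (poly_dunkl (positive_roots R \<Delta>) c \<tau>)) \<and>
            ops_commute U (restr_op R U (poly_dunkl (positive_roots R \<Delta>) c \<sigma>))
                          (restr_op R U (poly_dunkl (positive_roots R \<Delta>) c \<tau>)))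
       \<and> quantum_integrable n e U (restr_op R U (dunkl_laplacian (positive_roots R \<Delta>) c))"
proof -
  interpret stratum R "positive_roots R \<Delta>" c \<Gamma>\<^sub>0 P U n e
    by (rule simple_system_stratum[OF assms(1-7,9)])
  show ?thesis
    using restr_laplacian diff_op_restr ops_commute_restr quantum_integrable_laplacian by blast
qed

end
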